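(* In the Hill problem, there exists $\hat L>0$ such that for every $L\ge\hat L$ and every $n\in\mathbb{N}$ (with $n\ge1$), setting $K=L\,n^{2/3}$, there exist exactly four $n$-ejection-collision orbits ($n$-EC orbits) with first integral equal to $K$, which can be characterized by: (i) two $n$-EC orbits, each itself symmetric with respect to the $x_h$ axis, and one symmetric to the other with respect to the $y_h$ axis; (ii) two $n$-EC orbits, each itself symmetric with respect to the $y_h$ axis, and one symmetric to the other with respect to the $x_h$ axis. The respective families are labelled $\alpha_n,\gamma_n$ (those in (i)) and $\beta_n,\delta_n$ (those in (ii)).
   Context: Hill problem: the particle $(x_h(t),y_h(t))$ satisfies $$\ddot x_h-2\dot y_h=\Psi_{x_h},\qquad \ddot y_h+2\dot x_h=\Psi_{y_h},\qquad \Psi(x_h,y_h)=\tfrac32x_h^2+\frac{1}{\sqrt{x_h^2+y_h^2}},$$ with first integral $K=2\Psi(x_h,y_h)-\dot x_h^2-\dot y_h^2$. The primary $P_h$ is at the origin. Collisions with $P_h$ are regularized by the Levi-Civita change $x_h=u_h^2-v_h^2$, $y_h=2u_hv_h$, $dt/ds=4(u_h^2+v_h^2)$; for fixed $K$ the regularized equations are ($'=d/ds$) $$u_h''-8(u_h^2+v_h^2)v_h'=\partial_{u_h}\big(4(u_h^2+v_h^2)\,\mathcal U_h\big),\quad v_h''+8(u_h^2+v_h^2)u_h'=\partial_{v_h}\big(4(u_h^2+v_h^2)\,\mathcal U_h\big),$$ $$\mathcal U_h=\tfrac32(u_h^2-v_h^2)^2+\frac1{u_h^2+v_h^2}-\frac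 K2,$$ with $u_h'^2+v_h'^2=8(u_h^2+v_h^2)\,\mathcal U_h$, so $u_h'^2+v_h'^2=8$ at $u_h=v_h=0$. Ejection orbits are the solutions starting at $u_h=v_h=0$; $(u_h,v_h)$ and $(-u_h,-v_h)$ represent the same point of the $(x_h,y_h)$ plane, and orbits are counted in the $(x_h,y_h)$ plane. An $n$-EC orbit is the orbit described by a particle that ejects from $P_h$ (starts at collision with $P_h$) and whose distance to $P_h$ reaches $n$ times a relative maximum before the particle collides with $P_h$. Symmetries of orbits refer to their projections to the $(x_h,y_h)$ plane. *)

theory Defs
  imports "HOL-Analysis.Analysis"
begin

definition hill_Psi :: "real \<Rightarrow> real \<Rightarrow> real" where
  "hill_Psi x y = 3/2 * x\<^sup>2 + 1 / sqrt (x\<^sup>2 + y\<^sup>2)"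

definition hill_first_integral :: "real \<Rightarrow> real \<Rightarrow> real \<Rightarrow> real \<Rightarrow> real" where
  "hill_first_integral x y xd yd = 2 * hill_Psi x y - xd\<^sup>2 - yd\<^sup>2"

fun levi_civita :: "real \<times> real \<Rightarrow> real \<times> real" where
  "levi_civita (u, v) = (u\<^sup>2 - v\<^sup>2, 2 * u * v)"

definition reg_U :: "real \<Rightarrow> real \<Rightarrow> real \<Rightarrow> real" where
  "reg_U K u v = 3/2 * (u\<^sup>2 - v\<^sup>2)\<^sup>2 + 1 / (u\<^sup>2 + v\<^sup>2) - K / 2"

text \<open>The continuous extension of \<open>4 (u\<^sup>2 + v\<^sup>2) reg_U K u v\<close> to the origin. It has to be multiplied
  out, because \<open>1 / 0 = 0\<close> would give the product the value \<open>0\<close> instead of \<open>4\<close> at collision.\<close>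

definition reg_W :: "real \<Rightarrow> real \<Rightarrow> real \<Rightarrow> real" where
  "reg_W K u v = 6 * (u\<^sup>2 + v\<^sup>2) * (u\<^sup>2 - v\<^sup>2)\<^sup>2 + 4 - 2 * K * (u\<^sup>2 + v\<^sup>2)"

lemma reg_W_eq:
  assumes "(u, v) \<noteq> (0, 0)"
  shows "reg_W K u v = 4 * (u\<^sup>2 + v\<^sup>2) * reg_U K u v"
proof -
  have "u\<^sup>2 + v\<^sup>2 \<noteq> 0" using assms by (simp add: sum_power2_eq_zero_iff)
  moreover have "6 * r * d + 4 - 2 * K * r = 4 * r * (3/2 * d + 1 / r - K / 2)" if "r \<noteq> 0" for r d :: real
    using that by (simp add: field_simps)
  ultimately show ?thesis unfolding reg_W_def reg_U_def by blast
qed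

lemma reg_U_eq_Psi: "reg_U K u v = hill_Psi (u\<^sup>2 - v\<^sup>2) (2 * u * v) - K / 2"
proof -
  have "(u\<^sup>2 - v\<^sup>2)\<^sup>2 + (2 * u * v)\<^sup>2 = (u\<^sup>2 + v\<^sup>2)\<^sup>2" by algebra
  then have "sqrt ((u\<^sup>2 - v\<^sup>2)\<^sup>2 + (2 * u * v)\<^sup>2) = u\<^sup>2 + v\<^sup>2" by simp
  then show ?thesis by (simp add: reg_U_def hill_Psi_def)
qed

text \<open>\<open>u'\<close>, \<open>v'\<close> are the derivatives with respect to the regularized time \<open>s\<close>; one-sided at the
  ends of \<open>{0..S}\<close>. The last conjunct fixes the value \<open>K\<close> of the first integral, see
  \<open>reg_energy_iff\<close> below.\<close>

definition reg_hill_solution ::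
  "real \<Rightarrow> real \<Rightarrow> (real \<Rightarrow> real) \<Rightarrow> (real \<Rightarrow> real) \<Rightarrow> bool" where
  "reg_hill_solution K S u v \<longleftrightarrow> (\<exists>u' v'. \<forall>s\<in>{0..S}.
     (u has_real_derivative u' s) (at s within {0..S}) \<and>
     (v has_real_derivative v' s) (at s within {0..S}) \<and>
     (u' has_real_derivative
        8 * ((u s)\<^sup>2 + (v s)\<^sup>2) * v' s + deriv (\<lambda>a. reg_W K a (v s)) (u s)) (at s within {0..S}) \<and>
     (v' has_real_derivative
        - 8 * ((u s)\<^sup>2 + (v s)\<^sup>2) * u' s + deriv (\<lambda>b. reg_W K (u s) b) (v s)) (at s within {0..S}) \<and>
     (u' s)\<^sup>2 + (v' s)\<^sup>2 = 2 * reg_W K (u s) (v s))"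

text \<open>Physical velocities are \<open>s\<close>-derivatives divided by \<open>dt/ds = 4 (u\<^sup>2 + v\<^sup>2)\<close>.\<close>

lemma reg_energy_iff:
  assumes "(u, v) \<noteq> (0, 0)"
  shows "p\<^sup>2 + q\<^sup>2 = 2 * reg_W K u v \<longleftrightarrow>
    hill_first_integral (u\<^sup>2 - v\<^sup>2) (2 * u * v)
      ((2 * u * p - 2 * v * q) / (4 * (u\<^sup>2 + v\<^sup>2)))
      ((2 * u * q + 2 * v * p) / (4 * (u\<^sup>2 + v\<^sup>2))) = K"
proof -
  define r where "r = u\<^sup>2 + v\<^sup>2"
  have r: "r \<noteq> 0" using assms by (simp add: r_def sum_power2_eq_zero_iff)
  have W: "2 * reg_W K u v = 8 * r * reg_U K u v"
    using reg_W_eq[OF assms, of K] by (simp add: r_def)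
  have Psi: "2 * hill_Psi (u\<^sup>2 - v\<^sup>2) (2 * u * v) = 2 * reg_U K u v + K"
    by (simp add: reg_U_eq_Psi)
  have "(2 * u * p - 2 * v * q)\<^sup>2 + (2 * u * q + 2 * v * p)\<^sup>2 = 4 * r * (p\<^sup>2 + q\<^sup>2)"
    unfolding r_def by algebra
  then have "((2 * u * p - 2 * v * q) / (4 * r))\<^sup>2 + ((2 * u * q + 2 * v * p) / (4 * r))\<^sup>2
      = (p\<^sup>2 + q\<^sup>2) / (4 * r)"
    using r by (simp add: power_divide add_divide_distrib [symmetric] field_simps power2_eq_square)
  then have "hill_first_integral (u\<^sup>2 - v\<^sup>2) (2 * u * v)
      ((2 * u * p - 2 * v * q) / (4 * r)) ((2 * u * q + 2 * v * p) / (4 * r))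
      = 2 * reg_U K u v + K - (p\<^sup>2 + q\<^sup>2) / (4 * r)"
    unfolding hill_first_integral_def Psi by linarith
  moreover have "p\<^sup>2 + q\<^sup>2 = 8 * r * reg_U K u v \<longleftrightarrow>
      2 * reg_U K u v + K - (p\<^sup>2 + q\<^sup>2) / (4 * r) = K"
    using r by (auto simp: field_simps)
  ultimately show ?thesis unfolding r_def[symmetric] W by simp
qed

text \<open>A motion is a pair \<open>(S, q)\<close> of a final time and a curve \<open>q\<close> in the \<open>(x, y)\<close> plane on
  \<open>{0..S}\<close>. Its parameter is the regularized time; since \<open>dt/ds = 4 * norm (q s)\<close> is determined by
  \<open>q\<close>, two motions are equal iff they are equal as functions of the physical time. As \<open>q\<close> is the
  projected curve, \<open>(u, v)\<close> and \<open>(-u, -v)\<close> give the same motion.\<close>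

type_synonym motion = "real \<times> (real \<Rightarrow> real \<times> real)"

definition local_max_times :: "motion \<Rightarrow> real set" where
  "local_max_times m = (case m of (S, q) \<Rightarrow>
     {s \<in> {0<..<S}. \<forall>\<^sub>F s' in at s. norm (q s') \<le> norm (q s)})"

definition EC_motions :: "nat \<Rightarrow> real \<Rightarrow> motion set" where
  "EC_motions n K = {m. \<exists>S u v.
     0 < S \<and> reg_hill_solution K S u v \<and>
     (\<forall>s\<in>{0..S}. (u s, v s) = (0, 0) \<longleftrightarrow> s = 0 \<or> s = S) \<and>
     m = (S, restrict (\<lambda>s. levi_civita (u s, v s)) {0..S}) \<and>
     finite (local_max_times m) \<and> card (local_max_times m) = n}"

definition orbit :: "motion \<Rightarrow> (real \<times> real) set" where
  "orbit m = (case m of (S, q) \<Rightarrow> q ` {0..S})"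

fun reflect_x_axis :: "real \<times> real \<Rightarrow> real \<times> real" where
  "reflect_x_axis (x, y) = (x, - y)"

fun reflect_y_axis :: "real \<times> real \<Rightarrow> real \<times> real" where
  "reflect_y_axis (x, y) = (- x, y)"

end

theory Submission
  imports Defs
begin

text \<open>In the scaled time \<open>t = 2 sqrt K s\<close> the regularized equations are a small perturbation, with
  parameter \<open>\<epsilon> = K powr (- 3/2) = L powr (- 3/2) / n\<close>, of the oscillator \<open>w'' = - w\<close>. The ejection orbit
  with angle \<open>\<theta>\<close> is \<open>e\<^sup>i\<^sup>\<theta> w\<close> with \<open>w\<close> close to \<open>sin t\<close>; on the \<open>n\<close> half-periods that matter the error is of order
  \<open>\<epsilon> n = L powr (- 3/2)\<close>, uniformly in \<open>n\<close>, and so is its Lipschitz constant in \<open>\<theta>\<close>. The distance to the primary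
  therefore has one maximum per half-period, and a collision after \<open>n\<close> maxima happens iff the inertial
  angular momentum vanishes at the \<open>n\<close>-th close approach. The tidal term is the only source of angular momentum,
  which is thus a negative multiple of \<open>\<integral> \<bar>w\<bar>\<^sup>2 Im (e\<^sup>4\<^sup>i\<^sup>\<theta> w\<^sup>4) dt\<close>, that is, nearly of
  \<open>sin (4 \<theta>) \<integral> sin\<^sup>6 t dt\<close>. Hence there is exactly one zero near each multiple of \<open>\<pi>/4\<close>, which gives four orbits since
  \<open>\<theta>\<close> and \<open>\<theta> + \<pi>\<close> describe the same motion. By uniqueness each of them is invariant under the reversing
  reflection that preserves its \<open>\<theta>\<close>-window. The same symmetry and the steady Coriolis drift show that
  all these orbits eject on one side of the symmetry axis and arrive on the other, so that no
  ejection-collision orbit can be continued to a longer one; the \<open>n\<close>-th close approach is the first collision.\<close>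

section \<open>Ordinary differential equations\<close>

text \<open>The obstacle is a mismatch of orders. After n half-periods the deviation from
  \<open>sin t\<close> is of order \<epsilon> n, mostly from the Coriolis force, while the angular
  momentum that decides about a collision is at most of order \<epsilon>^2 n: a direct estimate of
  the miss distance would drown in the error. The quartic term of \<open>ang_mom\<close> therefore
  absorbs the Coriolis force exactly. After division by -12 \<epsilon>^2 the torque itself is the
  derivative, and the closeness to \<open>sin t\<close> enters only as a small relative error.
  Uniqueness of zeros would usually call for derivatives with respect to the angle. Instead each
  comparison with the oscillator is made twice: for one angle, with an error of order
  \<open>e\<close>, and for the difference of two angles, with an error of order
  \<open>e * \<bar>\<theta> - \<theta>'\<bar>\<close>. The second form replaces C^1 closeness and
  needs no differentiable dependence on parameters. In the coordinates of variation of constants the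
  vector field is of order \<epsilon>, so that a single contraction covers all n
  half-periods.\<close>

lemma picard_on_ball:
  fixes f :: "real \<Rightarrow> 'a::euclidean_space \<Rightarrow> 'a"
  assumes T: "0 \<le> T" and r: "0 \<le> r"
    and cont: "continuous_on ({0..T} \<times> cball y0 r) (\<lambda>(t, y). f t y)"
    and bound: "\<And>t y. t \<in> {0..T} \<Longrightarrow> y \<in> cball y0 r \<Longrightarrow> norm (f t y) \<le> m"
    and lip: "\<And>t x y. t \<in> {0..T} \<Longrightarrow> x \<in> cball y0 r \<Longrightarrow> y \<in> cball y0 r \<Longrightarrow>
                dist (f t x) (f t y) \<le> l * dist x y"
    and mT: "m * T \<le> r" and lT: "0 \<le> l" "l * T < 1"
  shows "\<exists>y. y 0 = y0 \<and> (\<forall>t\<in>{0..T}. y t \<in> cball y0 r \<and>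
           (y has_vector_derivative f t (y t)) (at t within {0..T}))"
proof -
  \<comment> \<open>Time is clamped to \<open>{0..T}\<close> so that the curves can be taken from
    the complete space of bounded continuous functions on the whole line; outside the interval the
    integral operator is constant.\<close>
  define cl where "cl t = min (max t 0) T" for t :: real
  have cl: "cl t \<in> {0..T}" for t using T by (auto simp: cl_def)
  have contcl: "continuous_on UNIV cl" unfolding cl_def by (intro continuous_intros)
  define X where "X = {y :: real \<Rightarrow>\<^sub>C 'a. \<forall>t. y t \<in> cball y0 r}"
  define g where "g y s = f s (apply_bcontfun y s)" for y s
  define F where "F y t = y0 + integral {0..cl t} (g y)" for y t
  have gcont: "continuous_on {0..T} (g y)" if "y \<in> X" for y
  proof -
    have "continuous_on {0..T} (\<lambda>s. (s, apply_bcontfun y s))"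
      by (intro continuous_intros continuous_on_apply_bcontfun)
    moreover have "(\<lambda>s. (s, apply_bcontfun y s)) ` {0..T} \<subseteq> {0..T} \<times> cball y0 r"
      using that by (auto simp: X_def)
    ultimately show ?thesis
      using continuous_on_compose2[OF cont, of "{0..T}" "\<lambda>s. (s, apply_bcontfun y s)"]
      by (simp add: g_def)
  qed
  have sub: "{0..cl t} \<subseteq> {0..T}" for t using cl[of t] by auto
  have gint: "g y integrable_on {0..cl t}" if "y \<in> X" for y t
    using gcont[OF that] sub continuous_on_subset integrable_continuous_real by blast
  have Fin: "F y t \<in> cball y0 r" if "y \<in> X" for y t
  proof -
    have "norm (integral {0..cl t} (g y)) \<le> m * (cl t - 0)"
    proof (rule integral_bound)
      show "0 \<le> cl t" using cl[of t] by simp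
      show "continuous_on {0..cl t} (g y)" using gcont[OF that] sub continuous_on_subset by blast
      show "norm (g y s) \<le> m" if "s \<in> {0..cl t}" for s
        unfolding g_def using bound[of s "y s"] \<open>y \<in> X\<close> that subsetD[OF sub that] by (auto simp: X_def)
    qed
    also have "\<dots> \<le> m * T"
    proof -
      have "0 \<le> m" using bound[of 0 y0] T r norm_ge_zero[of "f 0 y0"] by (simp del: norm_ge_zero)
      then show ?thesis using cl[of t] by (simp add: mult_left_mono)
    qed
    finally show ?thesis using mT by (simp add: F_def dist_norm)
  qed
  have Fcont: "continuous_on UNIV (F y)" if "y \<in> X" for y
  proof -
    have "continuous_on {0..T} (\<lambda>x. integral {0..x} (g y))"
      by (rule indefinite_integral_continuous_1) (use gcont[OF that] integrable_continuous_real in blast)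
    then have "continuous_on UNIV (\<lambda>t. integral {0..cl t} (g y))"
      by (rule continuous_on_compose2[OF _ contcl]) (use cl in auto)
    then show ?thesis unfolding F_def by (intro continuous_intros)
  qed
  have Fb: "F y \<in> bcontfun" if "y \<in> X" for y
    unfolding bcontfun_def using Fcont[OF that] Fin[OF that]
    by (auto intro: bounded_subset[OF bounded_cball[of y0 r]])
  define \<Phi> where "\<Phi> y = Bcontfun (F y)" for y
  have app: "apply_bcontfun (\<Phi> y) = F y" if "y \<in> X" for y
    unfolding \<Phi>_def using Fb[OF that] by (rule Bcontfun_inverse)
  have "complete X"
  proof -
    have "closed X"
    proof -
      have "X = (\<Inter>t. {y. dist y0 (apply_bcontfun y t) \<le> r})" by (auto simp: X_def)
      moreover have "closed {y. dist y0 (apply_bcontfun y t) \<le> r}" for t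
      proof (rule closed_Collect_le)
        have "continuous_on UNIV (\<lambda>y. apply_bcontfun y t)"
          unfolding continuous_on_iff by (meson dist_bounded order_le_less_trans)
        then show "continuous_on UNIV (\<lambda>y. dist y0 (apply_bcontfun y t))"
          by (intro continuous_intros)
      qed simp
      ultimately show ?thesis by (simp only:) (intro closed_INT ballI)
    qed
    then show ?thesis by (simp add: complete_eq_closed)
  qed
  moreover have "X \<noteq> {}"
  proof -
    have "const_bcontfun y0 \<in> X" using r by (simp add: X_def const_bcontfun.rep_eq)
    then show ?thesis by blast
  qed
  moreover have "\<Phi> ` X \<subseteq> X"
    using app Fin by (auto simp: X_def)
  moreover have "dist (\<Phi> x) (\<Phi> y) \<le> (l * T) * dist x y" if "x \<in> X" "y \<in> X" for x y
  proof (rule dist_bound)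
    fix t
    have "dist (F x t) (F y t) = norm (integral {0..cl t} (\<lambda>s. g x s - g y s))"
      unfolding F_def using gint[OF that(1)] gint[OF that(2)]
      by (simp add: dist_norm integral_diff)
    also have "\<dots> \<le> (l * dist x y) * (cl t - 0)"
    proof (rule integral_bound)
      show "0 \<le> cl t" using cl[of t] by simp
      show "continuous_on {0..cl t} (\<lambda>s. g x s - g y s)"
        by (intro continuous_on_diff continuous_on_subset[OF gcont sub] that)
      fix s assume s: "s \<in> {0..cl t}"
      have "norm (g x s - g y s) \<le> l * dist (x s) (y s)"
        using lip[of s "x s" "y s"] that subsetD[OF sub s] by (auto simp: X_def g_def dist_norm)
      also have "\<dots> \<le> l * dist x y"
        using lT(1) by (intro mult_left_mono dist_bounded)
      finally show "norm (g x s - g y s) \<le> l * dist x y" .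
    qed
    also have "\<dots> \<le> (l * dist x y) * T"
      using cl[of t] lT(1) by (intro mult_left_mono) auto
    finally show "dist (\<Phi> x t) (\<Phi> y t) \<le> (l * T) * dist x y"
      using app that by (simp add: algebra_simps)
  qed
  ultimately have "\<exists>!x. x \<in> X \<and> \<Phi> x = x"
    using T lT by (intro Banach_fix) auto
  then obtain y where y: "y \<in> X" "\<Phi> y = y" by auto
  have yF: "apply_bcontfun y t = F y t" for t using app[OF y(1)] y(2) by simp
  show ?thesis
  proof (intro exI[of _ "apply_bcontfun y"] conjI ballI)
    have "cl 0 = 0" using T by (simp add: cl_def)
    then show "y 0 = y0" using yF[of 0] by (simp add: F_def)
    fix t assume t: "t \<in> {0..T}"
    show "y t \<in> cball y0 r" using y(1) by (simp add: X_def)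
    have "((\<lambda>u. integral {0..u} (g y)) has_vector_derivative g y t) (at t within {0..T})"
      by (rule integral_has_vector_derivative[OF gcont[OF y(1)] t])
    then have "((\<lambda>u. y0 + integral {0..u} (g y)) has_vector_derivative g y t) (at t within {0..T})"
      by (auto intro!: derivative_eq_intros)
    then have "((\<lambda>u. y0 + integral {0..u} (g y)) has_vector_derivative f t (y t)) (at t within {0..T})"
      by (simp only: g_def)
    moreover have "apply_bcontfun y u = y0 + integral {0..u} (g y)" if "u \<in> {0..T}" for u
      using that yF[of u] by (simp add: F_def cl_def)
    ultimately show "(apply_bcontfun y has_vector_derivative f t (y t)) (at t within {0..T})"
      by (metis (no_types, lifting) has_vector_derivative_transform t)
  qed
qed

lemma norm_diff_le_of_vector_derivative:
  fixes f :: "real \<Rightarrow> 'a::real_normed_vector"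
  assumes "a \<le> b" "\<And>t. t \<in> {a..b} \<Longrightarrow> (f has_vector_derivative f' t) (at t within {a..b})"
    and "\<And>t. t \<in> {a..b} \<Longrightarrow> norm (f' t) \<le> m"
  shows "norm (f b - f a) \<le> m * (b - a)"
proof -
  have "norm (f b - f a) \<le> m * norm (b - a)"
  proof (rule differentiable_bound[of "{a..b}" f "\<lambda>t h. h *\<^sub>R f' t"])
    show "onorm (\<lambda>h. h *\<^sub>R f' t) \<le> m" if "t \<in> {a..b}" for t
      using assms(3)[OF that] by (intro onorm_le) (metis abs_ge_zero mult.commute mult_left_mono norm_scaleR real_norm_def)
  qed (use assms in \<open>auto simp: has_vector_derivative_def\<close>)
  then show ?thesis using assms(1) by simp
qed

text \<open>A first-exit argument: the speed bound is available only while the curve is within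
  \<open>r\<close> of its start, but up to the first time at distance \<open>r\<close> it permits a
  displacement of at most \<open>m * T\<close>, which is less than \<open>r\<close>.\<close>

lemma stays_in_ball:
  fixes y :: "real \<Rightarrow> 'a::real_normed_vector"
  assumes der: "\<And>t. t \<in> {0..T} \<Longrightarrow> (y has_vector_derivative y' t) (at t within {0..T})"
    and bound: "\<And>t. t \<in> {0..T} \<Longrightarrow> dist (y t) (y 0) \<le> r \<Longrightarrow> norm (y' t) \<le> m"
    and m: "0 \<le> m" and mT: "m * T < r" and t: "t \<in> {0..T}"
  shows "dist (y t) (y 0) \<le> m * t"
proof -
  have der': "(y has_vector_derivative y' s) (at s within {0..x})" if "x \<le> T" "s \<in> {0..x}" for x s
    by (rule has_vector_derivative_within_subset[OF der]) (use that in auto)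
  have cont: "continuous_on {0..T} (\<lambda>t. dist (y t) (y 0))"
    using der by (intro continuous_intros) (blast intro: continuous_on_vector_derivative)
  have key: "dist (y x) (y 0) \<le> m * x" if "x \<in> {0..T}" "\<And>s. s \<in> {0..x} \<Longrightarrow> dist (y s) (y 0) \<le> r" for x
  proof -
    have "norm (y x - y 0) \<le> m * (x - 0)"
      by (rule norm_diff_le_of_vector_derivative[where f' = y'])
         (use that der'[of x] bound in auto)
    then show ?thesis by (simp add: dist_norm)
  qed
  have inside: "dist (y s) (y 0) < r" if s: "s \<in> {0..T}" for s
  proof (rule ccontr)
    assume "\<not> dist (y s) (y 0) < r"
    define B where "B = {x \<in> {0..s}. r \<le> dist (y x) (y 0)}"
    have "closed B"
    proof -
      have "continuous_on {0..s} (\<lambda>t. dist (y t) (y 0))"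
        using cont continuous_on_subset s by fastforce
      then show ?thesis unfolding B_def
        using continuous_closed_preimage[of "{0..s}" "\<lambda>t. dist (y t) (y 0)" "{r..}"]
        by (simp add: vimage_def Int_def)
    qed
    moreover have "bounded B" unfolding B_def by (rule bounded_subset[of "{0..s}"]) auto
    moreover have "s \<in> B" using \<open>\<not> _\<close> s by (auto simp: B_def)
    ultimately obtain x where x: "x \<in> B" "\<And>z. z \<in> B \<Longrightarrow> x \<le> z"
      using compact_attains_inf[of B] by (metis compact_eq_bounded_closed empty_iff)
    have xT: "x \<in> {0..T}" using x(1) s by (auto simp: B_def)
    have r0: "0 < r" using mT m s by (smt (verit, best) atLeastAtMost_iff mult_nonneg_nonneg)
    have lt: "dist (y z) (y 0) < r" if "z \<in> {0..<x}" for z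
      using x(2)[of z] x(1) that by (force simp: B_def)
    have "dist (y x) (y 0) \<le> r"
    proof (cases "x = 0")
      case True then show ?thesis using r0 by simp
    next
      case False
      then have "x > 0" using xT by simp
      have "continuous_on {0..x} (\<lambda>t. dist (y t) (y 0))"
        using cont continuous_on_subset xT by fastforce
      moreover have "closure {0..<x} = {0..x}" using \<open>x > 0\<close> by simp
      ultimately show ?thesis
        using continuous_le_on_closure[of "{0..<x}" "\<lambda>t. dist (y t) (y 0)" x r] lt \<open>x > 0\<close>
        by (auto intro: less_imp_le)
    qed
    then have "dist (y z) (y 0) \<le> r" if "z \<in> {0..x}" for z
      using lt[of z] that by (cases "z = x") auto
    from key[OF xT this] have "dist (y x) (y 0) \<le> m * x" .
    also have "\<dots> \<le> m * T" using xT m by (simp add: mult_left_mono)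
    finally show False using mT x(1) by (simp add: B_def)
  qed
  show ?thesis using t less_imp_le[OF inside] by (intro key) auto
qed

section \<open>The perturbation\<close>

text \<open>With \<open>u + \<i> v = A e\<^sup>i\<^sup>\<theta> w\<close> the regularized equations read \<open>w'' + w = hill_rhs \<epsilon> \<theta> w w'\<close>; the first term
  is the Coriolis force, the second one comes from the term \<open>3/2 x\<^sup>2\<close> of the potential.\<close>

definition hill_rhs :: "real \<Rightarrow> real \<Rightarrow> complex \<Rightarrow> complex \<Rightarrow> complex" where
  "hill_rhs \<epsilon> \<theta> w p =
     of_real (8 * \<epsilon>) * (- \<i> * (w * cnj w) * p)
     + of_real (\<epsilon>\<^sup>2) * (12 * of_real ((Re (cis (2 * \<theta>) * w\<^sup>2))\<^sup>2) * w
                 + 24 * (w * cnj w) * of_real (Re (cis (2 * \<theta>) * w\<^sup>2)) * (cis (- 2 * \<theta>) * cnj w))"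

text \<open>Splitting the difference as \<open>a * (b - b') + (a - a') * b'\<close> yields a product
  rule for Lipschitz constants. The common factor \<open>d\<close> is kept apart so that the bounds
  of nested products can be assembled factor by factor.\<close>

lemma norm_mult_diff_le:
  fixes a a' b b' :: complex
  assumes "norm a \<le> A" "norm b' \<le> B" "norm (a - a') \<le> LA * d" "norm (b - b') \<le> LB * d"
    and "0 \<le> LA * d" "0 \<le> LB * d"
  shows "norm (a * b - a' * b') \<le> (A * LB + B * LA) * d"
proof -
  have A: "0 \<le> A" using assms(1) norm_ge_zero order_trans by blast
  have "a * b - a' * b' = a * (b - b') + (a - a') * b'" by (simp add: algebra_simps)
  then have "norm (a * b - a' * b') \<le> norm a * norm (b - b') + norm (a - a') * norm b'"
    by (metis norm_mult norm_triangle_ineq)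
  also have "\<dots> \<le> A * (LB * d) + (LA * d) * B"
    using assms A by (intro add_mono mult_mono) auto
  finally show ?thesis by (simp add: algebra_simps)
qed

lemma norm_mult_le:
  fixes a b :: complex
  assumes "norm a \<le> A" "norm b \<le> B"
  shows "norm (a * b) \<le> A * B"
  unfolding norm_mult using assms order_trans[OF norm_ge_zero assms(1)] by (intro mult_mono) auto

lemma norm_cis_diff_le: "norm (cis a - cis b) \<le> \<bar>a - b\<bar>"
proof -
  have "(cis has_vector_derivative \<i> * cis t) (at t within S)" for t S
    unfolding has_vector_derivative_def by (auto intro!: derivative_eq_intros)
  then have *: "norm (cis y - cis x) \<le> 1 * (y - x)" if "x \<le> y" for x y
    by (intro norm_diff_le_of_vector_derivative[where f' = "\<lambda>t. \<i> * cis t"])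
       (use that in \<open>auto simp: norm_mult\<close>)
  show ?thesis
    using *[of a b] *[of b a] by (cases "a \<le> b") (auto simp: norm_minus_commute)
qed

text \<open>Crude bounds on the ball of radius 2, built up factor by factor: the size is at most 8 *
  8 + 36 * 32, the Lipschitz constant at most 8 * 12 + 36 * 208 = 7584, using \<epsilon>^2 \<le>
  \<epsilon>; both are rounded up to 8000. The tide alone gives 1152 = 36 * 32. The angle is varied
  together with \<open>w\<close> and \<open>p\<close>, because an orbit depends on it only through
  \<open>hill_rhs\<close>.\<close>

lemma hill_rhs_estimates:
  assumes "norm w \<le> 2" "norm p \<le> 2" "norm w' \<le> 2" "norm p' \<le> 2" "0 \<le> \<epsilon>" "\<epsilon> \<le> 1"
  shows "norm (hill_rhs \<epsilon> \<theta> w p) \<le> 8000 * \<epsilon>"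
    and hill_rhs_lipschitz: "norm (hill_rhs \<epsilon> \<theta> w p - hill_rhs \<epsilon> \<theta>' w' p')
           \<le> 8000 * \<epsilon> * (norm (w - w') + norm (p - p') + \<bar>\<theta> - \<theta>'\<bar>)"
    and "norm (hill_rhs \<epsilon> \<theta> w p - of_real (8 * \<epsilon>) * (- \<i> * (w * cnj w) * p)) \<le> 1152 * \<epsilon>\<^sup>2"
proof -
  define d where "d = norm (w - w') + norm (p - p') + \<bar>\<theta> - \<theta>'\<bar>"
  have d: "0 \<le> d" "norm (w - w') \<le> 1 * d" "norm (p - p') \<le> 1 * d" "\<bar>\<theta> - \<theta>'\<bar> \<le> d"
    by (auto simp: d_def)
  have cw: "norm (cnj w - cnj w') \<le> 1 * d"
    using d(2) by (metis complex_cnj_diff complex_mod_cnj)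
  have c1: "norm (cis (2 * \<theta>) - cis (2 * \<theta>')) \<le> 2 * d"
    using norm_cis_diff_le[of "2*\<theta>" "2*\<theta>'"] d(4) by (simp add: algebra_simps abs_if split: if_splits)
  have c2: "norm (cis (- 2 * \<theta>) - cis (- 2 * \<theta>')) \<le> 2 * d"
    using norm_cis_diff_le[of "- 2*\<theta>" "- 2*\<theta>'"] d(4) by (simp add: algebra_simps abs_if split: if_splits)
  define R where "R w = w * cnj w" for w :: complex
  define Z where "Z \<theta> w = cis (2 * \<theta>) * w\<^sup>2" for \<theta> w
  define q where "q \<theta> w = complex_of_real (Re (Z \<theta> w))" for \<theta> w
  define z where "z \<theta> w = cis (- 2 * \<theta>) * cnj w" for \<theta> w
  have bR: "norm (R v) \<le> 2 * 2" if "norm v \<le> 2" for v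
    unfolding R_def by (rule norm_mult_le) (use that in auto)
  have bw2: "norm (v\<^sup>2) \<le> 2 * 2" if "norm v \<le> 2" for v :: complex
    unfolding power2_eq_square by (rule norm_mult_le) (use that in auto)
  have bZ: "norm (Z \<theta> v) \<le> 1 * (2 * 2)" if "norm v \<le> 2" for v \<theta>
    unfolding Z_def by (rule norm_mult_le) (use bw2 that in auto)
  have bq: "norm (q \<theta> v) \<le> 4" if "norm v \<le> 2" for v \<theta>
    unfolding q_def using bZ[OF that, of \<theta>] abs_Re_le_cmod[of "Z \<theta> v"] by simp
  have bq2: "norm ((q \<theta> v)\<^sup>2) \<le> 4 * 4" if "norm v \<le> 2" for v \<theta>
    unfolding power2_eq_square by (rule norm_mult_le) (use bq that in auto)
  have bz: "norm (z \<theta> v) \<le> 1 * 2" if "norm v \<le> 2" for v \<theta>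
    unfolding z_def by (rule norm_mult_le) (use that in auto)
  have bRp: "norm (R w * p) \<le> (2 * 2) * 2"
    by (rule norm_mult_le[OF bR]) (use assms in auto)
  have bq2w: "norm ((q \<theta> v)\<^sup>2 * v) \<le> (4 * 4) * 2" if "norm v \<le> 2" for v \<theta>
    by (rule norm_mult_le[OF bq2]) (use that in auto)
  have bRq: "norm (R v * q \<theta> v) \<le> (2 * 2) * 4" if "norm v \<le> 2" for v \<theta>
    by (rule norm_mult_le[OF bR bq]) (use that in auto)
  have bRqz: "norm (R v * q \<theta> v * z \<theta> v) \<le> ((2 * 2) * 4) * (1 * 2)" if "norm v \<le> 2" for v \<theta>
    by (rule norm_mult_le[OF bRq bz]) (use that in auto)
  note pos = mult_nonneg_nonneg[OF _ d(1)]
  have lR: "norm (R w - R w') \<le> (2 * 1 + 2 * 1) * d"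
    unfolding R_def by (rule norm_mult_diff_le) (use d cw assms in auto)
  have lw2: "norm (w\<^sup>2 - w'\<^sup>2) \<le> (2 * 1 + 2 * 1) * d"
    unfolding power2_eq_square by (rule norm_mult_diff_le) (use d assms in auto)
  have lZ: "norm (Z \<theta> w - Z \<theta>' w') \<le> (1 * (2 * 1 + 2 * 1) + 4 * 2) * d"
    unfolding Z_def by (rule norm_mult_diff_le) (use bw2[of w'] lw2 c1 d assms in auto)
  have lq: "norm (q \<theta> w - q \<theta>' w') \<le> 12 * d"
    using lZ abs_Re_le_cmod[of "Z \<theta> w - Z \<theta>' w'"] unfolding q_def
    by (simp flip: of_real_diff)
  have lq2: "norm ((q \<theta> w)\<^sup>2 - (q \<theta>' w')\<^sup>2) \<le> (4 * 12 + 4 * 12) * d"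
    unfolding power2_eq_square by (rule norm_mult_diff_le) (use bq lq d assms in auto)
  have lz: "norm (z \<theta> w - z \<theta>' w') \<le> (1 * 1 + 2 * 2) * d"
    unfolding z_def by (rule norm_mult_diff_le) (use cw c2 d assms in auto)
  have lRp: "norm (R w * p - R w' * p') \<le> (4 * 1 + 2 * (2 * 1 + 2 * 1)) * d"
    by (rule norm_mult_diff_le) (use bR[of w] lR d assms in auto)
  have lq2w: "norm ((q \<theta> w)\<^sup>2 * w - (q \<theta>' w')\<^sup>2 * w') \<le> (16 * 1 + 2 * (4 * 12 + 4 * 12)) * d"
    by (rule norm_mult_diff_le) (use bq2[of w] lq2 d assms in auto)
  have lRq: "norm (R w * q \<theta> w - R w' * q \<theta>' w') \<le> (4 * 12 + 4 * (2 * 1 + 2 * 1)) * d"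
    by (rule norm_mult_diff_le) (use bR[of w] bq[of w'] lq lR d assms in auto)
  have lRqz: "norm (R w * q \<theta> w * z \<theta> w - R w' * q \<theta>' w' * z \<theta>' w')
      \<le> (16 * (1 * 1 + 2 * 2) + 2 * (4 * 12 + 4 * (2 * 1 + 2 * 1))) * d"
    by (rule norm_mult_diff_le) (use bRq[of w \<theta>] bz[of w' \<theta>'] lRq lz d assms in auto)
  have rhs: "hill_rhs \<epsilon> \<theta> w p = of_real (8 * \<epsilon>) * (- \<i> * (R w * p))
      + of_real (\<epsilon>\<^sup>2) * (12 * ((q \<theta> w)\<^sup>2 * w) + 24 * (R w * q \<theta> w * z \<theta> w))" for \<theta> w p
    by (simp add: hill_rhs_def R_def Z_def q_def z_def algebra_simps)
  have e2: "\<epsilon>\<^sup>2 \<le> \<epsilon>" using assms by (simp add: power2_eq_square mult_left_le)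
  have tri: "norm (of_real (8 * \<epsilon>) * (- \<i> * a) + of_real (\<epsilon>\<^sup>2) * (12 * b + 24 * c))
      \<le> 8 * \<epsilon> * norm a + \<epsilon>\<^sup>2 * (12 * norm b + 24 * norm c)" for a b c :: complex
  proof -
    have "norm (of_real (8 * \<epsilon>) * (- \<i> * a) + of_real (\<epsilon>\<^sup>2) * (12 * b + 24 * c))
       \<le> norm (of_real (8 * \<epsilon>) * (- \<i> * a)) + norm (of_real (\<epsilon>\<^sup>2) * (12 * b + 24 * c))"
      by (rule norm_triangle_ineq)
    also have "norm (of_real (8 * \<epsilon>) * (- \<i> * a)) = 8 * \<epsilon> * norm a"
      using assms by (simp add: norm_mult)
    also have "norm (of_real (\<epsilon>\<^sup>2) * (12 * b + 24 * c)) = \<epsilon>\<^sup>2 * norm (12 * b + 24 * c)"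
      by (simp only: norm_mult norm_of_real abs_power2)
    also have "\<dots> \<le> \<epsilon>\<^sup>2 * (12 * norm b + 24 * norm c)"
      using norm_triangle_ineq[of "12 * b" "24 * c"] by (intro mult_left_mono) (auto simp: norm_mult)
    finally show ?thesis by simp
  qed
  have "norm (hill_rhs \<epsilon> \<theta> w p) \<le> 8 * \<epsilon> * norm (R w * p)
      + \<epsilon>\<^sup>2 * (12 * norm ((q \<theta> w)\<^sup>2 * w) + 24 * norm (R w * q \<theta> w * z \<theta> w))"
    unfolding rhs by (rule tri)
  also have "\<dots> \<le> 8 * \<epsilon> * 8 + \<epsilon> * (12 * 32 + 24 * 32)"
    using bRp bq2w[of w \<theta>] bRqz[of w \<theta>] assms e2
    by (intro add_mono mult_mono) (auto intro!: add_nonneg_nonneg)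
  finally show "norm (hill_rhs \<epsilon> \<theta> w p) \<le> 8000 * \<epsilon>" using assms by simp
  have "hill_rhs \<epsilon> \<theta> w p - hill_rhs \<epsilon> \<theta>' w' p' =
     of_real (8 * \<epsilon>) * (- \<i> * (R w * p - R w' * p'))
      + of_real (\<epsilon>\<^sup>2) * (12 * ((q \<theta> w)\<^sup>2 * w - (q \<theta>' w')\<^sup>2 * w')
         + 24 * (R w * q \<theta> w * z \<theta> w - R w' * q \<theta>' w' * z \<theta>' w'))"
    unfolding rhs by (simp add: algebra_simps)
  then have "norm (hill_rhs \<epsilon> \<theta> w p - hill_rhs \<epsilon> \<theta>' w' p')
     \<le> 8 * \<epsilon> * norm (R w * p - R w' * p')
      + \<epsilon>\<^sup>2 * (12 * norm ((q \<theta> w)\<^sup>2 * w - (q \<theta>' w')\<^sup>2 * w')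
         + 24 * norm (R w * q \<theta> w * z \<theta> w - R w' * q \<theta>' w' * z \<theta>' w'))"
    using tri by metis
  also have "\<dots> \<le> 8 * \<epsilon> * (12 * d) + \<epsilon> * (12 * (208 * d) + 24 * (208 * d))"
    using lRp lq2w lRqz assms e2 d(1)
    by (intro add_mono mult_mono) (auto intro!: add_nonneg_nonneg)
  also have "\<dots> \<le> 8000 * \<epsilon> * d" using assms d(1) by (simp add: algebra_simps)
  finally show "norm (hill_rhs \<epsilon> \<theta> w p - hill_rhs \<epsilon> \<theta>' w' p')
           \<le> 8000 * \<epsilon> * (norm (w - w') + norm (p - p') + \<bar>\<theta> - \<theta>'\<bar>)"
    by (simp add: d_def)
  have "hill_rhs \<epsilon> \<theta> w p - of_real (8 * \<epsilon>) * (- \<i> * (w * cnj w) * p)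
      = of_real (8 * \<epsilon>) * (- \<i> * 0) + of_real (\<epsilon>\<^sup>2) * (12 * ((q \<theta> w)\<^sup>2 * w) + 24 * (R w * q \<theta> w * z \<theta> w))"
    unfolding rhs by (simp add: R_def algebra_simps)
  then have "norm (hill_rhs \<epsilon> \<theta> w p - of_real (8 * \<epsilon>) * (- \<i> * (w * cnj w) * p))
      \<le> \<epsilon>\<^sup>2 * (12 * norm ((q \<theta> w)\<^sup>2 * w) + 24 * norm (R w * q \<theta> w * z \<theta> w))"
    using tri[of 0 "(q \<theta> w)\<^sup>2 * w" "R w * q \<theta> w * z \<theta> w"] by simp
  also have "\<dots> \<le> \<epsilon>\<^sup>2 * (12 * 32 + 24 * 32)"
    using bq2w[of w \<theta>] bRqz[of w \<theta>] assms by (intro mult_left_mono) auto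
  finally show "norm (hill_rhs \<epsilon> \<theta> w p - of_real (8 * \<epsilon>) * (- \<i> * (w * cnj w) * p)) \<le> 1152 * \<epsilon>\<^sup>2"
    by simp
qed

lemma
  assumes "norm w \<le> 2" "norm p \<le> 2" "0 \<le> \<epsilon>" "\<epsilon> \<le> 1"
  shows norm_hill_rhs_le: "norm (hill_rhs \<epsilon> \<theta> w p) \<le> 8000 * \<epsilon>"
    and norm_hill_rhs_minus_coriolis_le:
      "norm (hill_rhs \<epsilon> \<theta> w p - of_real (8 * \<epsilon>) * (- \<i> * (w * cnj w) * p)) \<le> 1152 * \<epsilon>\<^sup>2"
  using hill_rhs_estimates(1,3)[OF assms(1,2) assms(1,2) assms(3,4)] by auto

text \<open>Dividing by the ejection direction moves the angle from the initial data into the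
  equation. All angles then share \<open>w 0 = 0\<close> and \<open>p 0 = 1\<close>, and two
  solutions differ only through \<open>hill_rhs\<close>.\<close>

definition hsol :: "real \<Rightarrow> real \<Rightarrow> real \<Rightarrow> (real \<Rightarrow> complex) \<Rightarrow> (real \<Rightarrow> complex) \<Rightarrow> bool" where
  "hsol \<epsilon> \<theta> T w p \<longleftrightarrow> w 0 = 0 \<and> p 0 = 1 \<and> (\<forall>t\<in>{0..T}.
     (w has_vector_derivative p t) (at t within {0..T}) \<and>
     (p has_vector_derivative (- w t + hill_rhs \<epsilon> \<theta> (w t) (p t))) (at t within {0..T}))"

lemma hsol_subset:
  assumes "hsol \<epsilon> \<theta> T w p" "T' \<le> T"
  shows "hsol \<epsilon> \<theta> T' w p"
  unfolding hsol_def
proof (intro conjI ballI)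
  fix t assume "t \<in> {0..T'}"
  then have "t \<in> {0..T}" "{0..T'} \<subseteq> {0..T}" using assms(2) by auto
  then show "(w has_vector_derivative p t) (at t within {0..T'})"
    and "(p has_vector_derivative (- w t + hill_rhs \<epsilon> \<theta> (w t) (p t))) (at t within {0..T'})"
    using assms(1) unfolding hsol_def by (blast intro: has_vector_derivative_within_subset)+
qed (use assms(1) in \<open>auto simp: hsol_def\<close>)

text \<open>Variation of constants: \<open>w = a sin t + b cos t\<close>, \<open>p = a cos t - b sin t\<close>. For
  \<open>\<epsilon> = 0\<close> the pair \<open>(a, b)\<close> would be constant.\<close>

definition osc_w :: "real \<Rightarrow> complex \<times> complex \<Rightarrow> complex" where
  "osc_w t y = fst y * of_real (sin t) + snd y * of_real (cos t)"

definition osc_p :: "real \<Rightarrow> complex \<times> complex \<Rightarrow> complex" where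
  "osc_p t y = fst y * of_real (cos t) - snd y * of_real (sin t)"

definition osc_y :: "real \<Rightarrow> complex \<Rightarrow> complex \<Rightarrow> complex \<times> complex" where
  "osc_y t w p = (w * of_real (sin t) + p * of_real (cos t), w * of_real (cos t) - p * of_real (sin t))"

definition osc_f :: "real \<Rightarrow> real \<Rightarrow> real \<Rightarrow> complex \<times> complex \<Rightarrow> complex \<times> complex" where
  "osc_f \<epsilon> \<theta> t y = (hill_rhs \<epsilon> \<theta> (osc_w t y) (osc_p t y) * of_real (cos t),
                   - hill_rhs \<epsilon> \<theta> (osc_w t y) (osc_p t y) * of_real (sin t))"

lemma sin_cos_of_real_squared: "(of_real (sin t))\<^sup>2 + (of_real (cos t))\<^sup>2 = (1::complex)"
  by (metis of_real_1 of_real_add of_real_power sin_cos_squared_add)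

lemma osc_inverse:
  "osc_y t (osc_w t y) (osc_p t y) = y" "osc_w t (osc_y t w p) = w" "osc_p t (osc_y t w p) = p"
proof -
  have *: "a * of_real (sin t) * of_real (sin t) + a * of_real (cos t) * of_real (cos t) = a" for a :: complex
    using arg_cong[OF sin_cos_of_real_squared[of t], of "(*) a"]
    by (simp add: distrib_left power2_eq_square mult.assoc)
  show "osc_y t (osc_w t y) (osc_p t y) = y"
    using *[of "fst y"] *[of "snd y"]
    by (intro prod_eqI) (simp_all add: osc_y_def osc_w_def osc_p_def algebra_simps)
  show "osc_w t (osc_y t w p) = w" "osc_p t (osc_y t w p) = p"
    using *[of w] *[of p] by (simp_all add: osc_y_def osc_w_def osc_p_def algebra_simps)
qed

lemma norm_osc_diff_le:
  "norm (osc_w t y - osc_w t y') \<le> 2 * dist y y'" "norm (osc_p t y - osc_p t y') \<le> 2 * dist y y'"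
proof -
  have *: "norm (a * of_real s + b * of_real c) \<le> 2 * norm (a, b)"
    if "\<bar>s\<bar> \<le> 1" "\<bar>c\<bar> \<le> 1" for a b :: complex and s c :: real
  proof -
    have "norm (a * of_real s + b * of_real c) \<le> norm a * \<bar>s\<bar> + norm b * \<bar>c\<bar>"
      by (metis norm_mult norm_of_real norm_triangle_ineq)
    also have "\<dots> \<le> norm a * 1 + norm b * 1"
      using that by (intro add_mono mult_left_mono) auto
    also have "\<dots> \<le> 2 * norm (a, b)"
      using norm_fst_le[of a b] norm_snd_le[of b a] by simp
    finally show ?thesis .
  qed
  show "norm (osc_w t y - osc_w t y') \<le> 2 * dist y y'"
    using *[of "sin t" "cos t" "fst (y - y')" "snd (y - y')"]
    unfolding prod.collapse dist_norm by (simp add: osc_w_def algebra_simps)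
  show "norm (osc_p t y - osc_p t y') \<le> 2 * dist y y'"
    using *[of "cos t" "- sin t" "fst (y - y')" "snd (y - y')"]
    unfolding prod.collapse dist_norm by (simp add: osc_p_def algebra_simps)
qed

lemma norm_pair_cos_sin: "norm (x * of_real (cos t), - x * of_real (sin t)) = norm (x::complex)"
proof -
  have "(norm x * \<bar>cos t\<bar>)\<^sup>2 + (norm x * \<bar>sin t\<bar>)\<^sup>2 = (norm x)\<^sup>2 * ((sin t)\<^sup>2 + (cos t)\<^sup>2)"
    by (simp only: power_mult_distrib power2_abs) algebra
  then show ?thesis by (simp add: norm_Pair norm_mult)
qed

text \<open>The pair \<open>(1, 0)\<close> stands for the unperturbed orbit \<open>sin t\<close>; a
  deviation of 1/2 in the coefficients changes \<open>w\<close> and \<open>p\<close> by at most 1.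
  This is where the radius 2 in the bounds for \<open>hill_rhs\<close> comes from.\<close>

lemma osc_ball:
  assumes "y \<in> cball (1, 0) (1/2)"
  shows "norm (osc_w t y) \<le> 2" "norm (osc_p t y) \<le> 2"
proof -
  have "osc_w t (1, 0) = of_real (sin t)" "osc_p t (1, 0) = of_real (cos t)"
    by (simp_all add: osc_w_def osc_p_def)
  moreover have "dist y (1, 0) \<le> 1/2" using assms by (simp add: dist_commute)
  moreover have "norm (complex_of_real (sin t)) \<le> 1" "norm (complex_of_real (cos t)) \<le> 1" by simp_all
  ultimately show "norm (osc_w t y) \<le> 2" "norm (osc_p t y) \<le> 2"
    using norm_osc_diff_le[of t y "(1, 0)"]
      norm_triangle_sub[of "osc_w t y" "osc_w t (1, 0)"] norm_triangle_sub[of "osc_p t y" "osc_p t (1, 0)"]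
    by (simp_all only:)
qed

lemma osc_f_bound:
  assumes "y \<in> cball (1, 0) (1/2)" "0 \<le> \<epsilon>" "\<epsilon> \<le> 1"
  shows "norm (osc_f \<epsilon> \<theta> t y) \<le> 8000 * \<epsilon>"
  unfolding osc_f_def norm_pair_cos_sin
  by (rule norm_hill_rhs_le) (use assms osc_ball[OF assms(1)] in auto)

lemma osc_f_lipschitz:
  assumes "y \<in> cball (1, 0) (1/2)" "y' \<in> cball (1, 0) (1/2)" "0 \<le> \<epsilon>" "\<epsilon> \<le> 1"
  shows "dist (osc_f \<epsilon> \<theta> t y) (osc_f \<epsilon> \<theta>' t y') \<le> 8000 * \<epsilon> * (4 * dist y y' + \<bar>\<theta> - \<theta>'\<bar>)"
proof -
  let ?N = "\<lambda>\<theta> y. hill_rhs \<epsilon> \<theta> (osc_w t y) (osc_p t y)"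
  have "osc_f \<epsilon> \<theta> t y - osc_f \<epsilon> \<theta>' t y' =
      ((?N \<theta> y - ?N \<theta>' y') * of_real (cos t), - (?N \<theta> y - ?N \<theta>' y') * of_real (sin t))"
    by (simp add: osc_f_def algebra_simps)
  then have "dist (osc_f \<epsilon> \<theta> t y) (osc_f \<epsilon> \<theta>' t y') = norm (?N \<theta> y - ?N \<theta>' y')"
    unfolding dist_norm by (simp only: norm_pair_cos_sin)
  also have "\<dots> \<le> 8000 * \<epsilon> * (norm (osc_w t y - osc_w t y') + norm (osc_p t y - osc_p t y') + \<bar>\<theta> - \<theta>'\<bar>)"
    by (rule hill_rhs_lipschitz) (use assms osc_ball[OF assms(1)] osc_ball[OF assms(2)] in auto)
  also have "\<dots> \<le> 8000 * \<epsilon> * (4 * dist y y' + \<bar>\<theta> - \<theta>'\<bar>)"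
    using norm_osc_diff_le[of t y y'] assms(3) by (intro mult_left_mono) auto
  finally show ?thesis .
qed

lemma continuous_on_hill_rhs [continuous_intros]:
  assumes "continuous_on S w" "continuous_on S p"
  shows "continuous_on S (\<lambda>x. hill_rhs \<epsilon> \<theta> (w x) (p x))"
  unfolding hill_rhs_def by (intro continuous_intros assms)

lemma osc_has_vector_derivative:
  assumes "(y has_vector_derivative osc_f \<epsilon> \<theta> t (y t)) (at t within S)"
  shows "((\<lambda>t. osc_w t (y t)) has_vector_derivative osc_p t (y t)) (at t within S)"
    and "((\<lambda>t. osc_p t (y t)) has_vector_derivative
           (- osc_w t (y t) + hill_rhs \<epsilon> \<theta> (osc_w t (y t)) (osc_p t (y t)))) (at t within S)"
proof -
  define N where "N = hill_rhs \<epsilon> \<theta> (osc_w t (y t)) (osc_p t (y t))"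
  have 1: "((\<lambda>t. fst (y t)) has_vector_derivative N * of_real (cos t)) (at t within S)"
    using bounded_linear.has_vector_derivative[OF bounded_linear_fst assms] by (simp add: osc_f_def N_def)
  have 2: "((\<lambda>t. snd (y t)) has_vector_derivative - N * of_real (sin t)) (at t within S)"
    using bounded_linear.has_vector_derivative[OF bounded_linear_snd assms] by (simp add: osc_f_def N_def)
  have s: "((\<lambda>t. complex_of_real (sin t)) has_vector_derivative of_real (cos t)) (at t within S)"
   and c: "((\<lambda>t. complex_of_real (cos t)) has_vector_derivative of_real (- sin t)) (at t within S)"
    by (rule has_vector_derivative_of_real; auto intro!: derivative_eq_intros)+
  have "((\<lambda>t. osc_w t (y t)) has_vector_derivative
     (fst (y t) * of_real (cos t) + N * of_real (cos t) * of_real (sin t))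
     + (snd (y t) * of_real (- sin t) + - N * of_real (sin t) * of_real (cos t))) (at t within S)"
    unfolding osc_w_def by (intro has_vector_derivative_add has_vector_derivative_mult 1 2 s c)
  then show "((\<lambda>t. osc_w t (y t)) has_vector_derivative osc_p t (y t)) (at t within S)"
    by (rule has_vector_derivative_eq_rhs) (simp add: osc_p_def)
  have "((\<lambda>t. osc_p t (y t)) has_vector_derivative
     (fst (y t) * of_real (- sin t) + N * of_real (cos t) * of_real (cos t))
     - (snd (y t) * of_real (cos t) + - N * of_real (sin t) * of_real (sin t))) (at t within S)"
    unfolding osc_p_def by (intro has_vector_derivative_diff has_vector_derivative_mult 1 2 s c)
  moreover have "(fst (y t) * of_real (- sin t) + N * of_real (cos t) * of_real (cos t))
     - (snd (y t) * of_real (cos t) + - N * of_real (sin t) * of_real (sin t)) = - osc_w t (y t) + N"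
    unfolding osc_w_def using sin_cos_of_real_squared[of t] by (simp, algebra)
  ultimately show "((\<lambda>t. osc_p t (y t)) has_vector_derivative (- osc_w t (y t) + N)) (at t within S)"
    by simp
qed

lemma osc_y_has_vector_derivative:
  assumes "(w has_vector_derivative p t) (at t within S)"
    and "(p has_vector_derivative (- w t + hill_rhs \<epsilon> \<theta> (w t) (p t))) (at t within S)"
  shows "((\<lambda>t. osc_y t (w t) (p t)) has_vector_derivative osc_f \<epsilon> \<theta> t (osc_y t (w t) (p t))) (at t within S)"
proof -
  define N where "N = hill_rhs \<epsilon> \<theta> (w t) (p t)"
  have s: "((\<lambda>t. complex_of_real (sin t)) has_vector_derivative of_real (cos t)) (at t within S)"
   and c: "((\<lambda>t. complex_of_real (cos t)) has_vector_derivative of_real (- sin t)) (at t within S)"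
    by (rule has_vector_derivative_of_real; auto intro!: derivative_eq_intros)+
  have "((\<lambda>t. osc_y t (w t) (p t)) has_vector_derivative
     ((w t * of_real (cos t) + p t * of_real (sin t)) + (p t * of_real (- sin t) + (- w t + N) * of_real (cos t)),
      (w t * of_real (- sin t) + p t * of_real (cos t)) - (p t * of_real (cos t) + (- w t + N) * of_real (sin t))))
     (at t within S)"
    unfolding osc_y_def N_def
    by (intro has_vector_derivative_Pair has_vector_derivative_add has_vector_derivative_diff
        has_vector_derivative_mult assms s c)
  then show ?thesis
    by (rule has_vector_derivative_eq_rhs) (simp add: osc_f_def osc_inverse N_def algebra_simps)
qed

section \<open>Existence and stability of the scaled ejection orbits\<close>

lemma hsol_exists:
  assumes "0 \<le> T" "0 \<le> \<epsilon>" "\<epsilon> \<le> 1" "8000 * \<epsilon> * T \<le> 1/8"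
  shows "\<exists>w p. hsol \<epsilon> \<theta> T w p"
proof -
  have "\<exists>y. y 0 = (1, 0) \<and> (\<forall>t\<in>{0..T}. y t \<in> cball (1, 0) (1/2) \<and>
           (y has_vector_derivative osc_f \<epsilon> \<theta> t (y t)) (at t within {0..T}))"
  \<comment> \<open>The factor 4 between \<open>l\<close> and \<open>m\<close> is the cost of
    passing between \<open>(w, p)\<close> and the coefficient pair. As
    \<open>8000 * \<epsilon> * T\<close> is at most 1/8, curves move by at most 1/8 in a ball of
    radius 1/2, and the contraction factor is at most 1/2.\<close>
  proof (rule picard_on_ball[where m = "8000 * \<epsilon>" and l = "32000 * \<epsilon>"])
    show "continuous_on ({0..T} \<times> cball (1, 0) (1/2)) (\<lambda>(t, y). osc_f \<epsilon> \<theta> t y)"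
      unfolding osc_f_def osc_w_def osc_p_def split_beta by (intro continuous_intros)
    show "dist (osc_f \<epsilon> \<theta> t x) (osc_f \<epsilon> \<theta> t y) \<le> 32000 * \<epsilon> * dist x y"
      if "x \<in> cball (1, 0) (1/2)" "y \<in> cball (1, 0) (1/2)" for t x y
      using osc_f_lipschitz[OF that assms(2,3), of \<theta> t \<theta>] by simp
    show "norm (osc_f \<epsilon> \<theta> t y) \<le> 8000 * \<epsilon>" if "y \<in> cball (1, 0) (1/2)" for t y
      by (rule osc_f_bound[OF that assms(2,3)])
  qed (use assms in auto)
  then obtain y where y: "y 0 = (1, 0)"
    "\<And>t. t \<in> {0..T} \<Longrightarrow> (y has_vector_derivative osc_f \<epsilon> \<theta> t (y t)) (at t within {0..T})" by blast
  have "hsol \<epsilon> \<theta> T (\<lambda>t. osc_w t (y t)) (\<lambda>t. osc_p t (y t))"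
    unfolding hsol_def using osc_has_vector_derivative[OF y(2)] y(1)
    by (simp add: osc_w_def[of 0] osc_p_def[of 0])
  then show ?thesis by blast
qed

context
  fixes \<epsilon> T :: real
  assumes eT: "0 \<le> \<epsilon>" "\<epsilon> \<le> 1" "8000 * \<epsilon> * T \<le> 1/8"
begin

lemma hsol_osc:
  assumes "hsol \<epsilon> \<theta> T w p"
  shows "osc_y 0 (w 0) (p 0) = (1, 0)"
    and "t \<in> {0..T} \<Longrightarrow> ((\<lambda>t. osc_y t (w t) (p t)) has_vector_derivative
           osc_f \<epsilon> \<theta> t (osc_y t (w t) (p t))) (at t within {0..T})"
    and "t \<in> {0..T} \<Longrightarrow> dist (osc_y t (w t) (p t)) (1, 0) \<le> 8000 * \<epsilon> * t"
    and "t \<in> {0..T} \<Longrightarrow> osc_y t (w t) (p t) \<in> cball (1, 0) (1/2)"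
proof -
  show 0: "osc_y 0 (w 0) (p 0) = (1, 0)" using assms by (simp add: hsol_def osc_y_def)
  show d: "((\<lambda>t. osc_y t (w t) (p t)) has_vector_derivative
           osc_f \<epsilon> \<theta> t (osc_y t (w t) (p t))) (at t within {0..T})" if "t \<in> {0..T}" for t
    using assms that unfolding hsol_def by (intro osc_y_has_vector_derivative) auto
  have "dist (osc_y t (w t) (p t)) (osc_y 0 (w 0) (p 0)) \<le> 8000 * \<epsilon> * t" if "t \<in> {0..T}" for t
  proof (rule stays_in_ball[where r = "1/2", OF d _ _ _ that])
    fix t assume "dist (osc_y t (w t) (p t)) (osc_y 0 (w 0) (p 0)) \<le> 1/2"
    then have "osc_y t (w t) (p t) \<in> cball (1, 0) (1/2)" by (simp add: 0 dist_commute)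
    then show "norm (osc_f \<epsilon> \<theta> t (osc_y t (w t) (p t))) \<le> 8000 * \<epsilon>"
      using eT by (intro osc_f_bound)
  qed (use eT in auto)
  then show *: "dist (osc_y t (w t) (p t)) (1, 0) \<le> 8000 * \<epsilon> * t" if "t \<in> {0..T}" for t
    using that 0 by simp
  show "osc_y t (w t) (p t) \<in> cball (1, 0) (1/2)" if "t \<in> {0..T}"
  proof -
    have "8000 * \<epsilon> * t \<le> 8000 * \<epsilon> * T" using that eT by (intro mult_left_mono) auto
    then show ?thesis using *[OF that] eT by (simp add: dist_commute)
  qed
qed

lemma hsol_near_sin:
  assumes "hsol \<epsilon> \<theta> T w p" "t \<in> {0..T}"
  shows "norm (w t - of_real (sin t)) \<le> 16000 * \<epsilon> * t" "norm (p t - of_real (cos t)) \<le> 16000 * \<epsilon> * t"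
    and "norm (w t) \<le> 2" "norm (p t) \<le> 2"
proof -
  have "osc_w t (1, 0) = of_real (sin t)" "osc_p t (1, 0) = of_real (cos t)"
    by (simp_all add: osc_w_def osc_p_def)
  then show "norm (w t - of_real (sin t)) \<le> 16000 * \<epsilon> * t" "norm (p t - of_real (cos t)) \<le> 16000 * \<epsilon> * t"
    using norm_osc_diff_le[of t "osc_y t (w t) (p t)" "(1, 0)"] hsol_osc(3)[OF assms]
    by (simp_all add: osc_inverse)
  show "norm (w t) \<le> 2" "norm (p t) \<le> 2"
    using osc_ball[OF hsol_osc(4)[OF assms], of t] by (simp_all add: osc_inverse)
qed

text \<open>In place of a Gronwall inequality: let \<open>D\<close> be the largest distance of the
  two coefficient pairs and \<eta> = 8000 \<epsilon> T \<le> 1/8. The mean value bound gives D \<le>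
  4 \<eta> D + \<eta> \<bar>\<theta> - \<theta>'\<bar>, hence D \<le> 2 \<eta> \<bar>\<theta> -
  \<theta>'\<bar>. Equal angles give uniqueness of solutions.\<close>

lemma hsol_lipschitz:
  assumes "hsol \<epsilon> \<theta> T w p" "hsol \<epsilon> \<theta>' T w' p'" "t \<in> {0..T}"
  shows "norm (w t - w' t) \<le> 32000 * \<epsilon> * T * \<bar>\<theta> - \<theta>'\<bar>" "norm (p t - p' t) \<le> 32000 * \<epsilon> * T * \<bar>\<theta> - \<theta>'\<bar>"
proof -
  define z where "z t = osc_y t (w t) (p t) - osc_y t (w' t) (p' t)" for t
  define \<eta> where "\<eta> = 8000 * \<epsilon> * T"
  have T0: "0 \<le> T" using assms by auto
  have \<eta>: "0 \<le> \<eta>" "\<eta> \<le> 1/8" using eT T0 by (auto simp: \<eta>_def)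
  have der: "(z has_vector_derivative (osc_f \<epsilon> \<theta> t (osc_y t (w t) (p t)) - osc_f \<epsilon> \<theta>' t (osc_y t (w' t) (p' t))))
      (at t within {0..T})" if "t \<in> {0..T}" for t
    unfolding z_def using hsol_osc(2)[OF assms(1) that] hsol_osc(2)[OF assms(2) that]
    by (rule has_vector_derivative_diff)
  have "continuous_on {0..T} z" by (rule continuous_on_vector_derivative) (rule der)
  then have "continuous_on {0..T} (\<lambda>t. norm (z t))" by (intro continuous_intros)
  then obtain m where m: "m \<in> {0..T}" "\<And>t. t \<in> {0..T} \<Longrightarrow> norm (z t) \<le> norm (z m)"
    using continuous_attains_sup[of "{0..T}" "\<lambda>t. norm (z t)"] T0 by auto
  define D where "D = norm (z m)"
  have D0: "0 \<le> D" by (simp add: D_def)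
  have "norm (z m - z 0) \<le> (8000 * \<epsilon> * (4 * D + \<bar>\<theta> - \<theta>'\<bar>)) * (m - 0)"
  proof (rule norm_diff_le_of_vector_derivative)
    fix t assume t: "t \<in> {0..m}"
    then have tT: "t \<in> {0..T}" using m by auto
    show "(z has_vector_derivative (osc_f \<epsilon> \<theta> t (osc_y t (w t) (p t)) - osc_f \<epsilon> \<theta>' t (osc_y t (w' t) (p' t))))
      (at t within {0..m})"
      using der[OF tT] by (rule has_vector_derivative_within_subset) (use m in auto)
    have "norm (osc_f \<epsilon> \<theta> t (osc_y t (w t) (p t)) - osc_f \<epsilon> \<theta>' t (osc_y t (w' t) (p' t)))
       \<le> 8000 * \<epsilon> * (4 * dist (osc_y t (w t) (p t)) (osc_y t (w' t) (p' t)) + \<bar>\<theta> - \<theta>'\<bar>)"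
      using osc_f_lipschitz[OF hsol_osc(4)[OF assms(1) tT] hsol_osc(4)[OF assms(2) tT] eT(1,2), of \<theta> t \<theta>']
      by (simp add: dist_norm)
    also have "\<dots> \<le> 8000 * \<epsilon> * (4 * D + \<bar>\<theta> - \<theta>'\<bar>)"
      using m(2)[OF tT] eT(1) by (intro mult_left_mono add_mono) (auto simp: D_def z_def dist_norm)
    finally show "norm (osc_f \<epsilon> \<theta> t (osc_y t (w t) (p t)) - osc_f \<epsilon> \<theta>' t (osc_y t (w' t) (p' t)))
       \<le> 8000 * \<epsilon> * (4 * D + \<bar>\<theta> - \<theta>'\<bar>)" .
  qed (use m in auto)
  also have "\<dots> \<le> (8000 * \<epsilon> * (4 * D + \<bar>\<theta> - \<theta>'\<bar>)) * T"
    using m(1) eT(1) D0 by (intro mult_left_mono) auto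
  also have "\<dots> = 4 * (\<eta> * D) + \<eta> * \<bar>\<theta> - \<theta>'\<bar>" by (simp add: \<eta>_def algebra_simps)
  finally have "D \<le> 4 * (\<eta> * D) + \<eta> * \<bar>\<theta> - \<theta>'\<bar>"
    using hsol_osc(1)[OF assms(1)] hsol_osc(1)[OF assms(2)] by (simp add: D_def z_def)
  moreover have "\<eta> * D \<le> 1/8 * D" using \<eta> D0 by (intro mult_right_mono) auto
  ultimately have D: "D \<le> 2 * (\<eta> * \<bar>\<theta> - \<theta>'\<bar>)" by linarith
  have "dist (osc_y t (w t) (p t)) (osc_y t (w' t) (p' t)) \<le> D"
    using m(2)[OF assms(3)] by (simp add: D_def z_def dist_norm)
  then show "norm (w t - w' t) \<le> 32000 * \<epsilon> * T * \<bar>\<theta> - \<theta>'\<bar>" "norm (p t - p' t) \<le> 32000 * \<epsilon> * T * \<bar>\<theta> - \<theta>'\<bar>"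
    using norm_osc_diff_le[of t "osc_y t (w t) (p t)" "osc_y t (w' t) (p' t)"] D
    by (auto simp: osc_inverse \<eta>_def)
qed

end

section \<open>Oscillations\<close>

lemma abs_le_two_abs_sin:
  fixes x :: real
  assumes "\<bar>x\<bar> \<le> pi / 2"
  shows "\<bar>x\<bar> \<le> 2 * \<bar>sin x\<bar>"
proof -
  have "\<bar>sin x - x\<bar> \<le> inverse (fact 3) * \<bar>x\<bar> ^ 3"
    using Maclaurin_sin_bound[of x 3] by (simp add: numeral_3_eq_3 sin_coeff_def)
  also have "inverse (fact 3) * \<bar>x\<bar> ^ 3 = \<bar>x\<bar> * (\<bar>x\<bar> * \<bar>x\<bar>) / 6"
    by (simp add: fact_numeral power3_eq_cube)
  finally have "\<bar>sin x - x\<bar> \<le> \<bar>x\<bar> * (\<bar>x\<bar> * \<bar>x\<bar>) / 6" .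
  \<comment> \<open>Since pi/2 < 1.6 and 1.6^2 / 6 < 1/2, the cubic error takes away at most half of
    \<bar>x\<bar>.\<close>
  moreover have "\<bar>x\<bar> * (\<bar>x\<bar> * \<bar>x\<bar>) \<le> \<bar>x\<bar> * (1.6 * 1.6)"
    using assms pi_approx by (intro mult_left_mono mult_mono) auto
  ultimately show ?thesis by linarith
qed

lemma sin_int_pi [simp]: "sin (of_int k * pi) = 0"
  by (cases k rule: int_cases2) simp_all

lemma cos_int_pi: "cos (of_int k * pi) = (if even k then 1 else - 1)"
  by (cases k rule: int_cases2) simp_all

lemma cos_shift_int_pi: "cos (of_int k * pi + x) = (if even k then cos x else - cos x)"
  by (simp add: cos_add cos_int_pi)

lemma near_multiple_of_pi:
  assumes "\<bar>sin x\<bar> \<le> c"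
  shows "\<exists>k::int. \<bar>x - k * pi\<bar> \<le> 2 * c"
proof -
  define k where "k = round (x / pi)"
  have "\<bar>x / pi - k\<bar> \<le> 1/2" using of_int_round_abs_le[of "x / pi"] by (simp add: k_def abs_minus_commute)
  moreover have "\<bar>x - k * pi\<bar> = \<bar>x / pi - k\<bar> * pi"
    by (simp add: left_diff_distrib abs_mult_pos)
  ultimately have "\<bar>x - k * pi\<bar> \<le> pi / 2" using mult_right_mono[of "\<bar>x / pi - k\<bar>" "1/2" pi] by simp
  then have "\<bar>x - k * pi\<bar> \<le> 2 * \<bar>sin (x - k * pi)\<bar>" by (rule abs_le_two_abs_sin)
  also have "\<bar>sin (x - k * pi)\<bar> = \<bar>sin x\<bar>"
    by (simp add: sin_diff cos_int_pi)
  finally show ?thesis using assms by (intro exI[of _ k]) linarith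
qed

lemma cos_ge_one_minus: "1 - x\<^sup>2 / 2 \<le> cos (x::real)"
proof -
  have "cos x = 1 - 2 * (sin (x/2))\<^sup>2" using cos_double_sin[of "x/2"] by simp
  moreover have "(sin (x/2))\<^sup>2 \<le> (x/2)\<^sup>2"
    using abs_sin_x_le_abs_x[of "x/2"] abs_le_square_iff by blast
  ultimately show ?thesis by (simp add: power2_eq_square)
qed

lemma cos_ge_near_zero: "\<bar>x\<bar> \<le> 1/2 \<Longrightarrow> 7/8 \<le> cos (x::real)"
  using cos_ge_one_minus[of x] power_mono[of "\<bar>x\<bar>" "1/2" 2] by (simp add: power2_eq_square)

lemma growth_ge:
  fixes f :: "real \<Rightarrow> real"
  assumes "a \<le> b" "\<And>t. t \<in> {a..b} \<Longrightarrow> (f has_real_derivative f' t) (at t within {a..b})"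
    and "\<And>t. t \<in> {a..b} \<Longrightarrow> c \<le> f' t"
  shows "c * (b - a) \<le> f b - f a"
proof -
  obtain x where "x \<in> {a..b}" "f b - f a = (b - a) * f' x"
    using mvt_very_simple[OF assms(1), of f "\<lambda>x h. h * f' x"] assms(2)
    by (auto simp: has_field_derivative_def mult_commute_abs)
  then show ?thesis using assms(1,3) by (metis diff_ge_0_iff_ge mult.commute mult_left_mono)
qed

lemma has_real_derivative_subset:
  assumes "\<And>t. t \<in> S \<Longrightarrow> (f has_real_derivative f' t) (at t within S)" "X \<subseteq> S" "t \<in> X"
  shows "(f has_real_derivative f' t) (at t within X)"
  using assms DERIV_subset by blast

lemma real_diff_le_of_derivative:
  fixes f :: "real \<Rightarrow> real"
  assumes "\<And>t. t \<in> {0..T} \<Longrightarrow> (f has_real_derivative f' t) (at t within {0..T})"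
    and "\<And>t. t \<in> {0..T} \<Longrightarrow> \<bar>f' t\<bar> \<le> m" and "a \<in> {0..T}" "b \<in> {0..T}"
  shows "\<bar>f b - f a\<bar> \<le> m * \<bar>b - a\<bar>"
proof -
  have *: "\<bar>f b - f a\<bar> \<le> m * (b - a)" if "a \<le> b" "a \<in> {0..T}" "b \<in> {0..T}" for a b
  proof -
    have "norm (f b - f a) \<le> m * (b - a)"
    proof (rule norm_diff_le_of_vector_derivative[where f' = f', OF that(1)])
      fix t assume t: "t \<in> {a..b}"
      have sub: "{a..b} \<subseteq> {0..T}" using that by auto
      show "(f has_vector_derivative f' t) (at t within {a..b})"
        using has_real_derivative_subset[OF assms(1) sub t] by (simp add: has_real_derivative_iff_has_vector_derivative)
      show "norm (f' t) \<le> m" using assms(2) sub t by auto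
    qed
    then show ?thesis by simp
  qed
  show ?thesis using *[of a b] *[of b a] assms(3,4) by (cases "a \<le> b") (auto simp: abs_minus_commute)
qed

text \<open>A slope of at least 1/2 gains 1/8 on either side of \<open>x\<close>, more than the 1/10
  by which \<open>f x\<close> may miss zero; the same growth excludes a second zero.\<close>

lemma unique_crossing:
  fixes f :: "real \<Rightarrow> real"
  assumes der: "\<And>t. t \<in> {x - 1/4..x + 1/4} \<Longrightarrow> (f has_real_derivative f' t) (at t within {x - 1/4..x + 1/4})"
    and low: "\<And>t. t \<in> {x - 1/4..x + 1/4} \<Longrightarrow> 1/2 \<le> f' t" and small: "\<bar>f x\<bar> \<le> 1/10"
  shows "\<exists>!t. t \<in> {x - 1/4..x + 1/4} \<and> f t = 0"
proof -
  have mono: "1/2 * (b - a) \<le> f b - f a" if "a \<le> b" "{a..b} \<subseteq> {x - 1/4..x + 1/4}" for a b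
    by (rule growth_ge[OF that(1), of f f'])
       (use has_real_derivative_subset[OF der that(2)] low that(2) in auto)
  have "f x + 1/8 \<le> f (x + 1/4)" "f (x - 1/4) + 1/8 \<le> f x"
    using mono[of x "x + 1/4"] mono[of "x - 1/4" x] by (auto simp: subset_iff)
  then have "f (x - 1/4) \<le> 0" "0 \<le> f (x + 1/4)" using small by linarith+
  moreover have "continuous_on {x - 1/4..x + 1/4} f"
    by (rule DERIV_continuous_on) (rule der)
  ultimately obtain t where t: "x - 1/4 \<le> t" "t \<le> x + 1/4" "f t = 0"
    using IVT'[of f "x - 1/4" 0 "x + 1/4"] by auto
  have "s = t" if "s \<in> {x - 1/4..x + 1/4}" "f s = 0" for s
  proof (cases "s \<le> t")
    case True
    have "{s..t} \<subseteq> {x - 1/4..x + 1/4}" using that t by simp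
    from mono[OF True this] show ?thesis using True that t by simp
  next
    case False
    then have "t \<le> s" by simp
    moreover have "{t..s} \<subseteq> {x - 1/4..x + 1/4}" using that t by simp
    ultimately show ?thesis using mono[of t s] that t by simp
  qed
  moreover have "t \<in> {x - 1/4..x + 1/4}" using t by simp
  ultimately show ?thesis using t(3) by blast
qed

text \<open>\<open>R\<close> will be the squared distance. A zero of \<open>\<rho>\<close> lies near
  a multiple of pi/2; near the multiples of pi the derivative \<open>\<rho>'\<close> is positive,
  which no maximum allows, and near each \<open>j * pi + pi / 2\<close> strict decrease of
  \<open>\<rho>\<close> leaves exactly one zero, a maximum. The tolerance 1/2 on \<open>T\<close>
  keeps the end of the interval clear of these windows.\<close>

lemma card_local_max_near_sin_squared:
  fixes R \<rho> \<rho>' :: "real \<Rightarrow> real" and k :: nat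
  assumes R: "\<And>t. t \<in> {0..T} \<Longrightarrow> (R has_real_derivative 2 * \<rho> t) (at t within {0..T})"
    and \<rho>: "\<And>t. t \<in> {0..T} \<Longrightarrow> (\<rho> has_real_derivative \<rho>' t) (at t within {0..T})"
    and near: "\<And>t. t \<in> {0..T} \<Longrightarrow> \<bar>\<rho> t - sin t * cos t\<bar> \<le> 1/10"
    and near': "\<And>t. t \<in> {0..T} \<Longrightarrow> \<bar>\<rho>' t - cos (2 * t)\<bar> \<le> 1/10"
    and T: "\<bar>T - real k * pi\<bar> \<le> 1/2"
  defines "M \<equiv> {t \<in> {0<..<T}. \<forall>\<^sub>F s in at t. R s \<le> R t}"
  shows "finite M \<and> card M = k"
proof -
  define c where "c j = real j * pi + pi / 2" for j :: nat
  define w where "w j = {c j - 1/4..c j + 1/4}" for j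
  have sub: "w j \<subseteq> {0<..<T}" if "j < k" for j
  proof -
    have "real j * pi + pi \<le> real k * pi"
      using that mult_right_mono[of "real j + 1" "real k" pi] by (simp add: algebra_simps)
    moreover have "0 \<le> real j * pi" by simp
    ultimately have "0 < c j - 1/4" "c j + 1/4 < T"
      using T pi_gt3 unfolding c_def abs_le_iff by linarith+
    then show ?thesis by (auto simp: w_def)
  qed
  have down: "\<rho>' t \<le> - 1/2" if "t \<in> w j" "j < k" for t j
  proof -
    have "cos (2 * (t - c j)) \<ge> 7/8" using that by (intro cos_ge_near_zero) (auto simp: w_def abs_if)
    moreover have "2 * t = of_int (2 * int j + 1) * pi + 2 * (t - c j)" by (simp add: c_def algebra_simps)
    then have "cos (2 * t) = - cos (2 * (t - c j))" by (simp only: cos_shift_int_pi) simp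
    ultimately show ?thesis using near'[of t] sub[OF that(2)] that(1) by (auto simp: abs_if split: if_splits)
  qed
  have ex1: "\<exists>!t. t \<in> w j \<and> - \<rho> t = 0" if "j < k" for j
    unfolding w_def
  proof (rule unique_crossing[where f' = "\<lambda>t. - \<rho>' t"])
    show "((\<lambda>t. - \<rho> t) has_real_derivative - \<rho>' t) (at t within {c j - 1/4..c j + 1/4})"
      if "t \<in> {c j - 1/4..c j + 1/4}" for t
      by (rule DERIV_minus, rule has_real_derivative_subset[OF \<rho> subset_trans[OF sub[OF \<open>j < k\<close>, unfolded w_def]]])
         (use that in auto)
    show "1/2 \<le> - \<rho>' t" if "t \<in> {c j - 1/4..c j + 1/4}" for t
      using down[of t j] \<open>j < k\<close> that by (simp add: w_def)
    have "c j \<in> {0..T}" using subsetD[OF sub[OF that], of "c j"] by (simp add: w_def)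
    moreover have "cos (c j) = 0" by (simp add: c_def cos_add mult.commute[of _ pi])
    ultimately show "\<bar>- \<rho> (c j)\<bar> \<le> 1/10" using near[of "c j"] by simp
  qed
  define \<tau> where "\<tau> j = (THE t. t \<in> w j \<and> - \<rho> t = 0)" for j
  have \<tau>: "\<tau> j \<in> w j" "\<rho> (\<tau> j) = 0" if "j < k" for j
    using theI'[OF ex1[OF that]] by (auto simp: \<tau>_def)
  have \<tau>_unique: "t = \<tau> j" if "t \<in> w j" "\<rho> t = 0" "j < k" for t j
    using ex1[OF that(3)] \<tau>[OF that(3)] that(1,2) by auto
  have crit: "\<exists>j<k. t \<in> w j" if t: "t \<in> {0<..<T}" and 0: "\<rho> t = 0" and low: "\<rho>' t \<le> 0" for t
  proof -
    have "\<bar>sin (2 * t)\<bar> \<le> 1/5" using near[of t] t 0 by (auto simp: sin_double)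
    then obtain i :: int where i: "\<bar>2 * t - i * pi\<bar> \<le> 2/5" using near_multiple_of_pi by fastforce
    have "odd i"
    proof
      assume "even i"
      have "cos (2 * t) = cos (i * pi + (2 * t - i * pi))" by simp
      also have "\<dots> = cos (2 * t - i * pi)" using \<open>even i\<close> by (simp only: cos_shift_int_pi if_True)
      also have "\<dots> \<ge> 7/8" by (rule cos_ge_near_zero) (use i in linarith)
      finally show False using near'[of t] t low by (auto simp: abs_if split: if_splits)
    qed
    then obtain m where m: "i = 2 * m + 1" by (elim oddE)
    have eq: "i * pi = 2 * (m * pi) + pi" by (simp add: m algebra_simps)
    have mt: "\<bar>t - (m * pi + pi / 2)\<bar> \<le> 1/5" using i unfolding eq by (simp add: abs_if split: if_splits)
    have "0 \<le> m"
    proof (rule ccontr)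
      assume "\<not> 0 \<le> m"
      then have "m * pi \<le> - 1 * pi" by (intro mult_right_mono) auto
      then show False using mt t pi_gt3 by (auto simp: abs_if split: if_splits)
    qed
    moreover have "m < int k"
    proof (rule ccontr)
      assume "\<not> m < int k"
      then have "real k * pi \<le> m * pi" by (intro mult_right_mono) auto
      moreover have "t < T" using t by simp
      ultimately show False using mt pi_gt3 T unfolding abs_le_iff by linarith
    qed
    ultimately have "nat m < k" "t \<in> w (nat m)" using mt by (auto simp: w_def c_def abs_if split: if_splits)
    then show ?thesis by blast
  qed
  have at: "at t within {0..T} = at t" if "t \<in> {0<..<T}" for t
    using that by (auto intro: at_within_interior)
  have Rd: "(R has_real_derivative 2 * \<rho> t) (at t)" and \<rho>d: "(\<rho> has_real_derivative \<rho>' t) (at t)"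
    if "t \<in> {0<..<T}" for t
    using R[of t] \<rho>[of t] at[OF that] that by auto
  have "t \<in> \<tau> ` {..<k}" if "t \<in> M" for t
  proof -
    have t: "t \<in> {0<..<T}" and lm: "\<forall>\<^sub>F s in at t. R s \<le> R t" using that by (auto simp: M_def)
    obtain d where d: "d > 0" "\<And>s. s \<noteq> t \<Longrightarrow> dist s t < d \<Longrightarrow> R s \<le> R t"
      using lm unfolding eventually_at by auto
    have "2 * \<rho> t = 0"
      by (rule DERIV_local_max[OF Rd[OF t] d(1)]) (use d(2) in \<open>force simp: dist_real_def\<close>)
    then have z: "\<rho> t = 0" by simp
    have "\<rho>' t \<le> 0"
    proof (rule ccontr)
      assume "\<not> \<rho>' t \<le> 0"
      then obtain d' where d': "d' > 0" "\<And>h. 0 < h \<Longrightarrow> h < d' \<Longrightarrow> \<rho> t < \<rho> (t + h)"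
        using DERIV_pos_inc_right[OF \<rho>d[OF t]] by auto
      \<comment> \<open>Halving makes \<open>h\<close> strictly smaller than all three bounds. On
        the interval after \<open>t\<close> the function \<open>\<rho>\<close> is then positive, so
        \<open>R\<close> would rise beyond its local maximum.\<close>
      define h where "h = min (min d d') (T - t) / 2"
      have h0: "0 < 2 * h" "2 * h \<le> d" "2 * h \<le> d'" "2 * h \<le> T - t" using d(1) d'(1) t by (auto simp: h_def)
      then have h: "0 < h" "h < d" "h < d'" "t + h < T" by linarith+
      have "R t < R (t + h)"
      proof (rule DERIV_pos_imp_increasing_open[where f = R])
        show "\<exists>y. (R has_real_derivative y) (at x) \<and> 0 < y" if "t < x" "x < t + h" for x
          using Rd[of x] d'(2)[of "x - t"] that h t z by (intro exI[of _ "2 * \<rho> x"]) auto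
        show "continuous_on {t..t + h} R"
          by (rule continuous_at_imp_continuous_on) (use h t in \<open>auto intro!: DERIV_isCont[OF Rd]\<close>)
      qed (use h in simp)
      then show False using d(2)[of "t + h"] h by (auto simp: dist_real_def)
    qed
    from crit[OF t z this] obtain j where "j < k" "t \<in> w j" by blast
    then show ?thesis using \<tau>_unique z by blast
  qed
  moreover have "\<tau> j \<in> M" if "j < k" for j
  proof -
    have t: "\<tau> j \<in> {0<..<T}" using \<tau>(1) sub that by blast
    have "\<rho>' (\<tau> j) < 0" using down[OF \<tau>(1)[OF that] that] by simp
    from DERIV_neg_dec_right[OF \<rho>d[OF t] this] obtain d where
      d: "d > 0" "\<And>h. 0 < h \<Longrightarrow> h < d \<Longrightarrow> \<rho> (\<tau> j + h) < \<rho> (\<tau> j)" by auto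
    from DERIV_neg_dec_left[OF \<rho>d[OF t] \<open>\<rho>' (\<tau> j) < 0\<close>] obtain d' where
      d': "d' > 0" "\<And>h. 0 < h \<Longrightarrow> h < d' \<Longrightarrow> \<rho> (\<tau> j) < \<rho> (\<tau> j - h)" by auto
    define b where "b = min (min d d') (min (\<tau> j) (T - \<tau> j))"
    have b: "b > 0" "b \<le> d" "b \<le> d'" "b \<le> \<tau> j" "b \<le> T - \<tau> j" using d d' t by (auto simp: b_def)
    have "R s \<le> R (\<tau> j)" if s: "dist s (\<tau> j) < b" for s
    proof (cases "s \<le> \<tau> j")
      case True
      show ?thesis
      proof (rule DERIV_nonneg_imp_nondecreasing[OF True, where f = R])
        fix x assume x: "s \<le> x" "x \<le> \<tau> j"
        have "0 \<le> \<rho> x" using d'(2)[of "\<tau> j - x"] \<tau>(2)[OF \<open>j < k\<close>] x s b by (cases "x = \<tau> j") (auto simp: dist_real_def)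
        then show "\<exists>y. (R has_real_derivative y) (at x) \<and> 0 \<le> y"
          using Rd[of x] x s b t by (intro exI[of _ "2 * \<rho> x"]) (auto simp: dist_real_def)
      qed
    next
      case False
      then have "\<tau> j \<le> s" by simp
      then show ?thesis
      proof (rule DERIV_nonpos_imp_nonincreasing[where f = R])
        fix x assume x: "\<tau> j \<le> x" "x \<le> s"
        have "\<rho> x \<le> 0" using d(2)[of "x - \<tau> j"] \<tau>(2)[OF \<open>j < k\<close>] x s b by (cases "x = \<tau> j") (auto simp: dist_real_def)
        then show "\<exists>y. (R has_real_derivative y) (at x) \<and> y \<le> 0"
          using Rd[of x] x s b t by (intro exI[of _ "2 * \<rho> x"]) (auto simp: dist_real_def)
      qed
    qed
    then have "\<forall>\<^sub>F s in at (\<tau> j). R s \<le> R (\<tau> j)" unfolding eventually_at using b(1) by blast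
    then show ?thesis using t by (simp add: M_def)
  qed
  ultimately have M: "M = \<tau> ` {..<k}" by auto
  have "inj_on \<tau> {..<k}"
  proof (rule inj_onI)
    have less: "\<tau> i < \<tau> j" if "i < j" "j < k" for i j
    proof -
      have "real i * pi + pi \<le> real j * pi"
        using that mult_right_mono[of "real i + 1" "real j" pi] by (simp add: algebra_simps)
      moreover have "\<tau> i \<in> w i" "\<tau> j \<in> w j" using \<tau>(1) that by auto
      ultimately show ?thesis using pi_gt3 by (auto simp: w_def c_def)
    qed
    fix i j assume "i \<in> {..<k}" "j \<in> {..<k}" "\<tau> i = \<tau> j"
    then show "i = j" using less[of i j] less[of j i] by (cases i j rule: linorder_cases) auto
  qed
  then show ?thesis unfolding M by (simp add: card_image)
qed

section \<open>Energy and angular momentum\<close>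

definition sqn :: "complex \<Rightarrow> real" where "sqn w = Re (cnj w * w)"

lemma sqn_eq_norm: "sqn w = (norm w)\<^sup>2"
  unfolding cmod_power2 sqn_def by (simp add: power2_eq_square)

text \<open>Up to the factor -12 \<epsilon>^2 this is the torque of the tidal term. With Z =
  \<open>cis (2 * \<theta>)\<close> w^2 the non-radial part of the tide is governed by Re Z Im Z =
  Im (Z^2) / 2, which is why the angle appears as 4 \<theta>.\<close>

definition torque :: "real \<Rightarrow> complex \<Rightarrow> real" where
  "torque \<theta> w = sqn w * Im (cis (4 * \<theta>) * w ^ 4)"

text \<open>Inertial angular momentum: conserved without the tidal term, and zero at collision.\<close>

definition ang_mom :: "real \<Rightarrow> complex \<Rightarrow> complex \<Rightarrow> real" where
  "ang_mom \<epsilon> w p = Im (cnj w * p) + 2 * \<epsilon> * (sqn w)\<^sup>2"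

text \<open>The Jacobi integral in scaled variables. The Coriolis force is perpendicular to
  \<open>p\<close> and does no work, so only the tidal potential is added to the energy of the
  oscillator.\<close>

definition energy :: "real \<Rightarrow> real \<Rightarrow> complex \<Rightarrow> complex \<Rightarrow> real" where
  "energy \<epsilon> \<theta> w p = sqn p + sqn w - 12 * \<epsilon>\<^sup>2 * (sqn w * (Re (cis (2 * \<theta>) * w\<^sup>2))\<^sup>2)"

lemma cis_double: "cis (4 * \<theta>) = (cis (2 * \<theta>))\<^sup>2" "cis (- 2 * \<theta>) = cnj (cis (2 * \<theta>))"
  by (simp_all add: power2_eq_square cis_mult cis_cnj)

text \<open>The Coriolis force contributes -8 \<epsilon> \<open>sqn w * Re (cnj w * p)\<close>,
  which is minus the derivative of the quartic term of \<open>ang_mom\<close> along an orbit. Once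
  it is moved to the other side, only the tide remains.\<close>

lemma torque_identity:
  "Im (cnj w * hill_rhs \<epsilon> \<theta> w p) + 8 * \<epsilon> * (sqn w * Re (cnj w * p)) = - 12 * \<epsilon>\<^sup>2 * torque \<theta> w"
proof -
  obtain x y where w: "w = Complex x y" by (cases w)
  obtain a b where p: "p = Complex a b" by (cases p)
  obtain c s where c: "cis (2 * \<theta>) = Complex c s" by (cases "cis (2 * \<theta>)")
  show ?thesis
    unfolding hill_rhs_def torque_def sqn_def cis_double c w p
    by (simp add: power2_eq_square power4_eq_xxxx complex_of_real_def) algebra
qed

lemma energy_identity:
  "2 * Re (cnj p * (- w + hill_rhs \<epsilon> \<theta> w p)) + 2 * Re (cnj w * p)
    - 12 * \<epsilon>\<^sup>2 * (sqn w * (2 * Re (cis (2 * \<theta>) * w\<^sup>2) * (2 * Re (cis (2 * \<theta>) * (w * p))))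
        + 2 * Re (cnj w * p) * (Re (cis (2 * \<theta>) * w\<^sup>2))\<^sup>2) = 0"
proof -
  obtain x y where w: "w = Complex x y" by (cases w)
  obtain a b where p: "p = Complex a b" by (cases p)
  obtain c s where c: "cis (2 * \<theta>) = Complex c s" by (cases "cis (2 * \<theta>)")
  show ?thesis
    unfolding hill_rhs_def sqn_def cis_double c w p
    by (simp add: power2_eq_square complex_of_real_def) algebra
qed

lemma has_real_derivative_Re_Im:
  assumes "(f has_vector_derivative f') (at t within S)"
  shows "((\<lambda>t. Re (f t)) has_real_derivative Re f') (at t within S)"
    and "((\<lambda>t. Im (f t)) has_real_derivative Im f') (at t within S)"
  using assms by (simp_all add: has_vector_derivative_complex_iff has_real_derivative_iff_has_vector_derivative)

context
  fixes \<epsilon> \<theta> T w p t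
  assumes sol: "hsol \<epsilon> \<theta> T w p" and t: "t \<in> {0..T}"
begin

lemma hsol_derivs:
  "(w has_vector_derivative p t) (at t within {0..T})"
  "(p has_vector_derivative (- w t + hill_rhs \<epsilon> \<theta> (w t) (p t))) (at t within {0..T})"
  using sol t by (auto simp: hsol_def)

lemma cnj_w_p_derivative:
  "((\<lambda>t. cnj (w t) * p t) has_vector_derivative
     (cnj (w t) * (- w t + hill_rhs \<epsilon> \<theta> (w t) (p t)) + cnj (p t) * p t)) (at t within {0..T})"
  by (intro has_vector_derivative_mult has_vector_derivative_cnj hsol_derivs)

lemma sqn_derivative:
  "((\<lambda>t. sqn (w t)) has_real_derivative 2 * Re (cnj (w t) * p t)) (at t within {0..T})"
proof -
  have "((\<lambda>t. cnj (w t) * w t) has_vector_derivative (cnj (w t) * p t + cnj (p t) * w t)) (at t within {0..T})"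
    by (intro has_vector_derivative_mult has_vector_derivative_cnj hsol_derivs)
  from has_real_derivative_Re_Im(1)[OF this] show ?thesis unfolding sqn_def
    by (rule DERIV_cong) (simp add: algebra_simps)
qed

lemma rho_derivative:
  "((\<lambda>t. Re (cnj (w t) * p t)) has_real_derivative
     (sqn (p t) - sqn (w t) + Re (cnj (w t) * hill_rhs \<epsilon> \<theta> (w t) (p t)))) (at t within {0..T})"
  using has_real_derivative_Re_Im(1)[OF cnj_w_p_derivative]
  by (rule DERIV_cong) (simp add: sqn_def algebra_simps)

lemma ang_mom_derivative:
  "((\<lambda>t. ang_mom \<epsilon> (w t) (p t)) has_real_derivative (- 12 * \<epsilon>\<^sup>2 * torque \<theta> (w t))) (at t within {0..T})"
proof -
  have "((\<lambda>t. (sqn (w t))\<^sup>2) has_real_derivative (4 * (sqn (w t) * Re (cnj (w t) * p t)))) (at t within {0..T})"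
    by (rule DERIV_cong[OF DERIV_power[OF sqn_derivative]]) simp
  from DERIV_add[OF has_real_derivative_Re_Im(2)[OF cnj_w_p_derivative] DERIV_cmult[OF this, of "2 * \<epsilon>"]]
  show ?thesis unfolding ang_mom_def
  proof (rule DERIV_cong)
    have *: "Im (cnj (w t) * (- w t + z) + cnj (p t) * p t) = Im (cnj (w t) * z)" for z
      by (simp add: algebra_simps)
    show "Im (cnj (w t) * (- w t + hill_rhs \<epsilon> \<theta> (w t) (p t)) + cnj (p t) * p t)
        + 2 * \<epsilon> * (4 * (sqn (w t) * Re (cnj (w t) * p t))) = - 12 * \<epsilon>\<^sup>2 * torque \<theta> (w t)"
      unfolding * using torque_identity[of "w t" \<epsilon> \<theta> "p t"] by (simp add: mult.assoc)
  qed
qed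

lemma energy_derivative:
  "((\<lambda>t. energy \<epsilon> \<theta> (w t) (p t)) has_real_derivative 0) (at t within {0..T})"
proof -
  have "((\<lambda>t. cnj (p t) * p t) has_vector_derivative (cnj (p t) * (- w t + hill_rhs \<epsilon> \<theta> (w t) (p t))
      + cnj (- w t + hill_rhs \<epsilon> \<theta> (w t) (p t)) * p t)) (at t within {0..T})"
    by (intro has_vector_derivative_mult has_vector_derivative_cnj hsol_derivs)
  from has_real_derivative_Re_Im(1)[OF this]
  have 1: "((\<lambda>t. sqn (p t)) has_real_derivative 2 * Re (cnj (p t) * (- w t + hill_rhs \<epsilon> \<theta> (w t) (p t)))) (at t within {0..T})"
    unfolding sqn_def by (rule DERIV_cong) (simp add: algebra_simps)
  have "((\<lambda>t. cis (2 * \<theta>) * (w t * w t)) has_vector_derivative (cis (2 * \<theta>) * (w t * p t + p t * w t))) (at t within {0..T})"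
    by (intro has_vector_derivative_mult_right has_vector_derivative_mult hsol_derivs)
  from has_real_derivative_Re_Im(1)[OF this]
  have "((\<lambda>t. Re (cis (2 * \<theta>) * (w t)\<^sup>2)) has_real_derivative 2 * Re (cis (2 * \<theta>) * (w t * p t))) (at t within {0..T})"
    unfolding power2_eq_square by (rule DERIV_cong) (simp add: algebra_simps)
  note q = DERIV_power[OF this, of 2]
  define A B q r
    where "A = Re (cnj (p t) * (- w t + hill_rhs \<epsilon> \<theta> (w t) (p t)))" and "B = Re (cnj (w t) * p t)"
      and "q = Re (cis (2 * \<theta>) * (w t)\<^sup>2)" and "r = Re (cis (2 * \<theta>) * (w t * p t))"
  note folds = A_def[symmetric] B_def[symmetric] q_def[symmetric] r_def[symmetric]
  show ?thesis unfolding energy_def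
  proof (rule DERIV_cong[OF DERIV_diff[OF DERIV_add[OF 1 sqn_derivative] DERIV_cmult[OF DERIV_mult[OF sqn_derivative q]]]])
    show "2 * Re (cnj (p t) * (- w t + hill_rhs \<epsilon> \<theta> (w t) (p t))) + 2 * Re (cnj (w t) * p t)
       - 12 * \<epsilon>\<^sup>2 * (2 * Re (cnj (w t) * p t) * (Re (cis (2 * \<theta>) * (w t)\<^sup>2))\<^sup>2
         + of_nat 2 * (2 * Re (cis (2 * \<theta>) * (w t * p t)) * Re (cis (2 * \<theta>) * (w t)\<^sup>2) ^ (2 - Suc 0)) * sqn (w t)) = 0"
      using energy_identity[of "p t" "w t" \<epsilon> \<theta>] unfolding folds by (simp add: algebra_simps)
  qed
qed

end

lemma hsol_energy:
  assumes "hsol \<epsilon> \<theta> T w p" "t \<in> {0..T}"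
  shows "energy \<epsilon> \<theta> (w t) (p t) = 1"
proof -
  have "\<exists>c. \<forall>t\<in>{0..T}. energy \<epsilon> \<theta> (w t) (p t) = c"
    by (rule has_field_derivative_zero_constant) (auto intro: energy_derivative[OF assms(1)])
  then have "energy \<epsilon> \<theta> (w t) (p t) = energy \<epsilon> \<theta> (w 0) (p 0)" using assms(2) by force
  then show ?thesis using assms(1) by (simp add: hsol_def energy_def sqn_def)
qed

text \<open>At \<open>w = 0\<close> the energy reduces to \<open>sqn p\<close>. A collision momentum
  is thus a unit complex number, and rotating it to 1 turns the continuation of the motion, or its
  reversal, into a normalized ejection orbit.\<close>

lemma norm_momentum_at_collision:
  assumes "hsol \<epsilon> \<theta> T w p" "t \<in> {0..T}" "w t = 0"
  shows "norm (p t) = 1"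
proof -
  have "(norm (p t))\<^sup>2 = 1"
    using hsol_energy[OF assms(1,2)] assms(3) by (simp add: energy_def sqn_eq_norm)
  then show ?thesis by (simp add: power2_eq_1_iff) (smt (verit) norm_ge_zero)
qed

section \<open>Rotation and time reversal\<close>

lemma hill_rhs_rotate:
  assumes c: "norm c = 1" and s: "s = 1 \<or> s = - 1" and \<theta>: "cis (2 * \<theta>') * c\<^sup>2 = s * cis (2 * \<theta>)"
  shows "hill_rhs \<epsilon> \<theta>' (c * w) (c * p) = c * hill_rhs \<epsilon> \<theta> w p"
proof -
  have cc: "cnj c * c = 1" "c * cnj c = 1"
    using c complex_norm_square[of c] by (simp_all add: mult.commute)
  have R: "(c * w) * cnj (c * w) = w * cnj w"
  proof -
    have "(c * w) * cnj (c * w) = (c * cnj c) * (w * cnj w)" by (simp add: mult_ac)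
    then show ?thesis by (simp add: cc)
  qed
  have q: "Re (cis (2 * \<theta>') * (c * w)\<^sup>2) = Re (s * (cis (2 * \<theta>) * w\<^sup>2))"
    by (simp only: power_mult_distrib mult.assoc[symmetric] \<theta>)
  have "cnj (cis (2 * \<theta>')) * (cnj c * cnj c) = cnj s * cnj (cis (2 * \<theta>))"
    using arg_cong[OF \<theta>, of cnj] by (simp add: power2_eq_square)
  moreover have "cnj (cis (2 * \<theta>')) * cnj c = cnj (cis (2 * \<theta>')) * (cnj c * cnj c) * c"
    by (simp add: mult.assoc cc)
  ultimately have "cnj (cis (2 * \<theta>')) * cnj (c * w) = c * (cnj s * (cnj (cis (2 * \<theta>)) * cnj w))"
    by (simp add: mult_ac)
  note z = this
  \<comment> \<open>For \<open>s = - 1\<close> both \<open>Re Q\<close> and the factor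
    \<open>cis (- 2 * \<theta>) * cnj w\<close> change sign. The tide contains the square of the
    former or the product of the two, so the sign cancels. This is the invariance of the Hill
    problem under (x, y) -> (-x, -y).\<close>
  define Q where "Q = cis (2 * \<theta>) * w\<^sup>2"
  show ?thesis
    unfolding hill_rhs_def R q cis_double(2) z Q_def[symmetric] using s
    by (elim disjE) (simp_all add: algebra_simps)
qed

text \<open>Conjugation alone would reverse the sense of the Coriolis force; the sign change of the
  momentum under time reversal restores it. What is left is a rotation.\<close>

lemma hill_rhs_reverse:
  assumes c: "norm c = 1" and s: "s = 1 \<or> s = - 1" and \<theta>: "cis (2 * \<theta>') * c\<^sup>2 = s * cnj (cis (2 * \<theta>))"
  shows "hill_rhs \<epsilon> \<theta>' (c * cnj w) (- c * cnj p) = c * cnj (hill_rhs \<epsilon> \<theta> w p)"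
proof -
  have "cis (2 * \<theta>') * c\<^sup>2 = s * cis (2 * (- \<theta>))" using \<theta> by (simp add: cis_cnj)
  then have "hill_rhs \<epsilon> \<theta>' (c * cnj w) (c * - cnj p) = c * hill_rhs \<epsilon> (- \<theta>) (cnj w) (- cnj p)"
    by (rule hill_rhs_rotate[OF c s])
  moreover have "hill_rhs \<epsilon> (- \<theta>) (cnj w) (- cnj p) = cnj (hill_rhs \<epsilon> \<theta> w p)"
  proof -
    have "Re (cis (2 * - \<theta>) * (cnj w)\<^sup>2) = Re (cis (2 * \<theta>) * w\<^sup>2)"
      using cis_cnj[of "2 * \<theta>"] by (metis complex_cnj_mult complex_cnj_power complex_cnj mult_minus_right cnj.simps(1))
    then show ?thesis unfolding hill_rhs_def by (simp add: cis_cnj mult_ac)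
  qed
  ultimately show ?thesis by simp
qed

text \<open>The regularized motion runs smoothly through a collision. Division by the unit momentum
  \<open>p t0\<close> normalizes what follows to an ejection orbit whose angle is \<theta> plus the
  argument of \<open>p t0\<close>, up to quarter turns, which are the freedom left by
  \<open>s\<close>.\<close>

lemma hsol_shift:
  assumes sol: "hsol \<epsilon> \<theta> T w p" and t0: "t0 \<in> {0..T}" and w0: "w t0 = 0" and p0: "norm (p t0) = 1"
    and s: "s = 1 \<or> s = - 1" and \<theta>: "cis (2 * \<theta>') = s * (cis (2 * \<theta>) * (p t0)\<^sup>2)"
  shows "hsol \<epsilon> \<theta>' (T - t0) (\<lambda>t. w (t0 + t) / p t0) (\<lambda>t. p (t0 + t) / p t0)"
proof -
  define c where "c = inverse (p t0)"
  have c: "norm c = 1" "p t0 \<noteq> 0" using p0 by (auto simp: c_def norm_inverse)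
  have \<theta>c: "cis (2 * \<theta>') * c\<^sup>2 = s * cis (2 * \<theta>)"
    unfolding \<theta> c_def power_inverse using c(2) by (simp add: mult.assoc)
  have shift: "((\<lambda>t. c * f (t0 + t)) has_vector_derivative c * f') (at t within {0..T - t0})"
    if "(f has_vector_derivative f') (at (t0 + t) within {0..T})" for f f' t
  proof -
    have "((\<lambda>t. t0 + t) has_vector_derivative 1) (at t within {0..T - t0})"
      by (auto intro!: derivative_eq_intros)
    moreover have "(f has_vector_derivative f') (at (t0 + t) within (\<lambda>t. t0 + t) ` {0..T - t0})"
      using that by (rule has_vector_derivative_within_subset) (use t0 in auto)
    ultimately have "((f \<circ> (\<lambda>t. t0 + t)) has_vector_derivative 1 *\<^sub>R f') (at t within {0..T - t0})"
      by (rule vector_diff_chain_within)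
    then show ?thesis by (intro has_vector_derivative_mult_right) (simp add: o_def)
  qed
  have "hsol \<epsilon> \<theta>' (T - t0) (\<lambda>t. c * w (t0 + t)) (\<lambda>t. c * p (t0 + t))"
    unfolding hsol_def
  proof (intro conjI ballI)
    fix t assume "t \<in> {0..T - t0}"
    then have t: "t0 + t \<in> {0..T}" using t0 by auto
    show "((\<lambda>t. c * w (t0 + t)) has_vector_derivative c * p (t0 + t)) (at t within {0..T - t0})"
      by (rule shift[OF hsol_derivs(1)[OF sol t]])
    show "((\<lambda>t. c * p (t0 + t)) has_vector_derivative
        - (c * w (t0 + t)) + hill_rhs \<epsilon> \<theta>' (c * w (t0 + t)) (c * p (t0 + t))) (at t within {0..T - t0})"
      unfolding hill_rhs_rotate[OF c(1) s \<theta>c]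
      using shift[OF hsol_derivs(2)[OF sol t]] by (simp add: algebra_simps)
  qed (use w0 c in \<open>auto simp: c_def\<close>)
  then show ?thesis by (simp add: c_def field_simps)
qed

text \<open>An arc from ejection to collision, run backwards and reflected, is again such an arc.
  The factor \<open>p t0\<close> normalizes its initial momentum, because
  \<open>p t0 * cnj (p t0) = 1\<close>.\<close>

lemma hsol_reverse:
  assumes sol: "hsol \<epsilon> \<theta> T w p" and t0: "t0 \<in> {0..T}" and w0: "w t0 = 0" and p0: "norm (p t0) = 1"
    and s: "s = 1 \<or> s = - 1" and \<theta>: "cis (2 * \<theta>') * (p t0)\<^sup>2 = s * cnj (cis (2 * \<theta>))"
  shows "hsol \<epsilon> \<theta>' t0 (\<lambda>t. - p t0 * cnj (w (t0 - t))) (\<lambda>t. p t0 * cnj (p (t0 - t)))"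
proof -
  define c where "c = - p t0"
  have c: "norm c = 1" "cis (2 * \<theta>') * c\<^sup>2 = s * cnj (cis (2 * \<theta>))" using p0 \<theta> by (auto simp: c_def)
  have rev: "((\<lambda>t. c * cnj (f (t0 - t))) has_vector_derivative - c * cnj f') (at t within {0..t0})"
    if "(f has_vector_derivative f') (at (t0 - t) within {0..T})" for f f' t
  proof -
    have "((\<lambda>t. t0 - t) has_vector_derivative - 1) (at t within {0..t0})"
      by (auto intro!: derivative_eq_intros)
    moreover have "(f has_vector_derivative f') (at (t0 - t) within (\<lambda>t. t0 - t) ` {0..t0})"
      using that by (rule has_vector_derivative_within_subset) (use t0 in auto)
    ultimately have "((f \<circ> (\<lambda>t. t0 - t)) has_vector_derivative - 1 *\<^sub>R f') (at t within {0..t0})"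
      by (rule vector_diff_chain_within)
    then have "((\<lambda>t. cnj (f (t0 - t))) has_vector_derivative cnj (- f')) (at t within {0..t0})"
      by (intro has_vector_derivative_cnj) (simp add: o_def)
    from has_vector_derivative_mult_right[OF this, of c] show ?thesis by simp
  qed
  have "hsol \<epsilon> \<theta>' t0 (\<lambda>t. c * cnj (w (t0 - t))) (\<lambda>t. - c * cnj (p (t0 - t)))"
    unfolding hsol_def
  proof (intro conjI ballI)
    show "c * cnj (w (t0 - 0)) = 0" using w0 by simp
    have "p t0 * cnj (p t0) = 1" using p0 complex_norm_square[of "p t0"] by simp
    then show "- c * cnj (p (t0 - 0)) = 1" by (simp add: c_def)
    fix t assume "t \<in> {0..t0}"
    then have t: "t0 - t \<in> {0..T}" using t0 by auto
    show "((\<lambda>t. c * cnj (w (t0 - t))) has_vector_derivative - c * cnj (p (t0 - t))) (at t within {0..t0})"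
      by (rule rev[OF hsol_derivs(1)[OF sol t]])
    show "((\<lambda>t. - c * cnj (p (t0 - t))) has_vector_derivative
       - (c * cnj (w (t0 - t))) + hill_rhs \<epsilon> \<theta>' (c * cnj (w (t0 - t))) (- c * cnj (p (t0 - t)))) (at t within {0..t0})"
      unfolding hill_rhs_reverse[OF c(1) s c(2)]
      using has_vector_derivative_minus[OF rev[OF hsol_derivs(2)[OF sol t]]] by (simp add: algebra_simps)
  qed
  then show ?thesis by (simp add: c_def)
qed

text \<open>The Coriolis term turns the direction of motion steadily, to first order by \<open>- \<epsilon> t\<close>.\<close>

lemma coriolis_drift:
  assumes sol: "hsol \<epsilon> \<theta> T w p" and e: "0 < \<epsilon>" "32000 * \<epsilon> * T \<le> e" "1152 * \<epsilon> \<le> e" "e \<le> 1/1000"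
    and t0: "t0 \<in> {1..T}" and w0: "w t0 = 0"
  shows "Im (p t0) * cos t0 < 0"
proof -
  have T: "1 \<le> T" using t0 by simp
  have e0: "0 < e" using e by linarith
  have eps1: "\<epsilon> \<le> 1" using e by linarith
  have "8000 * \<epsilon> * T \<le> 1/8" using e by linarith
  note near = hsol_near_sin[OF less_imp_le[OF e(1)] eps1 this sol]
  \<comment> \<open>The slowly varying sine coefficient; at a zero of \<open>w\<close> it equals
    \<open>p t0 * cos t0\<close>, so the claim is about the sign of its imaginary part.\<close>
  define a where "a t = w t * of_real (sin t) + p t * of_real (cos t)" for t
  have ad: "((\<lambda>t. Im (a t)) has_real_derivative Im (hill_rhs \<epsilon> \<theta> (w t) (p t)) * cos t) (at t within {0..T})"
    if t: "t \<in> {0..T}" for t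
  proof -
    have "(a has_vector_derivative ((w t * of_real (cos t) + p t * of_real (sin t))
       + (p t * of_real (- sin t) + (- w t + hill_rhs \<epsilon> \<theta> (w t) (p t)) * of_real (cos t)))) (at t within {0..T})"
      unfolding a_def
      by (intro has_vector_derivative_add has_vector_derivative_mult has_vector_derivative_of_real hsol_derivs[OF sol t])
         (auto intro!: derivative_eq_intros)
    from has_real_derivative_Re_Im(2)[OF this] show ?thesis
      by (rule DERIV_cong) (simp add: algebra_simps)
  qed
  \<comment> \<open>To leading order the derivative of \<open>Im (a t)\<close> is -8 \<epsilon>
    sin^2 t cos^2 t = -\<epsilon> (1 - cos 4t). Adding the primitive of the opposite expression
    leaves in \<open>F\<close> only the error.\<close>
  define F where "F t = Im (a t) + \<epsilon> * (t - sin (4 * t) / 4)" for t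
  have Fd: "(F has_vector_derivative Im (hill_rhs \<epsilon> \<theta> (w t) (p t)) * cos t + \<epsilon> * (1 - cos (4 * t)))
     (at t within {0..T})" if "t \<in> {0..T}" for t
    unfolding has_real_derivative_iff_has_vector_derivative[symmetric] F_def
    by (rule DERIV_add[OF ad[OF that]]) (auto intro!: derivative_eq_intros)
  have bound: "norm (Im (hill_rhs \<epsilon> \<theta> (w t) (p t)) * cos t + \<epsilon> * (1 - cos (4 * t))) \<le> 57 * (\<epsilon> * e)"
    if t: "t \<in> {0..T}" for t
  proof -
    have "16000 * \<epsilon> * t \<le> 16000 * \<epsilon> * T" using t e by (intro mult_left_mono) auto
    then have ww: "norm (w t - of_real (sin t)) \<le> e" and pp: "norm (p t - of_real (cos t)) \<le> e"
      using near(1,2)[OF t] e by linarith+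
    define N where "N = hill_rhs \<epsilon> \<theta> (w t) (p t)"
    define N0 where "N0 = of_real (8 * \<epsilon>) * (- \<i> * (w t * cnj (w t)) * p t)"
    have "norm (N - N0) \<le> 1152 * \<epsilon>\<^sup>2"
      unfolding N_def N0_def by (rule norm_hill_rhs_minus_coriolis_le) (use near[OF t] e eps1 in auto)
    also have "\<dots> \<le> \<epsilon> * e" using mult_left_mono[OF e(3), of \<epsilon>] e by (simp add: power2_eq_square)
    finally have 1: "\<bar>Im N - Im N0\<bar> \<le> \<epsilon> * e" using abs_Im_le_cmod[of "N - N0"] by simp
    have N0: "Im N0 = - 8 * \<epsilon> * (sqn (w t) * Re (p t))"
      by (simp add: N0_def sqn_def algebra_simps)
    have "\<bar>norm (w t) - \<bar>sin t\<bar>\<bar> \<le> e"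
      using norm_triangle_ineq3[of "w t" "of_real (sin t)"] ww by simp
    moreover have s1: "\<bar>sin t\<bar> \<le> 1" by simp
    moreover have "sqn (w t) - (sin t)\<^sup>2 = (norm (w t) - \<bar>sin t\<bar>) * (norm (w t) + \<bar>sin t\<bar>)"
      by (simp add: sqn_eq_norm power2_eq_square algebra_simps)
    moreover have "\<bar>norm (w t) + \<bar>sin t\<bar>\<bar> \<le> 3" using add_mono[OF near(3)[OF t] s1] by simp
    ultimately have "\<bar>sqn (w t) - (sin t)\<^sup>2\<bar> \<le> e * 3"
      using e0 by (simp only: abs_mult) (intro mult_mono; simp)
    moreover have "\<bar>Re (p t)\<bar> \<le> 2" using abs_Re_le_cmod[of "p t"] near(4)[OF t] by linarith
    ultimately have 2: "\<bar>(sqn (w t) - (sin t)\<^sup>2) * Re (p t)\<bar> \<le> e * 3 * 2"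
      unfolding abs_mult using e0 by (intro mult_mono) auto
    have "\<bar>Re (p t) - cos t\<bar> \<le> e" using abs_Re_le_cmod[of "p t - of_real (cos t)"] pp by simp
    then have 3: "\<bar>(sin t)\<^sup>2 * (Re (p t) - cos t)\<bar> \<le> 1 * e"
      unfolding abs_mult by (intro mult_mono) (auto simp: abs_square_le_1)
    have "\<bar>sqn (w t) * Re (p t) - (sin t)\<^sup>2 * cos t\<bar> \<le> e * 7"
    proof -
      have "sqn (w t) * Re (p t) - (sin t)\<^sup>2 * cos t
         = (sqn (w t) - (sin t)\<^sup>2) * Re (p t) + (sin t)\<^sup>2 * (Re (p t) - cos t)"
        by (simp add: algebra_simps)
      then show ?thesis using 2 3 by linarith
    qed
    then have "\<epsilon> * \<bar>sqn (w t) * Re (p t) - (sin t)\<^sup>2 * cos t\<bar> \<le> \<epsilon> * (e * 7)"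
      using e by (intro mult_left_mono) auto
    then have 4: "\<bar>\<epsilon> * (sqn (w t) * Re (p t)) - \<epsilon> * ((sin t)\<^sup>2 * cos t)\<bar> \<le> \<epsilon> * (e * 7)"
      using e(1) by (simp add: abs_mult flip: right_diff_distrib)
    \<comment> \<open>57 = 1 + 8 * 7: one from the neglected tide, seven for replacing
      \<open>w\<close> and \<open>p\<close> by sine and cosine in the Coriolis term.\<close>
    have "\<bar>Im N + 8 * (\<epsilon> * ((sin t)\<^sup>2 * cos t))\<bar> \<le> 57 * (\<epsilon> * e)" using 1 4 unfolding N0 by linarith
    moreover have "1 - cos (4 * t) = 8 * ((sin t)\<^sup>2 * (cos t)\<^sup>2)"
      using cos_double_sin[of "2 * t"] sin_double[of t] by (simp add: power_mult_distrib)
    then have "Im N * cos t + \<epsilon> * (1 - cos (4 * t)) = cos t * (Im N + 8 * (\<epsilon> * ((sin t)\<^sup>2 * cos t)))"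
      by (simp only: distrib_left power2_eq_square mult_ac)
    moreover have "\<bar>cos t\<bar> \<le> 1" by simp
    ultimately have "norm (Im N * cos t + \<epsilon> * (1 - cos (4 * t))) \<le> 1 * (57 * (\<epsilon> * e))"
      unfolding real_norm_def abs_mult by (simp only: abs_mult) (intro mult_mono; simp)
    then show ?thesis by (simp add: N_def)
  qed
  have "norm (F t0 - F 0) \<le> 57 * (\<epsilon> * e) * (t0 - 0)"
  proof (rule norm_diff_le_of_vector_derivative)
    fix t assume "t \<in> {0..t0}"
    then have t: "t \<in> {0..T}" using t0 by simp
    show "(F has_vector_derivative Im (hill_rhs \<epsilon> \<theta> (w t) (p t)) * cos t + \<epsilon> * (1 - cos (4 * t))) (at t within {0..t0})"
      using Fd[OF t] by (rule has_vector_derivative_within_subset) (use t0 in auto)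
    show "norm (Im (hill_rhs \<epsilon> \<theta> (w t) (p t)) * cos t + \<epsilon> * (1 - cos (4 * t))) \<le> 57 * (\<epsilon> * e)"
      by (rule bound[OF t])
  qed (use t0 in simp)
  moreover have "F 0 = 0" using sol by (simp add: F_def a_def hsol_def)
  ultimately have "F t0 \<le> 57 * e * (\<epsilon> * t0)" by (simp add: algebra_simps)
  also have "\<dots> \<le> 57/1000 * (\<epsilon> * t0)" using e t0 by (intro mult_right_mono) auto
  finally have "Im (p t0) * cos t0 \<le> 57/1000 * (\<epsilon> * t0) - \<epsilon> * t0 + \<epsilon> * sin (4 * t0) / 4"
    by (simp add: F_def a_def w0 algebra_simps)
  \<comment> \<open>As \<open>t0\<close> is at least 1, the oscillating term costs at most a quarter
    of \<epsilon> t0, and 57/1000 + 1/4 < 1.\<close>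
  moreover have "\<epsilon> * sin (4 * t0) \<le> \<epsilon> * 1" "\<epsilon> * 1 \<le> \<epsilon> * t0" using e(1) t0 by (auto intro: mult_left_mono)
  ultimately show ?thesis using e(1) by linarith
qed

section \<open>Ejection orbits for small parameter\<close>

text \<open>The primitive of sin^6 that vanishes at 0. Its slope 5/16, the mean of sin^6, makes the
  main part of the collision function grow linearly in time.\<close>

definition sin6_int :: "real \<Rightarrow> real" where
  "sin6_int t = 5/16 * t - 15/64 * sin (2 * t) + 3/64 * sin (4 * t) - 1/192 * sin (6 * t)"

lemma sin6_int_derivative: "(sin6_int has_real_derivative (sin t) ^ 6) (at t within S)"
proof -
  have c2: "cos (2 * t) = 1 - 2 * (sin t)\<^sup>2" by (rule cos_double_sin)
  have c4: "cos (4 * t) = 2 * (cos (2 * t))\<^sup>2 - 1" using cos_double_cos[of "2 * t"] by simp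
  have c6: "cos (6 * t) = 4 * cos (2 * t) ^ 3 - 3 * cos (2 * t)" using cos_treble_cos[of "2 * t"] by simp
  have "5/16 - 15/32 * cos (2 * t) + 3/16 * cos (4 * t) - 1/32 * cos (6 * t) = (sin t) ^ 6"
    unfolding c6 c4 c2 by (simp add: field_simps power2_eq_square power3_eq_cube power_numeral_reduce)
  moreover have "(sin6_int has_real_derivative
      (5/16 - 15/32 * cos (2 * t) + 3/16 * cos (4 * t) - 1/32 * cos (6 * t))) (at t within S)"
    unfolding sin6_int_def by (auto intro!: derivative_eq_intros)
  ultimately show ?thesis by simp
qed

text \<open>The slope 5/16 exceeds 1/5 by 9/80, and the oscillating terms amount to at most 55/192.
  From 13/5 on the linear surplus wins; this is still before pi - 1/4, the start of the first window
  in which close approaches are sought.\<close>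

lemma sin6_int_ge: "13/5 \<le> t \<Longrightarrow> t / 5 \<le> sin6_int t"
  using sin_le_one[of "2 * t"] sin_ge_minus_one[of "4 * t"] sin_le_one[of "6 * t"]
  unfolding sin6_int_def by linarith

lemma sin6_int_le:
  assumes "0 \<le> t"
  shows "sin6_int t \<le> t"
proof -
  have "(sin t) ^ 6 \<le> 1" for t :: real
    using power_le_one[of "\<bar>sin t\<bar>" 6] by (simp add: power_even_abs)
  then have "- 1 * (t - 0) \<le> - sin6_int t - (- sin6_int 0)"
    by (intro growth_ge[where f = "\<lambda>t. - sin6_int t" and f' = "\<lambda>t. - ((sin t) ^ 6)"] assms
        DERIV_minus sin6_int_derivative) simp
  then show ?thesis by (simp add: sin6_int_def)
qed

text \<open>The complex quantity behind the torque: by \<open>torque_sextic\<close> the angle enters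
  only as a factor \<open>cis (4 * \<theta>)\<close>, so that the orbit and the angle can be varied
  separately.\<close>

definition sextic :: "complex \<Rightarrow> complex" where "sextic w = of_real (sqn w) * w ^ 4"

lemma torque_sextic: "torque \<theta> w = Im (cis (4 * \<theta>) * sextic w)"
proof -
  have "Im (cis (4 * \<theta>) * (of_real r * z)) = r * Im (cis (4 * \<theta>) * z)" for r z by (simp add: algebra_simps)
  then show ?thesis unfolding torque_def sextic_def by simp
qed

text \<open>A product of six factors of norm at most 101/100 has Lipschitz constant at most 6 *
  (101/100)^5 < 7.\<close>

lemma sextic_lipschitz:
  assumes "norm w \<le> (101/100)" "norm w' \<le> (101/100)"
  shows "norm (sextic w - sextic w') \<le> 7 * norm (w - w')"
proof -
  have s: "sextic w = (w * cnj w) * ((w * w) * (w * w))" for w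
    unfolding sextic_def sqn_eq_norm complex_norm_square by (simp add: power4_eq_xxxx mult.assoc)
  define d where "d = norm (w - w')"
  have d: "norm (w - w') \<le> 1 * d" "norm (cnj w - cnj w') \<le> 1 * d" "0 \<le> d"
    by (simp_all add: d_def flip: complex_cnj_diff)
  have b2: "norm (w * w) \<le> (101/100) * (101/100)" "norm (w' * w') \<le> (101/100) * (101/100)" "norm (w * cnj w) \<le> (101/100) * (101/100)"
    by (rule norm_mult_le; use assms in simp)+
  have l2: "norm (w * w - w' * w') \<le> ((101/100) * 1 + (101/100) * 1) * d"
    by (rule norm_mult_diff_le) (use assms d in auto)
  have lc: "norm (w * cnj w - w' * cnj w') \<le> ((101/100) * 1 + (101/100) * 1) * d"
    by (rule norm_mult_diff_le) (use assms d in auto)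
  have b4: "norm ((w' * w') * (w' * w')) \<le> ((101/100) * (101/100)) * ((101/100) * (101/100))"
    by (rule norm_mult_le[OF b2(2,2)])
  have l4: "norm ((w * w) * (w * w) - (w' * w') * (w' * w'))
     \<le> (((101/100) * (101/100)) * ((101/100) * 1 + (101/100) * 1) + ((101/100) * (101/100)) * ((101/100) * 1 + (101/100) * 1)) * d"
    by (rule norm_mult_diff_le[OF b2(1,2) l2 l2]) (use d in auto)
  have "norm (sextic w - sextic w') \<le> (((101/100) * (101/100)) *
      (((101/100) * (101/100)) * ((101/100) * 1 + (101/100) * 1) + ((101/100) * (101/100)) * ((101/100) * 1 + (101/100) * 1))
       + (((101/100) * (101/100)) * ((101/100) * (101/100))) * ((101/100) * 1 + (101/100) * 1)) * d"
    unfolding s by (rule norm_mult_diff_le[OF b2(3) b4 lc l4]) (use d in auto)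
  also have "\<dots> \<le> 7 * d" using d(3) by (intro mult_right_mono) auto
  finally show ?thesis by (simp add: d_def)
qed

text \<open>The time interval \<open>{0..T}\<close> covers one half-period more than needed; \<open>e\<close> bounds the distance to
  the unperturbed oscillator.\<close>

locale hill_regime =
  fixes n :: nat and \<epsilon> e T :: real
  assumes n: "1 \<le> n" and eps: "0 < \<epsilon>" and T: "T = (real n + 1) * pi"
    and e: "e = 32000 * \<epsilon> * T" and small: "e \<le> 1/1000000"
begin

lemma T_ge: "6 \<le> T"
proof -
  have "2 * 3 \<le> (real n + 1) * pi" using n pi_gt3 by (intro mult_mono) auto
  then show ?thesis by (simp add: T)
qed

lemma e_pos: "0 < e" and eps_le: "1152 * \<epsilon> \<le> e" "\<epsilon> \<le> 1" "8000 * \<epsilon> * T \<le> 1/8" "8000 * \<epsilon> \<le> e"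
proof -
  have "\<epsilon> * 6 \<le> \<epsilon> * T" using T_ge eps by (intro mult_left_mono) auto
  then show "1152 * \<epsilon> \<le> e" "\<epsilon> \<le> 1" "8000 * \<epsilon> * T \<le> 1/8" "8000 * \<epsilon> \<le> e" "0 < e"
    using e small eps by linarith+
qed

lemma jpi_le:
  assumes "1 \<le> j" "j \<le> n"
  shows "pi \<le> real j * pi" "real j * pi + pi \<le> T"
  using assms mult_right_mono[of 1 "real j" pi] mult_right_mono[of "real j + 1" "real n + 1" pi]
  by (auto simp: T algebra_simps)

text \<open>The choice determines \<open>W \<theta>\<close> only on \<open>{0..T}\<close>, where
  \<open>sol_unique\<close> applies. Nothing is known outside, so all facts about it are confined to
  that interval.\<close>

definition W :: "real \<Rightarrow> real \<Rightarrow> complex" where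
  "W \<theta> = fst (SOME wp. hsol \<epsilon> \<theta> T (fst wp) (snd wp))"

definition P :: "real \<Rightarrow> real \<Rightarrow> complex" where
  "P \<theta> = snd (SOME wp. hsol \<epsilon> \<theta> T (fst wp) (snd wp))"

lemma sol: "hsol \<epsilon> \<theta> T (W \<theta>) (P \<theta>)"
proof -
  obtain w p where "hsol \<epsilon> \<theta> T w p"
    using hsol_exists[of T \<epsilon> \<theta>] T_ge eps eps_le by auto
  then have "hsol \<epsilon> \<theta> T (fst (w, p)) (snd (w, p))" by simp
  from someI[of "\<lambda>wp. hsol \<epsilon> \<theta> T (fst wp) (snd wp)", OF this] show ?thesis by (simp add: W_def P_def)
qed

lemma sol_unique:
  assumes "hsol \<epsilon> \<theta> T' w p" "T' \<le> T" "t \<in> {0..T'}"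
  shows "w t = W \<theta> t" "p t = P \<theta> t"
proof -
  have "8000 * \<epsilon> * T' \<le> 8000 * \<epsilon> * T" using assms eps by (intro mult_left_mono) auto
  then have "8000 * \<epsilon> * T' \<le> 1/8" using eps_le(3) by linarith
  from hsol_lipschitz[OF less_imp_le[OF eps] eps_le(2) this assms(1) hsol_subset[OF sol[of \<theta>] assms(2)] assms(3)]
  show "w t = W \<theta> t" "p t = P \<theta> t" by simp_all
qed

context fixes t assumes t: "t \<in> {0..T}" begin

lemma near_sin: "norm (W \<theta> t - of_real (sin t)) \<le> e" "norm (P \<theta> t - of_real (cos t)) \<le> e"
proof -
  have "16000 * \<epsilon> * t \<le> 16000 * \<epsilon> * T" using t eps by (intro mult_left_mono) auto
  then show "norm (W \<theta> t - of_real (sin t)) \<le> e" "norm (P \<theta> t - of_real (cos t)) \<le> e"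
    using hsol_near_sin(1,2)[OF less_imp_le[OF eps] eps_le(2,3) sol t, of \<theta>] e e_pos by linarith+
qed

lemma norm_W_P_le: "norm (W \<theta> t) \<le> (101/100)" "norm (P \<theta> t) \<le> (101/100)"
proof -
  have "norm (complex_of_real (sin t)) \<le> 1" "norm (complex_of_real (cos t)) \<le> 1" by simp_all
  then show "norm (W \<theta> t) \<le> (101/100)" "norm (P \<theta> t) \<le> (101/100)"
    using norm_triangle_sub[of "W \<theta> t" "of_real (sin t)"] norm_triangle_sub[of "P \<theta> t" "of_real (cos t)"]
      near_sin[of \<theta>] small by linarith+
qed

lemma W_P_lipschitz:
  "norm (W \<theta> t - W \<theta>' t) \<le> e * \<bar>\<theta> - \<theta>'\<bar>" "norm (P \<theta> t - P \<theta>' t) \<le> e * \<bar>\<theta> - \<theta>'\<bar>"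
  using hsol_lipschitz[OF less_imp_le[OF eps] eps_le(2,3) sol sol t] by (simp_all add: e)

end

section \<open>Radial motion and torque along the ejection orbits\<close>

definition rho :: "real \<Rightarrow> real \<Rightarrow> real" where "rho \<theta> t = Re (cnj (W \<theta> t) * P \<theta> t)"

definition rho' :: "real \<Rightarrow> real \<Rightarrow> real" where
  "rho' \<theta> t = sqn (P \<theta> t) - sqn (W \<theta> t) + Re (cnj (W \<theta> t) * hill_rhs \<epsilon> \<theta> (W \<theta> t) (P \<theta> t))"

lemma rho_der: "t \<in> {0..T} \<Longrightarrow> (rho \<theta> has_real_derivative rho' \<theta> t) (at t within {0..T})"
  unfolding rho_def rho'_def by (rule rho_derivative[OF sol])

lemma sqn_W_der: "t \<in> {0..T} \<Longrightarrow> ((\<lambda>t. sqn (W \<theta> t)) has_real_derivative 2 * rho \<theta> t) (at t within {0..T})"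
  unfolding rho_def by (rule sqn_derivative[OF sol])

lemma sqn_near:
  assumes "norm (z - of_real x) \<le> e" "norm z \<le> (101/100)" "\<bar>x\<bar> \<le> 1"
  shows "\<bar>sqn z - x\<^sup>2\<bar> \<le> 3 * e"
proof -
  have "\<bar>norm z - \<bar>x\<bar>\<bar> \<le> e"
    using norm_triangle_ineq3[of z "of_real x"] assms(1) by simp
  moreover have "\<bar>norm z + \<bar>x\<bar>\<bar> \<le> 3" using add_mono[OF assms(2,3)] by simp
  moreover have "sqn z - x\<^sup>2 = (norm z - \<bar>x\<bar>) * (norm z + \<bar>x\<bar>)"
    by (simp add: sqn_eq_norm power2_eq_square algebra_simps)
  ultimately have "\<bar>sqn z - x\<^sup>2\<bar> \<le> e * 3"
    using e_pos by (simp only: abs_mult) (intro mult_mono; simp)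
  then show ?thesis by simp
qed

context fixes t assumes t: "t \<in> {0..T}" begin

lemma rho_near: "\<bar>rho \<theta> t - sin t * cos t\<bar> \<le> 3 * e"
proof -
  have *: "norm (cnj (W \<theta> t) * P \<theta> t - of_real (sin t) * of_real (cos t)) \<le> ((101/100) * 1 + 1 * 1) * e"
    by (rule norm_mult_diff_le)
       (use near_sin[OF t, of \<theta>] norm_W_P_le[OF t, of \<theta>] complex_mod_cnj[of "W \<theta> t - of_real (sin t)"] e_pos in auto)
  also have "\<dots> \<le> 3 * e" using e_pos by simp
  finally show ?thesis
    using abs_Re_le_cmod[of "cnj (W \<theta> t) * P \<theta> t - of_real (sin t) * of_real (cos t)"]
    unfolding rho_def by simp
qed

lemma rho_lipschitz: "\<bar>rho \<theta> t - rho \<theta>' t\<bar> \<le> 3 * e * \<bar>\<theta> - \<theta>'\<bar>"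
proof -
  have pos: "0 \<le> e * \<bar>\<theta> - \<theta>'\<bar>" using e_pos by simp
  have "norm (cnj (W \<theta> t) * P \<theta> t - cnj (W \<theta>' t) * P \<theta>' t) \<le> ((101/100) * 1 + (101/100) * 1) * (e * \<bar>\<theta> - \<theta>'\<bar>)"
    by (rule norm_mult_diff_le)
       (use W_P_lipschitz[OF t, of \<theta> \<theta>'] norm_W_P_le[OF t] complex_mod_cnj[of "W \<theta> t - W \<theta>' t"] pos in auto)
  also have "\<dots> \<le> 3 * (e * \<bar>\<theta> - \<theta>'\<bar>)" using pos by (intro mult_right_mono) auto
  finally show ?thesis
    using abs_Re_le_cmod[of "cnj (W \<theta> t) * P \<theta> t - cnj (W \<theta>' t) * P \<theta>' t"]
    unfolding rho_def by simp
qed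

lemma rho'_near: "\<bar>rho' \<theta> t - cos (2 * t)\<bar> \<le> 8 * e"
proof -
  have 1: "\<bar>sqn (P \<theta> t) - (cos t)\<^sup>2\<bar> \<le> 3 * e" "\<bar>sqn (W \<theta> t) - (sin t)\<^sup>2\<bar> \<le> 3 * e"
    by (rule sqn_near; use near_sin[OF t] norm_W_P_le[OF t] in simp)+
  have 2: "norm (hill_rhs \<epsilon> \<theta> (W \<theta> t) (P \<theta> t)) \<le> e"
    using norm_hill_rhs_le[of "W \<theta> t" "P \<theta> t" \<epsilon> \<theta>] norm_W_P_le[OF t, of \<theta>] eps eps_le by simp
  have "norm (cnj (W \<theta> t) * hill_rhs \<epsilon> \<theta> (W \<theta> t) (P \<theta> t)) \<le> (101/100) * e"
    by (rule norm_mult_le) (use norm_W_P_le[OF t, of \<theta>] 2 in auto)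
  then have "\<bar>Re (cnj (W \<theta> t) * hill_rhs \<epsilon> \<theta> (W \<theta> t) (P \<theta> t))\<bar> \<le> 2 * e"
    using abs_Re_le_cmod[of "cnj (W \<theta> t) * hill_rhs \<epsilon> \<theta> (W \<theta> t) (P \<theta> t)"] e_pos by linarith
  then show ?thesis using 1 unfolding rho'_def cos_double by linarith
qed

lemma sextic_near:
  "norm (sextic (W \<theta> t) - of_real ((sin t) ^ 6)) \<le> 7 * e"
  "norm (sextic (W \<theta> t) - sextic (W \<theta>' t)) \<le> 7 * e * \<bar>\<theta> - \<theta>'\<bar>"
proof -
  have "sextic (of_real (sin t)) = of_real ((sin t) ^ 6)"
    unfolding sextic_def sqn_eq_norm by (simp flip: of_real_power of_real_mult power_add)
  moreover have "norm (complex_of_real (sin t)) \<le> (101/100)"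
  proof -
    have "norm (complex_of_real (sin t)) \<le> 1" by simp
    then show ?thesis by linarith
  qed
  ultimately show "norm (sextic (W \<theta> t) - of_real ((sin t) ^ 6)) \<le> 7 * e"
    using sextic_lipschitz[OF norm_W_P_le(1)[OF t], of "of_real (sin t)" \<theta>] near_sin(1)[OF t, of \<theta>] by simp
  show "norm (sextic (W \<theta> t) - sextic (W \<theta>' t)) \<le> 7 * e * \<bar>\<theta> - \<theta>'\<bar>"
    using sextic_lipschitz[OF norm_W_P_le(1)[OF t] norm_W_P_le(1)[OF t], of \<theta> \<theta>'] W_P_lipschitz(1)[OF t, of \<theta> \<theta>']
    by linarith
qed

lemma torque_near: "\<bar>torque \<theta> (W \<theta> t) - sin (4 * \<theta>) * (sin t) ^ 6\<bar> \<le> 7 * e"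
proof -
  have "torque \<theta> (W \<theta> t) - sin (4 * \<theta>) * (sin t) ^ 6
      = Im (cis (4 * \<theta>) * (sextic (W \<theta> t) - of_real ((sin t) ^ 6)))"
    unfolding torque_sextic by (simp add: algebra_simps del: of_real_power)
  also have "\<bar>\<dots>\<bar> \<le> norm (cis (4 * \<theta>) * (sextic (W \<theta> t) - of_real ((sin t) ^ 6)))"
    by (rule abs_Im_le_cmod)
  also have "\<dots> \<le> 7 * e" using sextic_near(1)[of \<theta>] by (simp add: norm_mult)
  finally show ?thesis .
qed

lemma torque_le: "\<bar>torque \<theta> (W \<theta> t)\<bar> \<le> 2"
proof -
  have "\<bar>sin (4 * \<theta>) * (sin t) ^ 6\<bar> \<le> 1 * 1"
    unfolding abs_mult power_abs by (intro mult_mono power_le_one) auto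
  then show ?thesis using torque_near[of \<theta>] small by linarith
qed

text \<open>The variation of \<open>sextic\<close> with the orbit contributes 7 e and that of
  \<open>cis (4 * \<theta>)\<close>, applied to the deviation from sin^6, another 4 * 7 e. As the
  main term is subtracted exactly, the error carries both small factors, which the uniqueness of the
  zeros requires.\<close>

lemma torque_lipschitz:
  "\<bar>torque \<theta> (W \<theta> t) - torque \<theta>' (W \<theta>' t) - (sin (4 * \<theta>) - sin (4 * \<theta>')) * (sin t) ^ 6\<bar>
     \<le> 35 * e * \<bar>\<theta> - \<theta>'\<bar>"
proof -
  let ?A = "cis (4 * \<theta>) * (sextic (W \<theta> t) - sextic (W \<theta>' t))"
  let ?B = "(cis (4 * \<theta>) - cis (4 * \<theta>')) * (sextic (W \<theta>' t) - of_real ((sin t) ^ 6))"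
  have "torque \<theta> (W \<theta> t) - torque \<theta>' (W \<theta>' t) - (sin (4 * \<theta>) - sin (4 * \<theta>')) * (sin t) ^ 6 = Im (?A + ?B)"
    unfolding torque_sextic by (simp add: algebra_simps del: of_real_power)
  also have "\<bar>\<dots>\<bar> \<le> norm (?A + ?B)" by (rule abs_Im_le_cmod)
  also have "\<dots> \<le> norm ?A + norm ?B" by (rule norm_triangle_ineq)
  also have "\<dots> \<le> 7 * e * \<bar>\<theta> - \<theta>'\<bar> + (4 * \<bar>\<theta> - \<theta>'\<bar>) * (7 * e)"
  proof (intro add_mono)
    show "norm ?A \<le> 7 * e * \<bar>\<theta> - \<theta>'\<bar>" using sextic_near(2)[of \<theta> \<theta>'] by (simp add: norm_mult)
    have "norm (cis (4 * \<theta>) - cis (4 * \<theta>')) \<le> 4 * \<bar>\<theta> - \<theta>'\<bar>"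
      using norm_cis_diff_le[of "4 * \<theta>" "4 * \<theta>'"] by (simp add: abs_if split: if_splits)
    then show "norm ?B \<le> (4 * \<bar>\<theta> - \<theta>'\<bar>) * (7 * e)"
      by (rule norm_mult_le) (rule sextic_near(1))
  qed
  finally show ?thesis by (simp add: algebra_simps)
qed

end

end

section \<open>The collision function\<close>

context hill_regime begin

text \<open>The time of the j-th close approach, \<open>rho\<close> being half the derivative of the
  squared distance. For j between 1 and n it exists whether or not a collision takes place, so
  collisions can be tested at it for every angle.\<close>

definition cross :: "nat \<Rightarrow> real \<Rightarrow> real" where
  "cross j \<theta> = (THE t. t \<in> {real j * pi - 1/4..real j * pi + 1/4} \<and> rho \<theta> t = 0)"

context fixes j :: nat assumes j: "1 \<le> j" "j \<le> n" begin

lemma cross_window: "{real j * pi - 1/4..real j * pi + 1/4} \<subseteq> {13/5..T}"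
proof -
  have "13/5 \<le> real j * pi - 1/4" "real j * pi + 1/4 \<le> T" using jpi_le[OF j] pi_gt3 by linarith+
  then show ?thesis by simp
qed

lemma rho'_ge:
  assumes "t \<in> {real j * pi - 1/4..real j * pi + 1/4}"
  shows "1/2 \<le> rho' \<theta> t"
proof -
  have "2 * t = of_int (2 * int j) * pi + 2 * (t - real j * pi)" by (simp add: algebra_simps)
  then have "cos (2 * t) = cos (2 * (t - real j * pi))" by (simp only: cos_shift_int_pi) simp
  also have "\<dots> \<ge> 7/8" using assms by (intro cos_ge_near_zero) (auto simp: abs_if)
  finally have "7/8 \<le> cos (2 * t)" .
  moreover have "t \<in> {0..T}" using subsetD[OF cross_window assms] by simp
  ultimately show ?thesis using rho'_near[of t \<theta>] small by (simp add: abs_le_iff)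
qed

lemma rho_growth:
  assumes "{a..b} \<subseteq> {real j * pi - 1/4..real j * pi + 1/4}" "a \<le> b"
  shows "1/2 * (b - a) \<le> rho \<theta> b - rho \<theta> a"
proof (rule growth_ge[OF assms(2)])
  fix t assume t: "t \<in> {a..b}"
  have "{a..b} \<subseteq> {0..T}" using assms(1) cross_window by force
  then show "(rho \<theta> has_real_derivative rho' \<theta> t) (at t within {a..b})"
    using has_real_derivative_subset[OF rho_der _ t] by blast
  show "1/2 \<le> rho' \<theta> t" using rho'_ge assms(1) t by blast
qed

lemma cross_ex1: "\<exists>!t. t \<in> {real j * pi - 1/4..real j * pi + 1/4} \<and> rho \<theta> t = 0"
proof (rule unique_crossing)
  have sub: "{real j * pi - 1/4..real j * pi + 1/4} \<subseteq> {0..T}" using cross_window by force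
  show "(rho \<theta> has_real_derivative rho' \<theta> t) (at t within {real j * pi - 1/4..real j * pi + 1/4})"
    if "t \<in> {real j * pi - 1/4..real j * pi + 1/4}" for t
    using has_real_derivative_subset[OF rho_der sub that] by blast
  have "real j * pi \<le> T" using jpi_le[OF j] pi_gt3 by linarith
  then have "real j * pi \<in> {0..T}" by simp
  then show "\<bar>rho \<theta> (real j * pi)\<bar> \<le> 1/10" using rho_near[of "real j * pi" \<theta>] small by simp
qed (rule rho'_ge)

lemma cross:
  "\<bar>cross j \<theta> - real j * pi\<bar> \<le> 1/4" "cross j \<theta> \<in> {real j * pi - 1/4..real j * pi + 1/4}"
  "rho \<theta> (cross j \<theta>) = 0" "cross j \<theta> \<in> {0..T}" "13/5 \<le> cross j \<theta>"
proof -
  show *: "cross j \<theta> \<in> {real j * pi - 1/4..real j * pi + 1/4}" "rho \<theta> (cross j \<theta>) = 0"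
    using theI'[OF cross_ex1[of \<theta>]] by (auto simp: cross_def)
  then show "\<bar>cross j \<theta> - real j * pi\<bar> \<le> 1/4" unfolding abs_le_iff atLeastAtMost_iff by linarith
  show "cross j \<theta> \<in> {0..T}" "13/5 \<le> cross j \<theta>" using subsetD[OF cross_window *(1)] by simp_all
qed

lemma cross_unique: "\<bar>t - real j * pi\<bar> \<le> 1/4 \<Longrightarrow> rho \<theta> t = 0 \<Longrightarrow> t = cross j \<theta>"
proof -
  assume t: "\<bar>t - real j * pi\<bar> \<le> 1/4" "rho \<theta> t = 0"
  then have "t \<in> {real j * pi - 1/4..real j * pi + 1/4}" unfolding abs_le_iff atLeastAtMost_iff by linarith
  then show ?thesis using cross_ex1[of \<theta>] cross(2,3)[of \<theta>] t(2) by blast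
qed

text \<open>The slope of \<open>rho\<close>, at least 1/2, turns the bound 3 e for its values at a
  fixed time into 6 e for its zeros.\<close>

lemma cross_lipschitz: "\<bar>cross j \<theta> - cross j \<theta>'\<bar> \<le> 6 * e * \<bar>\<theta> - \<theta>'\<bar>"
proof -
  let ?a = "cross j \<theta>" and ?b = "cross j \<theta>'"
  have ab: "{?a..?b} \<subseteq> {real j * pi - 1/4..real j * pi + 1/4}" "{?b..?a} \<subseteq> {real j * pi - 1/4..real j * pi + 1/4}"
    using cross(2)[of \<theta>] cross(2)[of \<theta>'] by auto
  have "1/2 * \<bar>?a - ?b\<bar> \<le> \<bar>rho \<theta>' ?a - rho \<theta>' ?b\<bar>"
    using rho_growth[OF ab(1), of \<theta>'] rho_growth[OF ab(2), of \<theta>'] by (cases "?a \<le> ?b") auto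
  also have "\<dots> = \<bar>rho \<theta>' ?a - rho \<theta> ?a\<bar>" using cross(3) by simp
  also have "\<dots> \<le> 3 * e * \<bar>\<theta> - \<theta>'\<bar>"
    using rho_lipschitz[OF cross(4), of \<theta>' \<theta> \<theta>] by (simp add: abs_minus_commute)
  finally show ?thesis by simp
qed

end

text \<open>The divisor cancels the prefactor in \<open>ang_mom_derivative\<close>: the derivative
  of \<open>H\<close> is the torque, whose size does not depend on \<epsilon>.\<close>

definition H :: "real \<Rightarrow> real \<Rightarrow> real" where
  "H \<theta> t = - ang_mom \<epsilon> (W \<theta> t) (P \<theta> t) / (12 * \<epsilon>\<^sup>2)"

definition G :: "nat \<Rightarrow> real \<Rightarrow> real" where "G j \<theta> = H \<theta> (cross j \<theta>)"

lemma H_0: "H \<theta> 0 = 0"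
  using sol[of \<theta>] by (simp add: hsol_def H_def ang_mom_def sqn_def)

lemma H_der:
  assumes "t \<in> {0..T}"
  shows "(H \<theta> has_real_derivative torque \<theta> (W \<theta> t)) (at t within {0..T})"
proof -
  have "((\<lambda>t. (- 1 / (12 * \<epsilon>\<^sup>2)) * ang_mom \<epsilon> (W \<theta> t) (P \<theta> t)) has_real_derivative
      ((- 1 / (12 * \<epsilon>\<^sup>2)) * (- 12 * \<epsilon>\<^sup>2 * torque \<theta> (W \<theta> t)))) (at t within {0..T})"
    by (rule DERIV_cmult[OF ang_mom_derivative[OF sol assms]])
  then show ?thesis using eps by (simp add: H_def[abs_def])
qed

context fixes t assumes t: "t \<in> {0..T}" begin

lemma H_near: "\<bar>H \<theta> t - sin (4 * \<theta>) * sin6_int t\<bar> \<le> 7 * e * t"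
proof -
  have "\<bar>(H \<theta> t - sin (4 * \<theta>) * sin6_int t) - (H \<theta> 0 - sin (4 * \<theta>) * sin6_int 0)\<bar> \<le> 7 * e * \<bar>t - 0\<bar>"
    by (rule real_diff_le_of_derivative[where f = "\<lambda>t. H \<theta> t - sin (4 * \<theta>) * sin6_int t"
          and f' = "\<lambda>t. torque \<theta> (W \<theta> t) - sin (4 * \<theta>) * (sin t) ^ 6"])
       (use t torque_near in \<open>auto intro!: DERIV_diff DERIV_cmult H_der sin6_int_derivative\<close>)
  then show ?thesis using t by (simp add: H_0 sin6_int_def[of 0])
qed

lemma H_lipschitz:
  "\<bar>H \<theta> t - H \<theta>' t - (sin (4 * \<theta>) - sin (4 * \<theta>')) * sin6_int t\<bar> \<le> 35 * e * \<bar>\<theta> - \<theta>'\<bar> * t"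
proof -
  let ?s = "sin (4 * \<theta>) - sin (4 * \<theta>')"
  have "\<bar>(H \<theta> t - H \<theta>' t - ?s * sin6_int t) - (H \<theta> 0 - H \<theta>' 0 - ?s * sin6_int 0)\<bar>
      \<le> 35 * e * \<bar>\<theta> - \<theta>'\<bar> * \<bar>t - 0\<bar>"
    by (rule real_diff_le_of_derivative[where f = "\<lambda>t. H \<theta> t - H \<theta>' t - ?s * sin6_int t"
          and f' = "\<lambda>t. torque \<theta> (W \<theta> t) - torque \<theta>' (W \<theta>' t) - ?s * (sin t) ^ 6"])
       (use t torque_lipschitz in \<open>auto intro!: DERIV_diff DERIV_cmult H_der sin6_int_derivative\<close>)
  then show ?thesis using t by (simp add: H_0 sin6_int_def[of 0])
qed

lemma H_time: "t' \<in> {0..T} \<Longrightarrow> \<bar>H \<theta> t - H \<theta> t'\<bar> \<le> 2 * \<bar>t - t'\<bar>"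
  by (rule real_diff_le_of_derivative[where f' = "\<lambda>t. torque \<theta> (W \<theta> t)"])
     (use t torque_le H_der in auto)

end

context fixes j :: nat assumes j: "1 \<le> j" "j \<le> n" begin

lemma sin6_int_cross: "cross j \<theta> \<le> 5 * sin6_int (cross j \<theta>)" "0 < sin6_int (cross j \<theta>)"
  "sin6_int (cross j \<theta>) \<le> T"
  using sin6_int_ge[OF cross(5)[OF j, of \<theta>]] sin6_int_le[of "cross j \<theta>"] cross(4,5)[OF j, of \<theta>] by auto

lemma G_near: "\<bar>G j \<theta> - sin (4 * \<theta>) * sin6_int (cross j \<theta>)\<bar> \<le> 1/20 * sin6_int (cross j \<theta>)"
proof -
  have "\<bar>G j \<theta> - sin (4 * \<theta>) * sin6_int (cross j \<theta>)\<bar> \<le> 7 * e * cross j \<theta>"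
    unfolding G_def by (rule H_near[OF cross(4)[OF j]])
  also have "\<dots> \<le> (7 * (1/1000000)) * (5 * sin6_int (cross j \<theta>))"
    using small e_pos sin6_int_cross cross(5)[OF j, of \<theta>] by (intro mult_mono) auto
  also have "\<dots> \<le> 1/20 * sin6_int (cross j \<theta>)" using sin6_int_cross(2)[of \<theta>] by simp
  finally show ?thesis .
qed

text \<open>Changing the angle at the fixed time \<open>cross j \<theta>\<close> costs 35 e by
  \<open>H_lipschitz\<close>; moving that time costs 2 * 6 e, since the torque is at most 2. The sum
  47 e, times \<open>cross j \<theta>\<close>, is small against the main term because
  \<open>cross j \<theta>\<close> is at most 5 times
  \<open>sin6_int (cross j \<theta>)\<close>.\<close>

lemma G_diff:
  "\<bar>G j \<theta> - G j \<theta>' - (sin (4 * \<theta>) - sin (4 * \<theta>')) * sin6_int (cross j \<theta>)\<bar>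
     \<le> 1/20 * sin6_int (cross j \<theta>) * \<bar>\<theta> - \<theta>'\<bar>"
proof -
  let ?c = "cross j \<theta>" and ?d = "\<bar>\<theta> - \<theta>'\<bar>"
  have "\<bar>H \<theta>' ?c - H \<theta>' (cross j \<theta>')\<bar> \<le> 2 * \<bar>?c - cross j \<theta>'\<bar>"
    by (rule H_time[OF cross(4)[OF j] cross(4)[OF j]])
  also have "\<dots> \<le> 2 * (6 * e * ?d)" using cross_lipschitz[OF j, of \<theta> \<theta>'] by simp
  finally have "\<bar>H \<theta>' ?c - H \<theta>' (cross j \<theta>')\<bar> \<le> 12 * (e * ?d)" by simp
  moreover have "e * ?d * 1 \<le> e * ?d * ?c" using e_pos cross(5)[OF j, of \<theta>] by (intro mult_left_mono) auto
  moreover have "\<bar>H \<theta> ?c - H \<theta>' ?c - (sin (4 * \<theta>) - sin (4 * \<theta>')) * sin6_int ?c\<bar> \<le> 35 * (e * ?d * ?c)"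
    using H_lipschitz[OF cross(4)[OF j, of \<theta>], of \<theta> \<theta>'] by (simp add: mult.assoc)
  ultimately have "\<bar>G j \<theta> - G j \<theta>' - (sin (4 * \<theta>) - sin (4 * \<theta>')) * sin6_int ?c\<bar> \<le> 47 * (e * ?d * ?c)"
    unfolding G_def by linarith
  also have "47 * (e * ?d * ?c) = (47 * e * ?c) * ?d" by simp
  also have "\<dots> \<le> (1/20 * sin6_int ?c) * ?d"
  proof (rule mult_right_mono)
    have "47 * e * ?c \<le> 47 * (1/1000000) * (5 * sin6_int ?c)"
      using small e_pos sin6_int_cross[of \<theta>] cross(5)[OF j, of \<theta>] by (intro mult_mono) auto
    then show "47 * e * ?c \<le> 1/20 * sin6_int ?c" using sin6_int_cross(2)[of \<theta>] by simp
  qed simp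
  finally show ?thesis .
qed

lemma continuous_on_G: "continuous_on S (G j)"
proof -
  have "(5 * T)-lipschitz_on UNIV (G j)"
  proof (rule lipschitz_onI)
    fix \<theta> \<theta>' :: real
    let ?I = "sin6_int (cross j \<theta>)" and ?d = "\<bar>\<theta> - \<theta>'\<bar>"
    have "\<bar>sin (4 * \<theta>) - sin (4 * \<theta>')\<bar> \<le> norm (cis (4 * \<theta>) - cis (4 * \<theta>'))"
      using abs_Im_le_cmod[of "cis (4 * \<theta>) - cis (4 * \<theta>')"] by simp
    also have "\<dots> \<le> 4 * ?d" using norm_cis_diff_le[of "4 * \<theta>" "4 * \<theta>'"] by (simp add: abs_if split: if_splits)
    finally have "\<bar>(sin (4 * \<theta>) - sin (4 * \<theta>')) * ?I\<bar> \<le> 4 * ?d * ?I"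
      unfolding abs_mult using sin6_int_cross(2)[of \<theta>] by (intro mult_mono) auto
    then have "\<bar>G j \<theta> - G j \<theta>'\<bar> \<le> (4 + 1/20) * (?I * ?d)" using G_diff[of \<theta> \<theta>'] by argo
    also have "\<dots> \<le> 5 * (T * ?d)" using sin6_int_cross[of \<theta>] by (intro mult_mono) auto
    finally show "dist (G j \<theta>) (G j \<theta>') \<le> 5 * T * dist \<theta> \<theta>'" by (simp add: dist_real_def)
  qed (use T_ge in simp)
  then show ?thesis using lipschitz_on_continuous_on continuous_on_subset by blast
qed

text \<open>If \<open>rho\<close> and the angular momentum vanish although \<open>w\<close> does
  not, then \<open>cnj w * p\<close> is purely imaginary and \<bar>p\<bar> = 2 \<epsilon>
  \<bar>w\<bar>^3, which is tiny. But close to a multiple of pi the norm of \<open>p\<close> nearly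
  equals that of the cosine, at least 7/8.\<close>

lemma collision_iff: "W \<theta> (cross j \<theta>) = 0 \<longleftrightarrow> G j \<theta> = 0"
proof
  assume "W \<theta> (cross j \<theta>) = 0"
  then show "G j \<theta> = 0" by (simp add: G_def H_def ang_mom_def sqn_def)
next
  assume G0: "G j \<theta> = 0"
  define w p where "w = W \<theta> (cross j \<theta>)" and "p = P \<theta> (cross j \<theta>)"
  show "W \<theta> (cross j \<theta>) = 0"
  proof (rule ccontr)
    assume "W \<theta> (cross j \<theta>) \<noteq> 0"
    then have w0: "w \<noteq> 0" by (simp add: w_def)
    have "Im (cnj w * p) = - 2 * \<epsilon> * (sqn w)\<^sup>2"
      using G0 eps by (simp add: G_def H_def ang_mom_def w_def p_def)
    moreover have "Re (cnj w * p) = 0" using cross(3)[OF j, of \<theta>] by (simp add: rho_def w_def p_def)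
    ultimately have "norm (cnj w * p) = \<bar>- 2 * \<epsilon> * (sqn w)\<^sup>2\<bar>" by (simp only: cmod_def) simp
    also have "\<dots> = 2 * \<epsilon> * (norm w) ^ 4" using eps by (simp add: abs_mult sqn_eq_norm flip: power_mult)
    finally have "norm (cnj w * p) = 2 * \<epsilon> * (norm w) ^ 4" .
    then have "norm p = 2 * \<epsilon> * (norm w) ^ 3"
      using w0 by (simp add: norm_mult power_numeral_reduce)
    also have "\<dots> \<le> 2 * (1/1000) * (101/100) ^ 3"
      using norm_W_P_le(1)[OF cross(4)[OF j], of \<theta> \<theta>] eps eps_le(1) small
      by (intro mult_mono power_mono) (auto simp: w_def)
    finally have "norm p \<le> 1/4" by (simp add: power3_eq_cube)
    moreover have "7/8 \<le> \<bar>cos (cross j \<theta>)\<bar>"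
    proof -
      have "cross j \<theta> = of_int (int j) * pi + (cross j \<theta> - real j * pi)" by simp
      then have "\<bar>cos (cross j \<theta>)\<bar> = \<bar>cos (cross j \<theta> - real j * pi)\<bar>"
        using cos_shift_int_pi[of "int j" "cross j \<theta> - real j * pi"] by (simp split: if_splits)
      then show ?thesis using cos_ge_near_zero[of "cross j \<theta> - real j * pi"] cross(1)[OF j, of \<theta>] by simp
    qed
    moreover have "\<bar>cos (cross j \<theta>)\<bar> \<le> norm p + e"
      using near_sin(2)[OF cross(4)[OF j], of \<theta> \<theta>]
        norm_triangle_sub[of "of_real (cos (cross j \<theta>))" p] by (simp add: p_def norm_minus_commute)
    ultimately show False using small by linarith
  qed
qed

section \<open>Location and uniqueness of the zeros\<close>

lemma sin4_growth:
  fixes k :: int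
  assumes "\<bar>\<theta> - k * pi / 4\<bar> \<le> 1/10" "\<bar>\<theta>' - k * pi / 4\<bar> \<le> 1/10"
  shows "\<bar>\<theta> - \<theta>'\<bar> \<le> \<bar>sin (4 * \<theta>) - sin (4 * \<theta>')\<bar>"
proof -
  define s :: real where "s = (if even k then 1 else - 1)"
  have "1 * (b - a) \<le> s * sin (4 * b) - s * sin (4 * a)"
    if "a \<le> b" "\<bar>a - k * pi / 4\<bar> \<le> 1/10" "\<bar>b - k * pi / 4\<bar> \<le> 1/10" for a b
  proof (rule growth_ge[OF that(1), of "\<lambda>x. s * sin (4 * x)" "\<lambda>x. s * (4 * cos (4 * x))"])
    fix t assume t: "t \<in> {a..b}"
    show "((\<lambda>x. s * sin (4 * x)) has_real_derivative s * (4 * cos (4 * t))) (at t within {a..b})"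
      by (auto intro!: derivative_eq_intros)
    have "4 * t = k * pi + 4 * (t - k * pi / 4)" by simp
    then have "cos (4 * t) = s * cos (4 * (t - k * pi / 4))"
      unfolding s_def by (simp only: cos_shift_int_pi) simp
    moreover have "\<bar>t - k * pi / 4\<bar> \<le> 1/10"
      using t that(2,3) unfolding abs_le_iff atLeastAtMost_iff by linarith
    then have "\<bar>4 * (t - k * pi / 4)\<bar> \<le> 1/2" unfolding abs_mult by simp
    from cos_ge_near_zero[OF this] have "7/8 \<le> cos (4 * (t - k * pi / 4))" .
    ultimately show "1 \<le> s * (4 * cos (4 * t))" by (auto simp: s_def)
  qed
  from this[of \<theta> \<theta>'] this[of \<theta>' \<theta>] assms show ?thesis
    by (cases "\<theta> \<le> \<theta>'") (auto simp: s_def split: if_splits)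
qed

text \<open>At two zeros \<open>G_diff\<close> bounds the difference of the sines by \<bar>\<theta>
  - \<theta>'\<bar> / 20, whereas in the window they differ by at least \<bar>\<theta> -
  \<theta>'\<bar>. The half-width 1/10, twice that of the existence result, leaves room for the
  reflected angle in \<open>collision_reversal\<close>.\<close>

lemma G_zero_unique:
  fixes k :: int
  assumes "\<bar>\<theta> - k * pi / 4\<bar> \<le> 1/10" "\<bar>\<theta>' - k * pi / 4\<bar> \<le> 1/10" "G j \<theta> = 0" "G j \<theta>' = 0"
  shows "\<theta> = \<theta>'"
proof -
  let ?I = "sin6_int (cross j \<theta>)"
  have "\<bar>\<theta> - \<theta>'\<bar> * ?I \<le> \<bar>sin (4 * \<theta>) - sin (4 * \<theta>')\<bar> * ?I"
    using sin4_growth[OF assms(1,2)] sin6_int_cross(2)[of \<theta>] by (intro mult_right_mono) auto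
  also have "\<dots> \<le> 1/20 * (\<bar>\<theta> - \<theta>'\<bar> * ?I)"
    using G_diff[of \<theta> \<theta>'] sin6_int_cross(2)[of \<theta>] assms(3,4) by (simp add: abs_mult mult.commute)
  finally have "\<bar>\<theta> - \<theta>'\<bar> * ?I \<le> 0" by linarith
  then show ?thesis using sin6_int_cross(2)[of \<theta>] by (simp add: mult_le_0_iff)
qed

lemma G_zero_window: "G j \<theta> = 0 \<Longrightarrow> \<exists>k::int. \<bar>\<theta> - k * pi / 4\<bar> \<le> 1/20"
proof -
  assume "G j \<theta> = 0"
  then have "\<bar>sin (4 * \<theta>)\<bar> * sin6_int (cross j \<theta>) \<le> 1/20 * sin6_int (cross j \<theta>)"
    using G_near[of \<theta>] sin6_int_cross(2)[of \<theta>] by (simp add: abs_mult)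
  then have "\<bar>sin (4 * \<theta>)\<bar> \<le> 1/20" using sin6_int_cross(2)[of \<theta>] by simp
  then obtain k :: int where "\<bar>4 * \<theta> - k * pi\<bar> \<le> 2 * (1/20)" using near_multiple_of_pi by blast
  then have "\<bar>\<theta> - k * pi / 4\<bar> \<le> 1/20" unfolding abs_le_iff by linarith
  then show ?thesis by blast
qed

lemma G_zero_exists: "\<exists>\<theta>. \<bar>\<theta> - of_int k * pi / 4\<bar> \<le> 1/20 \<and> G j \<theta> = 0"
proof -
  define s :: real where "s = (if even k then 1 else - 1)"
  have s2: "s * s = 1" "\<bar>s\<bar> = 1" by (simp_all add: s_def)
  \<comment> \<open>At the ends of the window the sine of 4 \<theta> has absolute value sin (1/5)
    \<ge> 1/10, twice the relative error in \<open>G_near\<close>. So the collision function changes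
    sign, and \<open>s\<close> accounts for the direction of the change.\<close>
  have sin02: "1/10 \<le> sin (1/5::real)"
    using abs_le_two_abs_sin[of "1/5"] sin_gt_zero[of "1/5"] pi_gt3 by simp
  have val: "s * sin (4 * (of_int k * pi / 4 + x)) = sin (4 * x)" for x
  proof -
    have "4 * (of_int k * pi / 4 + x) = of_int k * pi + 4 * x" by simp
    then show ?thesis by (simp only: sin_add cos_int_pi sin_int_pi s_def) simp
  qed
  have near: "\<bar>s * G j (of_int k * pi / 4 + x) - sin (4 * x) * I\<bar> \<le> 1/20 * I"
    if "I = sin6_int (cross j (of_int k * pi / 4 + x))" for x I
  proof -
    have "\<bar>s * (G j (of_int k * pi / 4 + x) - sin (4 * (of_int k * pi / 4 + x)) * I)\<bar> \<le> 1/20 * I"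
      unfolding abs_mult s2 using G_near[of "of_int k * pi / 4 + x"] that by simp
    then show ?thesis unfolding right_diff_distrib mult.assoc[symmetric] val .
  qed
  have "0 \<le> s * G j (of_int k * pi / 4 + 1/20)"
  proof -
    define I where "I = sin6_int (cross j (of_int k * pi / 4 + 1/20))"
    have "1/10 * I \<le> sin (4 * (1/20)) * I"
      using sin02 sin6_int_cross(2) by (intro mult_right_mono) (auto simp: I_def less_imp_le)
    moreover have "0 < I" unfolding I_def by (rule sin6_int_cross(2))
    ultimately show ?thesis using near[OF I_def] by linarith
  qed
  moreover have "s * G j (of_int k * pi / 4 - 1/20) \<le> 0"
  proof -
    define I where "I = sin6_int (cross j (of_int k * pi / 4 + - (1/20)))"
    have "1/10 * I \<le> sin (4 * (1/20)) * I"
      using sin02 sin6_int_cross(2) by (intro mult_right_mono) (auto simp: I_def less_imp_le)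
    moreover have "sin (4 * - (1/20)) = - sin (4 * (1/20) :: real)" by (simp flip: sin_minus)
    moreover have "0 < I" unfolding I_def by (rule sin6_int_cross(2))
    ultimately have "s * G j (of_int k * pi / 4 + - (1/20)) \<le> 0"
      using near[OF I_def] unfolding abs_le_iff by (simp only: minus_mult_left[symmetric]) linarith
    then show ?thesis by simp
  qed
  moreover have "continuous_on {of_int k * pi / 4 - 1/20..of_int k * pi / 4 + 1/20} (\<lambda>x. s * G j x)"
    by (intro continuous_intros continuous_on_G)
  ultimately obtain \<theta> where "of_int k * pi / 4 - 1/20 \<le> \<theta>" "\<theta> \<le> of_int k * pi / 4 + 1/20" "s * G j \<theta> = 0"
    using IVT'[of "\<lambda>x. s * G j x" "of_int k * pi / 4 - 1/20" 0 "of_int k * pi / 4 + 1/20"] by auto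
  moreover from this have "\<bar>\<theta> - of_int k * pi / 4\<bar> \<le> 1/20" unfolding abs_le_iff by linarith
  ultimately show ?thesis using s2 by auto
qed

end

end

section \<open>Symmetry and first collisions\<close>

context hill_regime begin

lemma rho_zero: "W \<theta> t = 0 \<Longrightarrow> rho \<theta> t = 0"
  by (simp add: rho_def)

lemma W_0: "W \<theta> 0 = 0"
  using sol[of \<theta>] by (simp add: hsol_def)

text \<open>The collision momentum is, up to sign, \<open>cis \<alpha>\<close> with a small
  \<alpha>, negative by \<open>coriolis_drift\<close>. The reversed and reflected arc is an ejection
  orbit of angle k pi/2 - \<theta> - \<alpha> that collides at the same time; by uniqueness in the
  window this angle is \<theta>. Hence \<theta> = k pi/4 - \<alpha>/2 lies above k pi/4, while the
  continuation after the collision has the angle \<theta> + \<alpha> below it.\<close>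

lemma collision_reversal:
  fixes k :: int
  assumes j: "1 \<le> j" "j \<le> n" and win: "\<bar>\<theta> - k * pi / 4\<bar> \<le> 1/20" and G0: "G j \<theta> = 0"
  obtains \<alpha> where "- 1/20 \<le> \<alpha>" "\<alpha> < 0" "\<theta> = k * pi / 4 - \<alpha> / 2"
    and "norm (P \<theta> (cross j \<theta>)) = 1" "(P \<theta> (cross j \<theta>))\<^sup>2 = cis (2 * \<alpha>)"
    and "\<And>t. t \<in> {0..cross j \<theta>} \<Longrightarrow> W \<theta> t = - P \<theta> (cross j \<theta>) * cnj (W \<theta> (cross j \<theta> - t))"
proof -
  define c p0 where "c = cross j \<theta>" and "p0 = P \<theta> c"
  have c: "c \<in> {0..T}" "13/5 \<le> c" "\<bar>c - real j * pi\<bar> \<le> 1/4" using cross[OF j] by (auto simp: c_def)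
  have Wc: "W \<theta> c = 0" using collision_iff[OF j] G0 by (simp add: c_def)
  have n1: "norm p0 = 1" using norm_momentum_at_collision[OF sol c(1) Wc] by (simp add: p0_def)
  have drift: "Im p0 * cos c < 0"
    unfolding p0_def by (rule coriolis_drift[OF sol eps _ eps_le(1) _ _ Wc]) (use e small c in auto)
  \<comment> \<open>The momentum is near \<open>cos c\<close>, hence near 1 or -1 according to the
    parity of \<open>j\<close>. Removing the sign gives a unit number near 1, whose argument is an
    arcsine.\<close>
  define s :: real where "s = (if 0 < cos c then 1 else - 1)"
  have s: "s = 1 \<or> s = - 1" "s * s = 1" by (auto simp: s_def)
  define z where "z = of_real s * p0"
  have near: "norm (p0 - of_real (cos c)) \<le> e" unfolding p0_def by (rule near_sin(2)[OF c(1)])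
  have cosc: "7/8 \<le> s * cos c"
  proof -
    have "c = of_int (int j) * pi + (c - real j * pi)" by simp
    then have "\<bar>cos c\<bar> = \<bar>cos (c - real j * pi)\<bar>"
      using cos_shift_int_pi[of "int j" "c - real j * pi"] by (simp split: if_splits)
    then have "7/8 \<le> \<bar>cos c\<bar>" using cos_ge_near_zero[of "c - real j * pi"] c(3) by simp
    then show ?thesis by (auto simp: s_def abs_if split: if_splits)
  qed
  have Imz: "Im z < 0" using drift cosc s(1) by (auto simp: z_def mult_less_0_iff)
  have Imz_small: "\<bar>Im z\<bar> \<le> e"
    using near abs_Im_le_cmod[of "p0 - of_real (cos c)"] s(1) by (auto simp: z_def)
  have Rez: "0 < Re z"
    using near abs_Re_le_cmod[of "p0 - of_real (cos c)"] s(1) cosc small by (auto simp: z_def)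
  define \<alpha> where "\<alpha> = arcsin (Im z)"
  have bd: "- 1 \<le> Im z" "Im z \<le> 1" using Imz Imz_small small by auto
  have sin\<alpha>: "sin \<alpha> = Im z" unfolding \<alpha>_def by (rule sin_arcsin[OF bd])
  have rng: "- (pi / 2) \<le> \<alpha>" "\<alpha> \<le> pi / 2" unfolding \<alpha>_def using arcsin_bounded[OF bd] by auto
  have \<alpha>neg: "\<alpha> < 0"
  proof (rule ccontr)
    assume "\<not> \<alpha> < 0"
    then have "0 \<le> sin \<alpha>" using rng pi_gt3 by (intro sin_ge_zero) auto
    then show False using sin\<alpha> Imz by simp
  qed
  have \<alpha>small: "- 1/20 \<le> \<alpha>"
    using abs_le_two_abs_sin[of \<alpha>] rng sin\<alpha> Imz_small small unfolding abs_le_iff by linarith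
  have "cos \<alpha> = Re z"
  proof -
    have "norm z = 1" using n1 s(1) by (auto simp: z_def norm_mult)
    then have "(Re z)\<^sup>2 + (Im z)\<^sup>2 = 1" by (metis cmod_power2 one_power2)
    then have "(Re z)\<^sup>2 = (cos \<alpha>)\<^sup>2" using sin_cos_squared_add[of \<alpha>] sin\<alpha> by simp
    moreover have "0 \<le> cos \<alpha>" using rng by (intro cos_ge_zero) auto
    ultimately show ?thesis using Rez by (simp add: power2_eq_iff_nonneg)
  qed
  then have "z = cis \<alpha>" using sin\<alpha> by (simp add: complex_eq_iff)
  moreover have "p0 = of_real s * z" using s(2) by (simp add: z_def flip: of_real_mult mult.assoc)
  ultimately have p2: "p0\<^sup>2 = cis (2 * \<alpha>)"
    using s(1) by (auto simp: power2_eq_square cis_mult)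
  define \<theta>' where "\<theta>' = k * pi / 2 - \<theta> - \<alpha>"
  have "cis (k * pi) = (if even k then 1 else - 1)"
    by (simp add: complex_eq_iff cos_int_pi)
  moreover have "cis (2 * \<theta>') * p0\<^sup>2 = cis (k * pi) * cnj (cis (2 * \<theta>))"
    by (simp add: p2 cis_mult cis_cnj \<theta>'_def algebra_simps)
  ultimately have "hsol \<epsilon> \<theta>' c (\<lambda>t. - P \<theta> c * cnj (W \<theta> (c - t))) (\<lambda>t. P \<theta> c * cnj (P \<theta> (c - t)))"
    using hsol_reverse[OF sol c(1) Wc, of "cis (k * pi)" \<theta>'] n1 by (auto simp: p0_def split: if_splits)
  from sol_unique(1)[OF this] c(1)
  have rev: "- P \<theta> c * cnj (W \<theta> (c - t)) = W \<theta>' t" if "t \<in> {0..c}" for t using that by simp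
  have "W \<theta>' c = 0" using rev[of c] c(1) by (simp add: W_0)
  then have "c = cross j \<theta>'" using cross_unique[OF j c(3)] rho_zero by blast
  then have "G j \<theta>' = 0" using collision_iff[OF j, of \<theta>'] \<open>W \<theta>' c = 0\<close> by simp
  moreover have "\<bar>\<theta>' - k * pi / 4\<bar> \<le> 1/10"
    using win \<alpha>neg \<alpha>small unfolding \<theta>'_def abs_le_iff by (simp add: field_simps)
  ultimately have eq: "\<theta>' = \<theta>" using G_zero_unique[OF j _ _ _ G0] win by auto
  then have "\<theta> = k * pi / 4 - \<alpha> / 2" by (simp add: \<theta>'_def field_simps)
  then show ?thesis using that[of \<alpha>] \<alpha>small \<alpha>neg n1 p2 rev eq by (simp add: p0_def c_def)
qed

text \<open>Smallness of \<bar>sin t\<bar> puts \<open>t\<close> near a multiple of pi. The multiple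
  0 is excluded because \<open>rho\<close> starts at 0 and at first grows with slope at least 1/2:
  the particle is still receding.\<close>

lemma zero_near_multiple:
  assumes t: "0 < t" "t \<le> T" and W0: "W \<theta> t = 0"
  obtains j :: nat where "1 \<le> j" "\<bar>t - real j * pi\<bar> \<le> 1/4"
proof -
  have tT: "t \<in> {0..T}" using t by simp
  have "\<bar>sin t\<bar> \<le> e" using near_sin(1)[OF tT, of \<theta>] W0 by simp
  then obtain i :: int where i: "\<bar>t - i * pi\<bar> \<le> 2 * e" using near_multiple_of_pi by blast
  have "0 < i"
  proof (rule ccontr)
    assume "\<not> 0 < i"
    then have "i * pi \<le> 0" by (simp add: mult_le_0_iff)
    then have t4: "t \<le> 1/4" using i small unfolding abs_le_iff by linarith
    have "1/2 * (t - 0) \<le> rho \<theta> t - rho \<theta> 0"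
    proof (rule growth_ge)
      fix x assume x: "x \<in> {0..t}"
      have sub: "{0..t} \<subseteq> {0..T}" using t by simp
      show "(rho \<theta> has_real_derivative rho' \<theta> x) (at x within {0..t})"
        using has_real_derivative_subset[OF rho_der sub x] by blast
      have "7/8 \<le> cos (2 * x)" using x t4 by (intro cos_ge_near_zero) auto
      then show "1/2 \<le> rho' \<theta> x" using rho'_near[OF subsetD[OF sub x], of \<theta>] small unfolding abs_le_iff by linarith
    qed (use t in simp)
    then show False using rho_zero[OF W0] rho_zero[OF W_0] t by simp
  qed
  then have "1 \<le> nat i" "real (nat i) = real_of_int i" by simp_all
  moreover have "\<bar>t - i * pi\<bar> \<le> 1/4" using i small by linarith
  ultimately show ?thesis using that[of "nat i"] by simp
qed

text \<open>The margin 1/2 before \<open>T\<close> rules out the close approach number n + 1, which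
  would be within 1/4 of \<open>T\<close>.\<close>

lemma zero_is_cross:
  assumes t: "0 < t" "t \<le> T - 1/2" and W0: "W \<theta> t = 0"
  obtains j :: nat where "1 \<le> j" "j \<le> n" "t = cross j \<theta>" "G j \<theta> = 0"
proof -
  obtain j :: nat where j: "1 \<le> j" "\<bar>t - real j * pi\<bar> \<le> 1/4"
    using zero_near_multiple[OF t(1) _ W0] t(2) by auto
  have "j \<le> n"
  proof (rule ccontr)
    assume "\<not> j \<le> n"
    then have "(real n + 1) * pi \<le> real j * pi" by (intro mult_right_mono) auto
    then show False using j(2) t(2) unfolding T abs_le_iff by linarith
  qed
  moreover have "t = cross j \<theta>" by (rule cross_unique[OF j(1) \<open>j \<le> n\<close> j(2) rho_zero[OF W0]])
  ultimately show ?thesis using that[of j] collision_iff[OF j(1), of \<theta>] W0 j(1) by simp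
qed

text \<open>Were there an earlier collision, the motion after it would be another ejection-collision
  motion, whose ejection angle lies on the wrong side of the symmetry axis.\<close>

lemma no_earlier_collision:
  assumes Gn: "G n \<theta> = 0" and j: "1 \<le> j" "j < n"
  shows "G j \<theta> \<noteq> 0"
proof
  assume Gj: "G j \<theta> = 0"
  have jn: "j \<le> n" using j by simp
  obtain k :: int where k: "\<bar>\<theta> - k * pi / 4\<bar> \<le> 1/20" using G_zero_window[OF j(1) jn Gj] by blast
  obtain \<alpha> where \<alpha>: "- 1/20 \<le> \<alpha>" "\<alpha> < 0" "\<theta> = k * pi / 4 - \<alpha> / 2"
    "norm (P \<theta> (cross j \<theta>)) = 1" "(P \<theta> (cross j \<theta>))\<^sup>2 = cis (2 * \<alpha>)"
    using collision_reversal[OF j(1) jn k Gj] by metis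
  define t0 t1 where "t0 = cross j \<theta>" and "t1 = cross n \<theta>"
  have t0: "t0 \<in> {0..T}" "\<bar>t0 - real j * pi\<bar> \<le> 1/4" using cross[OF j(1) jn] by (auto simp: t0_def)
  have t1: "t1 \<in> {0..T}" "\<bar>t1 - real n * pi\<bar> \<le> 1/4" using cross[OF n order_refl] by (auto simp: t1_def)
  have W0: "W \<theta> t0 = 0" "W \<theta> t1 = 0"
    using collision_iff[OF j(1) jn] collision_iff[OF n order_refl] Gn Gj by (auto simp: t0_def t1_def)
  define \<theta>' where "\<theta>' = \<theta> + \<alpha>"
  have "cis (2 * \<theta>') = 1 * (cis (2 * \<theta>) * (P \<theta> t0)\<^sup>2)"
    using \<alpha>(5) by (simp add: t0_def \<theta>'_def cis_mult algebra_simps)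
  from hsol_shift[OF sol t0(1) W0(1) _ _ this]
  have sh: "hsol \<epsilon> \<theta>' (T - t0) (\<lambda>t. W \<theta> (t0 + t) / P \<theta> t0) (\<lambda>t. P \<theta> (t0 + t) / P \<theta> t0)"
    using \<alpha>(4) by (simp add: t0_def)
  have diff: "real (n - j) * pi = real n * pi - real j * pi" "pi \<le> real (n - j) * pi"
    using j mult_right_mono[of 1 "real (n - j)" pi] by (auto simp: of_nat_diff algebra_simps)
  have lt: "0 < t1 - t0" using t0(2) t1(2) diff pi_gt3 unfolding abs_le_iff by linarith
  then have in0: "t1 - t0 \<in> {0..T - t0}" using t1(1) by simp
  have W': "W \<theta>' (t1 - t0) = 0" using sol_unique(1)[OF sh _ in0] t0(1) W0(2) by simp
  moreover have "t1 - t0 \<le> T - 1/2"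
    using t1(1) cross(5)[OF j(1) jn, of \<theta>] by (simp add: t0_def)
  ultimately obtain i where i: "1 \<le> i" "i \<le> n" "t1 - t0 = cross i \<theta>'" "G i \<theta>' = 0"
    using zero_is_cross lt by metis
  have win: "\<bar>\<theta>' - k * pi / 4\<bar> \<le> 1/20" using \<alpha> unfolding \<theta>'_def abs_le_iff by simp
  \<comment> \<open>The continuation has the angle k pi/4 + \<alpha>/2 with \<alpha> < 0. As it
    collides as well, the angle would also have to be k pi/4 - \<alpha>'/2 with \<alpha>' < 0, on
    the other side.\<close>
  obtain \<alpha>' where "\<alpha>' < 0" "\<theta>' = k * pi / 4 - \<alpha>' / 2"
    using collision_reversal[OF i(1,2) win i(4)] by metis
  then show False using \<alpha> by (simp add: \<theta>'_def)
qed

lemma first_collision: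
  assumes "G n \<theta> = 0" "0 < t" "t \<le> cross n \<theta>" "W \<theta> t = 0"
  shows "t = cross n \<theta>"
proof -
  have "cross n \<theta> \<le> T - 1/2"
    using cross(1)[OF n order_refl, of \<theta>] jpi_le[OF n order_refl] pi_gt3 unfolding abs_le_iff by linarith
  then obtain j where j: "1 \<le> j" "j \<le> n" "t = cross j \<theta>" "G j \<theta> = 0"
    using zero_is_cross[OF assms(2) _ assms(4)] assms(3) by (metis order_trans)
  then show ?thesis using no_earlier_collision[OF assms(1) j(1)] by (cases "j = n") auto
qed

section \<open>Quarter turns of the ejection angle\<close>

lemma W_P_quarter_turn:
  assumes "t \<in> {0..T}"
  shows "W (\<theta> + of_int m * pi / 2) t = W \<theta> t" "P (\<theta> + of_int m * pi / 2) t = P \<theta> t"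
proof -
  \<comment> \<open>A quarter turn of \<theta>, a half turn in the (x, y) plane, only changes the
    sign of \<open>cis (2 * \<theta>)\<close>, to which \<open>hill_rhs\<close> is insensitive. The
    scaled orbit stays the same and just the prefactor \<open>cis \<theta>\<close> turns.\<close>
  have "cis (of_int m * pi) = (if even m then 1 else - 1)"
    by (simp add: complex_eq_iff cos_int_pi)
  moreover have "cis (2 * (\<theta> + of_int m * pi / 2)) = cis (of_int m * pi) * cis (2 * \<theta>)"
    by (simp add: cis_mult algebra_simps)
  ultimately have "hill_rhs \<epsilon> (\<theta> + of_int m * pi / 2) w p = hill_rhs \<epsilon> \<theta> w p" for w p
    using hill_rhs_rotate[of 1 "cis (of_int m * pi)" "\<theta> + of_int m * pi / 2" \<theta> \<epsilon> w p]
    by (auto split: if_splits)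
  then have "hsol \<epsilon> (\<theta> + of_int m * pi / 2) T (W \<theta>) (P \<theta>)" using sol[of \<theta>] by (simp add: hsol_def)
  from sol_unique[OF this order_refl assms]
  show "W (\<theta> + of_int m * pi / 2) t = W \<theta> t" "P (\<theta> + of_int m * pi / 2) t = P \<theta> t" by simp_all
qed

lemma G_quarter_turn:
  assumes j: "1 \<le> j" "j \<le> n"
  shows "cross j (\<theta> + of_int m * pi / 2) = cross j \<theta>" "G j (\<theta> + of_int m * pi / 2) = 0 \<longleftrightarrow> G j \<theta> = 0"
proof -
  have "rho (\<theta> + of_int m * pi / 2) (cross j \<theta>) = 0"
    using cross(3)[OF j, of \<theta>] cross(4)[OF j, of \<theta>] by (simp add: rho_def W_P_quarter_turn)
  then show *: "cross j (\<theta> + of_int m * pi / 2) = cross j \<theta>"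
    using cross_unique[OF j cross(1)[OF j]] by metis
  show "G j (\<theta> + of_int m * pi / 2) = 0 \<longleftrightarrow> G j \<theta> = 0"
    unfolding collision_iff[OF j, symmetric] * using W_P_quarter_turn(1)[OF cross(4)[OF j]] by simp
qed

text \<open>With k = 2 m + k mod 2 for the index of the window, turning back by m quarter turns
  brings any zero into the window at 0 or at pi/4, where it is unique.\<close>

lemma G_zeros:
  assumes \<theta>0: "\<bar>\<theta>0\<bar> \<le> 1/20" "G n \<theta>0 = 0" and \<theta>1: "\<bar>\<theta>1 - pi / 4\<bar> \<le> 1/20" "G n \<theta>1 = 0"
  shows "G n \<theta> = 0 \<longleftrightarrow> (\<exists>m::int. \<theta> = \<theta>0 + m * pi / 2 \<or> \<theta> = \<theta>1 + m * pi / 2)"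
proof
  assume G0: "G n \<theta> = 0"
  obtain k :: int where k: "\<bar>\<theta> - k * pi / 4\<bar> \<le> 1/20" using G_zero_window[OF n order_refl G0] by blast
  define m where "m = k div 2"
  have km: "k = 2 * m + k mod 2" by (simp add: m_def)
  define \<theta>' where "\<theta>' = \<theta> + of_int (- m) * pi / 2"
  have G': "G n \<theta>' = 0" unfolding \<theta>'_def G_quarter_turn[OF n order_refl] by (rule G0)
  have k4: "real_of_int k * pi / 4 = m * pi / 2 + of_int (k mod 2) * pi / 4"
    by (subst km) (simp add: algebra_simps)
  have "\<bar>\<theta>' - of_int (k mod 2) * pi / 4\<bar> \<le> 1/20"
    using k unfolding k4 \<theta>'_def by (simp add: algebra_simps)
  moreover have "k mod 2 = 0 \<or> k mod 2 = 1" by presburger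
  ultimately have "\<theta>' = \<theta>0 \<or> \<theta>' = \<theta>1"
    using G_zero_unique[OF n order_refl _ _ G' \<theta>0(2), of 0] G_zero_unique[OF n order_refl _ _ G' \<theta>1(2), of 1] \<theta>0 \<theta>1
    by auto
  moreover have "\<theta> = \<theta>' + of_int m * pi / 2" by (simp add: \<theta>'_def)
  ultimately show "\<exists>m::int. \<theta> = \<theta>0 + m * pi / 2 \<or> \<theta> = \<theta>1 + m * pi / 2" by blast
qed (use \<theta>0 \<theta>1 G_quarter_turn[OF n order_refl] in auto)

lemma card_local_max_W:
  assumes k: "1 \<le> k" and T': "T' \<le> T" "\<bar>T' - real k * pi\<bar> \<le> 1/2"
  shows "finite {t \<in> {0<..<T'}. \<forall>\<^sub>F s in at t. sqn (W \<theta> s) \<le> sqn (W \<theta> t)} \<and>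
    card {t \<in> {0<..<T'}. \<forall>\<^sub>F s in at t. sqn (W \<theta> s) \<le> sqn (W \<theta> t)} = k"
proof (rule card_local_max_near_sin_squared[where \<rho> = "rho \<theta>" and \<rho>' = "rho' \<theta>"])
  fix t assume t: "t \<in> {0..T'}"
  have sub: "{0..T'} \<subseteq> {0..T}" and tT: "t \<in> {0..T}" using T' t by auto
  show "((\<lambda>t. sqn (W \<theta> t)) has_real_derivative 2 * rho \<theta> t) (at t within {0..T'})"
    by (rule has_real_derivative_subset[OF sqn_W_der sub t])
  show "(rho \<theta> has_real_derivative rho' \<theta> t) (at t within {0..T'})"
    using has_real_derivative_subset[OF rho_der sub t] by blast
  show "\<bar>rho \<theta> t - sin t * cos t\<bar> \<le> 1/10" using rho_near[OF tT, of \<theta>] small by linarith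
  show "\<bar>rho' \<theta> t - cos (2 * t)\<bar> \<le> 1/10" using rho'_near[OF tT, of \<theta>] small by linarith
qed (use assms rho_zero[OF W_0] in auto)

end

section \<open>Scaling to the regularized Hill problem\<close>

lemma deriv_reg_W:
  "deriv (\<lambda>a. reg_W K a v) u = - 4 * K * u + 12 * u * (u\<^sup>2 - v\<^sup>2)\<^sup>2 + 24 * u * (u\<^sup>2 + v\<^sup>2) * (u\<^sup>2 - v\<^sup>2)"
  "deriv (\<lambda>b. reg_W K u b) v = - 4 * K * v + 12 * v * (u\<^sup>2 - v\<^sup>2)\<^sup>2 - 24 * v * (u\<^sup>2 + v\<^sup>2) * (u\<^sup>2 - v\<^sup>2)"
  unfolding reg_W_def
  by (rule DERIV_imp_deriv; auto intro!: derivative_eq_intros simp: algebra_simps power2_eq_square)+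

definition reg_force :: "real \<Rightarrow> complex \<Rightarrow> complex" where
  "reg_force K z = - of_real (4 * K) * z + 12 * of_real ((Re (z\<^sup>2))\<^sup>2) * z
     + 24 * (z * cnj z) * of_real (Re (z\<^sup>2)) * cnj z"

lemma reg_force_components:
  "Re (reg_force K z) = deriv (\<lambda>a. reg_W K a (Im z)) (Re z)"
  "Im (reg_force K z) = deriv (\<lambda>b. reg_W K (Re z) b) (Im z)"
  unfolding deriv_reg_W reg_force_def by (simp_all add: power2_eq_square algebra_simps)

definition reg_sol :: "real \<Rightarrow> real \<Rightarrow> (real \<Rightarrow> complex) \<Rightarrow> (real \<Rightarrow> complex) \<Rightarrow> bool" where
  "reg_sol K S Z Z' \<longleftrightarrow> (\<forall>s\<in>{0..S}.
     (Z has_vector_derivative Z' s) (at s within {0..S}) \<and>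
     (Z' has_vector_derivative (- 8 * \<i> * (Z s * cnj (Z s)) * Z' s + reg_force K (Z s))) (at s within {0..S}) \<and>
     sqn (Z' s) = 2 * reg_W K (Re (Z s)) (Im (Z s)))"

lemma reg_hill_solution_iff:
  "reg_hill_solution K S u v \<longleftrightarrow> (\<exists>Z'. reg_sol K S (\<lambda>s. Complex (u s) (v s)) Z')"
proof -
  have eq: "(\<forall>s\<in>{0..S}.
     (u has_real_derivative u' s) (at s within {0..S}) \<and>
     (v has_real_derivative v' s) (at s within {0..S}) \<and>
     (u' has_real_derivative
        8 * ((u s)\<^sup>2 + (v s)\<^sup>2) * v' s + deriv (\<lambda>a. reg_W K a (v s)) (u s)) (at s within {0..S}) \<and>
     (v' has_real_derivative
        - 8 * ((u s)\<^sup>2 + (v s)\<^sup>2) * u' s + deriv (\<lambda>b. reg_W K (u s) b) (v s)) (at s within {0..S}) \<and>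
     (u' s)\<^sup>2 + (v' s)\<^sup>2 = 2 * reg_W K (u s) (v s)) \<longleftrightarrow>
    reg_sol K S (\<lambda>s. Complex (u s) (v s)) (\<lambda>s. Complex (u' s) (v' s))" for u' v'
  proof -
    have "Re (- 8 * \<i> * (Complex a b * cnj (Complex a b)) * Complex c d + reg_force K (Complex a b))
        = 8 * (a\<^sup>2 + b\<^sup>2) * d + deriv (\<lambda>x. reg_W K x b) a"
      "Im (- 8 * \<i> * (Complex a b * cnj (Complex a b)) * Complex c d + reg_force K (Complex a b))
        = - 8 * (a\<^sup>2 + b\<^sup>2) * c + deriv (\<lambda>x. reg_W K a x) b" for a b c d
      using reg_force_components[of K "Complex a b"] by (simp_all add: power2_eq_square algebra_simps)
    then show ?thesis
      unfolding reg_sol_def has_vector_derivative_complex_iff sqn_eq_norm cmod_power2 by (simp add: conj_ac)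
  qed
  show ?thesis
  proof
    assume "reg_hill_solution K S u v"
    then show "\<exists>Z'. reg_sol K S (\<lambda>s. Complex (u s) (v s)) Z'"
      unfolding reg_hill_solution_def eq by blast
  next
    assume "\<exists>Z'. reg_sol K S (\<lambda>s. Complex (u s) (v s)) Z'"
    then obtain Z' where "reg_sol K S (\<lambda>s. Complex (u s) (v s)) (\<lambda>s. Complex (Re (Z' s)) (Im (Z' s)))"
      by auto
    then show "reg_hill_solution K S u v"
      unfolding reg_hill_solution_def eq by (intro exI)
  qed
qed

text \<open>The scaling \<open>Z s = A e\<^sup>i\<^sup>\<theta> w (2 k s)\<close> with \<open>K = k\<^sup>2\<close> and \<open>A = sqrt 2 / k\<close>.\<close>

locale hill_scaling =
  fixes k A \<epsilon> :: real
  assumes k: "0 < k" and A: "0 < A" "A\<^sup>2 * k\<^sup>2 = 2" and \<epsilon>: "\<epsilon> = A\<^sup>2 / (2 * k)"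
begin

text \<open>With amplitude \<open>A\<close> the Coriolis term scales as 16 A^3 k and the tide as
  A^5. Relative to the factor 4 k^2 A of the linear force these are 8 \<epsilon> and \<epsilon>^2
  for the single value \<epsilon> = A^2 / (2 k).\<close>

lemma reg_force_scaled:
  fixes w p :: complex and \<theta> :: real
  defines "C \<equiv> cis \<theta>"
  shows "- 8 * \<i> * ((of_real A * C * w) * cnj (of_real A * C * w)) * (of_real (2 * k * A) * C * p)
      + reg_force (k\<^sup>2) (of_real A * C * w)
    = of_real (4 * k\<^sup>2 * A) * C * (- w + hill_rhs \<epsilon> \<theta> w p)"
proof -
  define q where "q = Re (cis (2 * \<theta>) * w\<^sup>2)"
  define D where "D = cis (- 2 * \<theta>)"
  have "Re ((of_real A * C * w)\<^sup>2) = Re (of_real (A\<^sup>2) * (C\<^sup>2 * w\<^sup>2))"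
    by (simp only: power_mult_distrib of_real_power mult.assoc)
  also have "C\<^sup>2 = cis (2 * \<theta>)" by (simp add: C_def power2_eq_square cis_mult)
  finally have q: "Re ((of_real A * C * w)\<^sup>2) = A\<^sup>2 * q" by (simp add: q_def)
  have CD: "cnj C = C * D" by (simp add: C_def D_def cis_mult cis_cnj)
  have R: "(of_real A * C * w) * cnj (of_real A * C * w) = of_real (A\<^sup>2) * (w * cnj w)"
  proof -
    have "C * cnj C = 1" by (simp add: C_def cis_cnj cis_mult)
    moreover have "(of_real A * C * w) * cnj (of_real A * C * w) = of_real (A\<^sup>2) * (w * cnj w) * (C * cnj C)"
      by (simp add: power2_eq_square mult_ac)
    ultimately show ?thesis by simp
  qed
  have cnj: "cnj (of_real A * C * w) = of_real A * (C * D) * cnj w" by (simp add: CD)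
  have e1: "4 * k\<^sup>2 * A * (8 * \<epsilon>) = 16 * A ^ 3 * k"
    unfolding \<epsilon> using k by (simp add: power2_eq_square power3_eq_cube field_simps)
  have e2: "4 * k\<^sup>2 * A * \<epsilon>\<^sup>2 = A ^ 5"
    unfolding \<epsilon> using k by (simp add: power2_eq_square power_numeral_reduce field_simps)
  have "of_real (4 * k\<^sup>2 * A) * C * (- w + hill_rhs \<epsilon> \<theta> w p) =
     - of_real (4 * k\<^sup>2 * A) * C * w + of_real (4 * k\<^sup>2 * A * (8 * \<epsilon>)) * C * (- \<i> * (w * cnj w) * p)
     + of_real (4 * k\<^sup>2 * A * \<epsilon>\<^sup>2) * C * (12 * of_real (q\<^sup>2) * w + 24 * (w * cnj w) * of_real q * (D * cnj w))"
    unfolding hill_rhs_def q_def[symmetric] D_def[symmetric]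
    by (simp only: of_real_mult distrib_left mult_minus_right mult_minus_left mult_ac) simp
  moreover have "- 8 * \<i> * ((of_real A * C * w) * cnj (of_real A * C * w)) * (of_real (2 * k * A) * C * p)
      + reg_force (k\<^sup>2) (of_real A * C * w) =
     - of_real (4 * k\<^sup>2 * A) * C * w + of_real (16 * A ^ 3 * k) * C * (- \<i> * (w * cnj w) * p)
     + of_real (A ^ 5) * C * (12 * of_real (q\<^sup>2) * w + 24 * (w * cnj w) * of_real q * (D * cnj w))"
    unfolding reg_force_def R q unfolding cnj
    by (simp add: algebra_simps power2_eq_square power_numeral_reduce)
  ultimately show ?thesis unfolding e1 e2 by simp
qed

text \<open>Through \<open>A\<^sup>2 * k\<^sup>2 = 2\<close> the constant 8 can be factored out, and
  the regularized energy constraint becomes \<open>energy = 1\<close>, the value provided by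
  \<open>hsol_energy\<close>.\<close>

lemma reg_W_scaled:
  "2 * reg_W (k\<^sup>2) (Re (of_real A * cis \<theta> * w)) (Im (of_real A * cis \<theta> * w))
     = 8 * (1 - sqn w + 12 * \<epsilon>\<^sup>2 * (sqn w * (Re (cis (2 * \<theta>) * w\<^sup>2))\<^sup>2))"
proof -
  define z where "z = of_real A * cis \<theta> * w"
  define q where "q = Re (cis (2 * \<theta>) * w\<^sup>2)"
  have "z\<^sup>2 = of_real (A\<^sup>2) * (cis (2 * \<theta>) * w\<^sup>2)"
    by (simp add: z_def power_mult_distrib power2_eq_square[of "cis \<theta>"] cis_mult)
  then have q: "(Re z)\<^sup>2 - (Im z)\<^sup>2 = A\<^sup>2 * q"
    by (simp only: q_def flip: Re_power2) (simp add: algebra_simps)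
  have R: "(Re z)\<^sup>2 + (Im z)\<^sup>2 = A\<^sup>2 * sqn w"
    unfolding sqn_eq_norm cmod_power2[symmetric] z_def by (simp add: norm_mult power_mult_distrib)
  have "12 * A ^ 6 = 96 * \<epsilon>\<^sup>2 * (A\<^sup>2 * k\<^sup>2 / 2)"
    unfolding \<epsilon> using k by (simp add: power2_eq_square power_numeral_reduce field_simps)
  then have e: "12 * A ^ 6 = 96 * \<epsilon>\<^sup>2" using A(2) by simp
  have "2 * reg_W (k\<^sup>2) (Re z) (Im z) = 12 * A ^ 6 * (sqn w * q\<^sup>2) + 8 - 4 * (A\<^sup>2 * k\<^sup>2) * sqn w"
    unfolding reg_W_def q R by (simp add: power2_eq_square power_numeral_reduce algebra_simps)
  also have "\<dots> = 8 * (1 - sqn w + 12 * \<epsilon>\<^sup>2 * (sqn w * q\<^sup>2))" unfolding e A(2) by simp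
  finally show ?thesis by (simp add: z_def q_def)
qed

lemma scale_derivative:
  fixes f :: "real \<Rightarrow> complex" and a :: complex
  assumes "(f has_vector_derivative f') (at (c * s) within {0..c * S})" "0 < c"
  shows "((\<lambda>s. a * f (c * s)) has_vector_derivative of_real c * a * f') (at s within {0..S})"
proof -
  have "((\<lambda>s. c * s) has_vector_derivative c) (at s within {0..S})"
    by (auto intro!: derivative_eq_intros)
  moreover have "(f has_vector_derivative f') (at (c * s) within (\<lambda>s. c * s) ` {0..S})"
    by (rule has_vector_derivative_within_subset[OF assms(1)]) (use assms(2) in auto)
  ultimately have "((f \<circ> (\<lambda>s. c * s)) has_vector_derivative c *\<^sub>R f') (at s within {0..S})"
    by (rule vector_diff_chain_within)
  from has_vector_derivative_mult_right[OF this, of a] show ?thesis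
    by (simp add: o_def scaleR_conv_of_real mult_ac)
qed

lemma hsol_imp_reg_sol:
  assumes sol: "hsol \<epsilon> \<theta> (2 * k * S) w p"
  shows "reg_sol (k\<^sup>2) S (\<lambda>s. of_real A * cis \<theta> * w (2 * k * s)) (\<lambda>s. of_real (2 * k * A) * cis \<theta> * p (2 * k * s))"
  unfolding reg_sol_def
proof (intro ballI conjI)
  fix s assume s: "s \<in> {0..S}"
  then have t: "2 * k * s \<in> {0..2 * k * S}" using k by simp
  have k2: "0 < 2 * k" using k by simp
  show "((\<lambda>s. of_real A * cis \<theta> * w (2 * k * s)) has_vector_derivative of_real (2 * k * A) * cis \<theta> * p (2 * k * s))
      (at s within {0..S})"
    using scale_derivative[OF hsol_derivs(1)[OF sol t] k2, of "of_real A * cis \<theta>"] by (simp add: mult_ac)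
  have "((\<lambda>s. of_real (2 * k * A) * cis \<theta> * p (2 * k * s)) has_vector_derivative
      of_real (4 * k\<^sup>2 * A) * cis \<theta> * (- w (2 * k * s) + hill_rhs \<epsilon> \<theta> (w (2 * k * s)) (p (2 * k * s)))) (at s within {0..S})"
    using scale_derivative[OF hsol_derivs(2)[OF sol t] k2, of "of_real (2 * k * A) * cis \<theta>"]
    by (rule has_vector_derivative_eq_rhs) (simp add: power2_eq_square mult_ac)
  then show "((\<lambda>s. of_real (2 * k * A) * cis \<theta> * p (2 * k * s)) has_vector_derivative
      - 8 * \<i> * (of_real A * cis \<theta> * w (2 * k * s) * cnj (of_real A * cis \<theta> * w (2 * k * s)))
        * (of_real (2 * k * A) * cis \<theta> * p (2 * k * s)) + reg_force (k\<^sup>2) (of_real A * cis \<theta> * w (2 * k * s)))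
      (at s within {0..S})"
    unfolding reg_force_scaled .
  have "sqn (of_real (2 * k * A) * cis \<theta> * p (2 * k * s)) = 4 * (A\<^sup>2 * k\<^sup>2) * sqn (p (2 * k * s))"
    using k A(1) by (simp add: sqn_eq_norm norm_mult power_mult_distrib)
  also have "\<dots> = 8 * sqn (p (2 * k * s))" unfolding A(2) by simp
  also have "\<dots> = 2 * reg_W (k\<^sup>2) (Re (of_real A * cis \<theta> * w (2 * k * s))) (Im (of_real A * cis \<theta> * w (2 * k * s)))"
    unfolding reg_W_scaled using hsol_energy[OF sol t] by (simp add: energy_def)
  finally show "sqn (of_real (2 * k * A) * cis \<theta> * p (2 * k * s)) =
      2 * reg_W (k\<^sup>2) (Re (of_real A * cis \<theta> * w (2 * k * s))) (Im (of_real A * cis \<theta> * w (2 * k * s)))" .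
qed

text \<open>At the origin the energy constraint forces \<bar>Z' 0\<bar>^2 = 8 = (2 k A)^2. The
  direction of \<open>Z' 0\<close> is the only free datum and becomes the angle \<theta>.\<close>

lemma reg_sol_imp_hsol:
  assumes sol: "reg_sol (k\<^sup>2) S Z Z'" and S: "0 \<le> S" and Z0: "Z 0 = 0"
  obtains \<theta> w p where "hsol \<epsilon> \<theta> (2 * k * S) w p"
    and "\<And>s. Z s = of_real A * cis \<theta> * w (2 * k * s)"
proof -
  have "(norm (Z' 0))\<^sup>2 = 8"
    using sol S Z0 by (simp add: reg_sol_def sqn_eq_norm reg_W_def)
  also have "\<dots> = (2 * k * A)\<^sup>2" using A(2) by (simp add: power_mult_distrib)
  finally have nZ': "norm (Z' 0) = 2 * k * A" using k A(1) by (simp add: power2_eq_iff_nonneg)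
  define \<theta> where "\<theta> = Arg (Z' 0)"
  have Z'0: "Z' 0 = of_real (2 * k * A) * cis \<theta>"
    using cis_Arg_unique rcis_cmod_Arg[of "Z' 0"] nZ' by (simp add: rcis_def \<theta>_def)
  define C where "C = cis \<theta>"
  have C: "C \<noteq> 0" by (simp add: C_def)
  have kA: "complex_of_real k \<noteq> 0" "complex_of_real A \<noteq> 0" using k A by auto
  define w where "w t = inverse (of_real A * C) * Z (1 / (2 * k) * t)" for t
  define p where "p t = inverse (of_real (2 * k * A) * C) * Z' (1 / (2 * k) * t)" for t
  have Zw: "Z s = of_real A * C * w (2 * k * s)" for s using kA C k by (simp add: w_def field_simps)
  have Zp: "Z' s = of_real (2 * k * A) * C * p (2 * k * s)" for s using kA C k by (simp add: p_def field_simps)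
  have "hsol \<epsilon> \<theta> (2 * k * S) w p"
    unfolding hsol_def
  proof (intro conjI ballI)
    show "w 0 = 0" by (simp add: w_def Z0)
    have "of_real (2 * k * A) * C \<noteq> 0" using kA C by simp
    moreover have "p 0 = inverse (of_real (2 * k * A) * C) * (of_real (2 * k * A) * C)"
      by (simp only: p_def mult_zero_right Z'0 C_def)
    ultimately show "p 0 = 1" using left_inverse by metis
    fix t assume "t \<in> {0..2 * k * S}"
    then have s: "1 / (2 * k) * t \<in> {0..1 / (2 * k) * (2 * k * S)}" using k by (simp add: field_simps)
    have SS: "1 / (2 * k) * (2 * k * S) = S" and tt: "2 * k * (1 / (2 * k) * t) = t" using k by simp_all
    have k2: "0 < 1 / (2 * k)" using k by simp
    define X where "X = - w t + hill_rhs \<epsilon> \<theta> (w t) (p t)"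
    have Z'1: "Z' (1 / (2 * k) * t) = of_real (2 * k * A) * C * p t" using Zp[of "1 / (2 * k) * t"] tt by simp
    have Z1: "Z (1 / (2 * k) * t) = of_real A * C * w t" using Zw[of "1 / (2 * k) * t"] tt by simp
    have "- 8 * \<i> * (Z (1 / (2 * k) * t) * cnj (Z (1 / (2 * k) * t))) * Z' (1 / (2 * k) * t)
        + reg_force (k\<^sup>2) (Z (1 / (2 * k) * t)) = of_real (4 * k\<^sup>2 * A) * C * X"
      unfolding Z1 Z'1 X_def C_def by (rule reg_force_scaled)
    moreover have "(Z has_vector_derivative Z' (1 / (2 * k) * t)) (at (1 / (2 * k) * t) within {0..S})"
      "(Z' has_vector_derivative - 8 * \<i> * (Z (1 / (2 * k) * t) * cnj (Z (1 / (2 * k) * t))) * Z' (1 / (2 * k) * t)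
        + reg_force (k\<^sup>2) (Z (1 / (2 * k) * t))) (at (1 / (2 * k) * t) within {0..S})"
      using sol s unfolding reg_sol_def SS by blast+
    ultimately have d: "(Z has_vector_derivative of_real (2 * k * A) * C * p t) (at (1 / (2 * k) * t) within {0..1 / (2 * k) * (2 * k * S)})"
      "(Z' has_vector_derivative of_real (4 * k\<^sup>2 * A) * C * X) (at (1 / (2 * k) * t) within {0..1 / (2 * k) * (2 * k * S)})"
      unfolding SS Z'1[symmetric] by (simp_all only:)
    have "(w has_vector_derivative of_real (1 / (2 * k)) * inverse (of_real A * C) * (of_real (2 * k * A) * C * p t))
        (at t within {0..2 * k * S})"
      unfolding w_def using scale_derivative[OF d(1) k2] .
    then show "(w has_vector_derivative p t) (at t within {0..2 * k * S})"
      by (rule has_vector_derivative_eq_rhs) (use kA C in \<open>simp add: field_simps\<close>)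
    have "(p has_vector_derivative of_real (1 / (2 * k)) * inverse (of_real (2 * k * A) * C) * (of_real (4 * k\<^sup>2 * A) * C * X))
        (at t within {0..2 * k * S})"
      unfolding p_def[abs_def] using scale_derivative[OF d(2) k2] .
    then have "(p has_vector_derivative X) (at t within {0..2 * k * S})"
      by (rule has_vector_derivative_eq_rhs) (use kA C in \<open>simp add: power2_eq_square field_simps\<close>)
    then show "(p has_vector_derivative (- w t + hill_rhs \<epsilon> \<theta> (w t) (p t))) (at t within {0..2 * k * S})"
      by (simp only: X_def)
  qed
  then show ?thesis using that Zw by (simp add: C_def)
qed

end

section \<open>Ejection-collision motions\<close>

definition pair_of :: "complex \<Rightarrow> real \<times> real" where "pair_of z = (Re z, Im z)"

lemma levi_civita_eq: "levi_civita (Re z, Im z) = pair_of (z\<^sup>2)"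
  by (simp add: pair_of_def Re_power2 Im_power2)

lemma norm_pair_of: "norm (pair_of z) = norm z"
  by (simp add: pair_of_def norm_Pair cmod_def)

lemma inj_pair_of: "inj pair_of"
  by (auto simp: inj_def pair_of_def complex_eq_iff)

lemma reflect_pair_of:
  "reflect_x_axis (pair_of z) = pair_of (cnj z)" "reflect_y_axis (pair_of z) = pair_of (- cnj z)"
  by (simp_all add: pair_of_def)

lemma eventually_at_scale:
  fixes c x :: real
  assumes "0 < c"
  shows "(\<forall>\<^sub>F s in at x. Q (c * s)) \<longleftrightarrow> (\<forall>\<^sub>F t in at (c * x). Q t)"
proof -
  have "(\<forall>\<^sub>F t in at (c * x). Q t) \<longleftrightarrow> (\<forall>\<^sub>F t in filtermap ((*) c) (nhds x). t \<noteq> c * x \<longrightarrow> Q t)"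
    using filtermap_nhds_times[of c x] assms by (simp add: eventually_at_filter)
  also have "\<dots> \<longleftrightarrow> (\<forall>\<^sub>F s in at x. Q (c * s))"
    using assms by (simp add: eventually_filtermap eventually_at_filter)
  finally show ?thesis by simp
qed

text \<open>A positive factor and a rescaling of time do not affect local maxima. The formula for
  \<open>q\<close> holds on \<open>{0..S}\<close> only, so the neighbourhoods are first shrunk into
  the open interval.\<close>

lemma local_max_times_scaled:
  assumes c: "0 < c" and A: "A \<noteq> 0"
    and q: "\<And>s. s \<in> {0..S} \<Longrightarrow> norm (q s) = A\<^sup>2 * f (c * s)"
  shows "local_max_times (S, q) = (\<lambda>t. t / c) ` {t \<in> {0<..<c * S}. \<forall>\<^sub>F t' in at t. f t' \<le> f t}"
proof -
  have iff: "(\<forall>\<^sub>F s' in at s. norm (q s') \<le> norm (q s)) \<longleftrightarrow> (\<forall>\<^sub>F t' in at (c * s). f t' \<le> f (c * s))"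
    if s: "s \<in> {0<..<S}" for s
  proof -
    have "\<forall>\<^sub>F s' in at s. s' \<in> {0<..<S}"
      using s by (intro eventually_at_in_open') auto
    then have "(\<forall>\<^sub>F s' in at s. norm (q s') \<le> norm (q s)) \<longleftrightarrow> (\<forall>\<^sub>F s' in at s. f (c * s') \<le> f (c * s))"
      by (rule eventually_subst[OF eventually_mono]) (use s q[of s] q A in \<open>simp add: mult_le_cancel_left\<close>)
    also have "\<dots> \<longleftrightarrow> (\<forall>\<^sub>F t' in at (c * s). f t' \<le> f (c * s))" by (rule eventually_at_scale[OF c])
    finally show ?thesis .
  qed
  show ?thesis
  proof (intro subset_antisym subsetI)
    fix s assume "s \<in> local_max_times (S, q)"
    then have "s \<in> {0<..<S}" "\<forall>\<^sub>F t' in at (c * s). f t' \<le> f (c * s)"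
      using iff by (auto simp: local_max_times_def)
    then show "s \<in> (\<lambda>t. t / c) ` {t \<in> {0<..<c * S}. \<forall>\<^sub>F t' in at t. f t' \<le> f t}"
      using c by (intro image_eqI[of _ _ "c * s"]) auto
  next
    fix s assume "s \<in> (\<lambda>t. t / c) ` {t \<in> {0<..<c * S}. \<forall>\<^sub>F t' in at t. f t' \<le> f t}"
    then have "s \<in> {0<..<S}" "\<forall>\<^sub>F t' in at (c * s). f t' \<le> f (c * s)"
      using c by (auto simp: field_simps)
    then show "s \<in> local_max_times (S, q)" using iff by (simp add: local_max_times_def)
  qed
qed

locale hill_problem = hill_regime n \<epsilon> e T + hill_scaling k A \<epsilon> for n \<epsilon> e T k A
begin

definition Z :: "real \<Rightarrow> real \<Rightarrow> complex" where
  "Z \<theta> s = of_real A * cis \<theta> * W \<theta> (2 * k * s)"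

definition mot :: "real \<Rightarrow> motion" where
  "mot \<theta> = (cross n \<theta> / (2 * k), restrict (\<lambda>s. pair_of ((Z \<theta> s)\<^sup>2)) {0..cross n \<theta> / (2 * k)})"

lemma k2: "0 < 2 * k" using k by simp

lemma Z_eq_0_iff: "Z \<theta> s = 0 \<longleftrightarrow> W \<theta> (2 * k * s) = 0"
  using A by (simp add: Z_def)

lemma norm_square_scaled: "norm (pair_of ((of_real A * cis \<theta> * w)\<^sup>2)) = A\<^sup>2 * sqn w"
  by (simp add: norm_pair_of norm_power norm_mult power_mult_distrib sqn_eq_norm)

lemma card_image_div: "card ((\<lambda>t. t / (2 * k)) ` X) = card X" "finite ((\<lambda>t. t / (2 * k)) ` X) \<longleftrightarrow> finite X"
proof -
  have "inj_on (\<lambda>t. t / (2 * k)) X" using k by (auto simp: inj_on_def)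
  then show "card ((\<lambda>t. t / (2 * k)) ` X) = card X" "finite ((\<lambda>t. t / (2 * k)) ` X) \<longleftrightarrow> finite X"
    by (simp_all add: card_image finite_image_iff)
qed

lemma mot_in_EC:
  assumes G0: "G n \<theta> = 0"
  shows "mot \<theta> \<in> EC_motions n (k\<^sup>2)"
proof -
  define S where "S = cross n \<theta> / (2 * k)"
  note c = cross[OF n order_refl, of \<theta>]
  have kS: "2 * k * S = cross n \<theta>" using k by (simp add: S_def)
  have S: "0 < S" using c(5) k by (simp add: S_def)
  have sol': "hsol \<epsilon> \<theta> (2 * k * S) (W \<theta>) (P \<theta>)"
    unfolding kS by (rule hsol_subset[OF sol]) (use c(4) in simp)
  have "reg_sol (k\<^sup>2) S (\<lambda>s. Complex (Re (Z \<theta> s)) (Im (Z \<theta> s))) (\<lambda>s. of_real (2 * k * A) * cis \<theta> * P \<theta> (2 * k * s))"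
    unfolding complex_surj Z_def by (rule hsol_imp_reg_sol[OF sol'])
  then have reg: "reg_hill_solution (k\<^sup>2) S (\<lambda>s. Re (Z \<theta> s)) (\<lambda>s. Im (Z \<theta> s))"
    using reg_hill_solution_iff by blast
  have W_c: "W \<theta> (cross n \<theta>) = 0" using collision_iff[OF n order_refl] G0 by simp
  have zeros: "(Re (Z \<theta> s), Im (Z \<theta> s)) = (0, 0) \<longleftrightarrow> s = 0 \<or> s = S" if s: "s \<in> {0..S}" for s
  proof -
    have "(Re (Z \<theta> s), Im (Z \<theta> s)) = (0, 0) \<longleftrightarrow> Z \<theta> s = 0" by (simp add: complex_eq_iff)
    also have "\<dots> \<longleftrightarrow> W \<theta> (2 * k * s) = 0" by (rule Z_eq_0_iff)
    also have "\<dots> \<longleftrightarrow> s = 0 \<or> s = S"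
    proof
      assume W0: "W \<theta> (2 * k * s) = 0"
      show "s = 0 \<or> s = S"
      proof (cases "s = 0")
        case False
        then have "0 < 2 * k * s" "2 * k * s \<le> cross n \<theta>"
          using s k mult_left_mono[of s S "2 * k"] by (auto simp: kS)
        then have "2 * k * s = 2 * k * S" using first_collision[OF G0 _ _ W0] kS by simp
        then show ?thesis using k by simp
      qed simp
    next
      assume "s = 0 \<or> s = S"
      then show "W \<theta> (2 * k * s) = 0" using W_0 W_c kS by auto
    qed
    finally show ?thesis .
  qed
  have m: "mot \<theta> = (S, restrict (\<lambda>s. levi_civita (Re (Z \<theta> s), Im (Z \<theta> s))) {0..S})"
    by (simp add: mot_def S_def levi_civita_eq del: levi_civita.simps)
  have "local_max_times (mot \<theta>) = (\<lambda>t. t / (2 * k)) ` {t \<in> {0<..<2 * k * S}. \<forall>\<^sub>F t' in at t. sqn (W \<theta> t') \<le> sqn (W \<theta> t)}"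
    unfolding mot_def S_def[symmetric]
    by (rule local_max_times_scaled[OF k2, where A = A]) (use A norm_square_scaled in \<open>auto simp: Z_def\<close>)
  moreover have "\<bar>cross n \<theta> - real n * pi\<bar> \<le> 1/2" using c(1) by linarith
  ultimately have "finite (local_max_times (mot \<theta>)) \<and> card (local_max_times (mot \<theta>)) = n"
    using card_local_max_W[OF n, of "cross n \<theta>" \<theta>] c(4) unfolding kS by (simp add: card_image_div)
  then show ?thesis unfolding EC_motions_def using S reg zeros m by blast
qed

text \<open>The duration of the given motion is not known beforehand; the number of its maxima
  bounds it. If it lasted beyond \<open>T - 1/2\<close>, within 1/2 of (n + 1) pi, it would contain
  n + 1 maxima. So it ends at some close approach \<open>cross j \<theta>\<close>, and counting the
  maxima up to there gives j = n.\<close>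

lemma EC_is_mot:
  assumes m: "m \<in> EC_motions n (k\<^sup>2)"
  shows "\<exists>\<theta>. G n \<theta> = 0 \<and> m = mot \<theta>"
proof -
  obtain S u v where S: "0 < S" and reg: "reg_hill_solution (k\<^sup>2) S u v"
    and zeros: "\<And>s. s \<in> {0..S} \<Longrightarrow> (u s, v s) = (0, 0) \<longleftrightarrow> s = 0 \<or> s = S"
    and m_eq: "m = (S, restrict (\<lambda>s. levi_civita (u s, v s)) {0..S})"
    and fin: "finite (local_max_times m)" and card: "card (local_max_times m) = n"
    using m unfolding EC_motions_def by blast
  obtain Z' where "reg_sol (k\<^sup>2) S (\<lambda>s. Complex (u s) (v s)) Z'" using reg reg_hill_solution_iff by blast
  moreover have "Complex (u 0) (v 0) = 0" using zeros[of 0] S by (simp add: complex_eq_iff)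
  ultimately obtain \<theta> w p where sol': "hsol \<epsilon> \<theta> (2 * k * S) w p"
    and uv: "\<And>s. Complex (u s) (v s) = of_real A * cis \<theta> * w (2 * k * s)"
    using reg_sol_imp_hsol[of S "\<lambda>s. Complex (u s) (v s)" Z'] S by (metis less_imp_le)
  define T' where "T' = 2 * k * S"
  have T': "0 < T'" using S k by (simp add: T'_def)
  define T1 where "T1 = min T' T"
  have eq: "w t = W \<theta> t" if "t \<in> {0..T1}" for t
    by (rule sol_unique(1)[OF hsol_subset[OF sol', folded T'_def, of T1] _ that]) (auto simp: T1_def)
  have lc: "levi_civita (u s, v s) = pair_of ((of_real A * cis \<theta> * w (2 * k * s))\<^sup>2)" for s
    using levi_civita_eq[of "Complex (u s) (v s)"] unfolding complex.sel by (simp only: uv)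
  have lm: "local_max_times m = (\<lambda>t. t / (2 * k)) ` {t \<in> {0<..<T'}. \<forall>\<^sub>F t' in at t. sqn (w t') \<le> sqn (w t)}"
    unfolding m_eq T'_def
    by (rule local_max_times_scaled[OF k2, where A = A])
       (use A norm_square_scaled in \<open>auto simp: lc simp del: levi_civita.simps\<close>)
  define M where "M x = {t \<in> {0<..<x}. \<forall>\<^sub>F t' in at t. sqn (W \<theta> t') \<le> sqn (W \<theta> t)}" for x
  have M_eq: "{t \<in> {0<..<x}. \<forall>\<^sub>F t' in at t. sqn (w t') \<le> sqn (w t)} = M x" if x: "x \<le> T1" for x
  proof -
    have "(\<forall>\<^sub>F t' in at t. sqn (w t') \<le> sqn (w t)) \<longleftrightarrow> (\<forall>\<^sub>F t' in at t. sqn (W \<theta> t') \<le> sqn (W \<theta> t))"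
      if t: "t \<in> {0<..<x}" for t
    proof -
      have "\<forall>\<^sub>F t' in at t. t' \<in> {0<..<x}" using t by (intro eventually_at_in_open') auto
      then show ?thesis by (rule eventually_subst[OF eventually_mono]) (use eq t x in auto)
    qed
    then show ?thesis unfolding M_def by blast
  qed
  have T'_le: "T' \<le> T - 1/2"
  proof (rule ccontr)
    assume "\<not> T' \<le> T - 1/2"
    then have x: "T - 1/2 \<le> T1" "T - 1/2 \<le> T'" by (auto simp: T1_def)
    have "finite (M (T - 1/2)) \<and> card (M (T - 1/2)) = n + 1"
      unfolding M_def by (rule card_local_max_W) (simp_all add: T algebra_simps)
    moreover have "M (T - 1/2) \<subseteq> {t \<in> {0<..<T'}. \<forall>\<^sub>F t' in at t. sqn (w t') \<le> sqn (w t)}"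
      unfolding M_eq[OF x(1), symmetric] using x(2) by (intro Collect_mono) auto
    ultimately have "n + 1 \<le> card {t \<in> {0<..<T'}. \<forall>\<^sub>F t' in at t. sqn (w t') \<le> sqn (w t)}"
      using fin unfolding lm card_image_div by (metis card_mono)
    then show False using card unfolding lm card_image_div by simp
  qed
  then have T1: "T1 = T'" by (simp add: T1_def)
  have "(u S, v S) = (0, 0)" using zeros[of S] S by simp
  then have "Complex (u S) (v S) = 0" by (simp add: complex_eq_iff)
  then have "w T' = 0" using A unfolding uv T'_def by simp
  then have W0: "W \<theta> T' = 0" using eq[of T'] T' T1 by simp
  obtain j where j: "1 \<le> j" "j \<le> n" "T' = cross j \<theta>" "G j \<theta> = 0"
    using zero_is_cross[OF T' T'_le W0] by metis
  have "\<bar>T' - real j * pi\<bar> \<le> 1/2" using cross(1)[OF j(1,2), of \<theta>] unfolding j(3) by linarith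
  then have "card (M T') = j" unfolding M_def using card_local_max_W[OF j(1)] T'_le by auto
  then have "j = n" using card M_eq[of T'] T1 unfolding lm card_image_div by simp
  then have c: "T' = cross n \<theta>" "G n \<theta> = 0" using j by auto
  have SS: "cross n \<theta> / (2 * k) = S" using c(1) k by (simp add: T'_def field_simps)
  have "m = mot \<theta>"
    unfolding m_eq mot_def SS lc
  proof (intro arg_cong[of _ _ "Pair S"] restrict_ext)
    fix s assume "s \<in> {0..S}"
    then have "2 * k * s \<in> {0..T1}" using k by (simp add: T1 T'_def)
    then show "pair_of ((of_real A * cis \<theta> * w (2 * k * s))\<^sup>2) = pair_of ((Z \<theta> s)\<^sup>2)" by (simp add: Z_def eq)
  qed
  then show ?thesis using c(2) by blast
qed

lemma EC_motions_eq: "EC_motions n (k\<^sup>2) = {mot \<theta> |\<theta>. G n \<theta> = 0}"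
  using mot_in_EC EC_is_mot by blast

section \<open>Orbits as point sets: symmetries and distinctness\<close>

definition orb :: "real \<Rightarrow> complex set" where
  "orb \<theta> = (\<lambda>t. of_real (A\<^sup>2) * (cis (2 * \<theta>) * (W \<theta> t)\<^sup>2)) ` {0..cross n \<theta>}"

lemma Z_square: "(Z \<theta> s)\<^sup>2 = of_real (A\<^sup>2) * (cis (2 * \<theta>) * (W \<theta> (2 * k * s))\<^sup>2)"
  by (simp add: Z_def power_mult_distrib power2_eq_square[of "cis \<theta>"] cis_mult)

lemma orbit_mot: "orbit (mot \<theta>) = pair_of ` orb \<theta>"
proof -
  have "{0..cross n \<theta>} = (\<lambda>s. 2 * k * s) ` {0..cross n \<theta> / (2 * k)}"
    using k cross(4)[OF n order_refl, of \<theta>] by (simp add: image_mult_atLeastAtMost)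
  then show ?thesis by (simp add: orbit_def mot_def orb_def image_image Z_square)
qed

text \<open>Two quarter turns replace (u, v) by (-u, -v), which squaring identifies. The infinitely
  many zeros of \<open>G n\<close> thereby collapse to two motions for each of the two basic
  angles.\<close>

lemma mot_quarter_turns:
  "mot (\<theta> + of_int (2 * m) * pi / 2) = mot \<theta>"
  "mot (\<theta> + of_int (2 * m + 1) * pi / 2) = mot (\<theta> + pi / 2)"
proof -
  have gen: "mot (\<theta> + of_int i * pi / 2) = mot (\<theta> + of_int j * pi / 2)" if ev: "even (i - j)" for i j
  proof -
    obtain l where "i - j = 2 * l" using evenE[OF ev] by blast
    then have l: "i = j + 2 * l" by simp
    have "cis (2 * (\<theta> + of_int i * pi / 2)) = cis (2 * (\<theta> + of_int j * pi / 2)) * cis (of_int (2 * l) * pi)"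
      unfolding cis_mult by (rule arg_cong[of _ _ cis]) (simp add: l field_simps)
    also have "cis (of_int (2 * l) * pi) = 1" by (simp only: complex_eq_iff cis.sel cos_int_pi sin_int_pi) simp
    finally have cis_eq: "cis (2 * (\<theta> + of_int i * pi / 2)) = cis (2 * (\<theta> + of_int j * pi / 2))" by simp
    have "(Z (\<theta> + of_int i * pi / 2) s)\<^sup>2 = (Z (\<theta> + of_int j * pi / 2) s)\<^sup>2"
      if "s \<in> {0..cross n \<theta> / (2 * k)}" for s
    proof -
      have "2 * k * s \<in> {0..T}" using that k cross(4)[OF n order_refl, of \<theta>] by (auto simp: field_simps)
      then show ?thesis unfolding Z_square cis_eq by (simp only: W_P_quarter_turn)
    qed
    then show ?thesis unfolding mot_def G_quarter_turn(1)[OF n order_refl] by (auto intro: restrict_ext)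
  qed
  show "mot (\<theta> + of_int (2 * m) * pi / 2) = mot \<theta>" using gen[of "2 * m" 0] by simp
  show "mot (\<theta> + of_int (2 * m + 1) * pi / 2) = mot (\<theta> + pi / 2)" using gen[of "2 * m + 1" 1] by simp
qed

lemma orb_quarter_turn: "orb (\<theta> + pi / 2) = uminus ` orb \<theta>"
proof -
  have q: "W (\<theta> + pi / 2) t = W \<theta> t" if "t \<in> {0..T}" for t using W_P_quarter_turn(1)[OF that, of \<theta> 1] by simp
  have c: "cross n (\<theta> + pi / 2) = cross n \<theta>" using G_quarter_turn(1)[OF n order_refl, of \<theta> 1] by simp
  have "cis (2 * (\<theta> + pi / 2)) = - cis (2 * \<theta>)" by (simp add: complex_eq_iff algebra_simps)
  then show ?thesis
    unfolding orb_def c image_image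
    by (intro image_cong refl) (use cross(4)[OF n order_refl, of \<theta>] q in auto)
qed

text \<open>Reversing time about the midpoint of the arc conjugates the projected curve up to the
  sign \<open>cis (i * pi)\<close>: symmetry in the x axis for even i, in the y axis for odd
  i.\<close>

lemma orb_reversal:
  fixes i :: int
  assumes "\<bar>\<theta> - i * pi / 4\<bar> \<le> 1/20" "G n \<theta> = 0"
  shows "cnj ` orb \<theta> = (if even i then orb \<theta> else uminus ` orb \<theta>)"
proof -
  define c where "c = cross n \<theta>"
  obtain \<alpha> where \<alpha>: "\<theta> = i * pi / 4 - \<alpha> / 2" "(P \<theta> c)\<^sup>2 = cis (2 * \<alpha>)"
    and rev: "\<And>t. t \<in> {0..c} \<Longrightarrow> W \<theta> t = - P \<theta> c * cnj (W \<theta> (c - t))"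
    using collision_reversal[OF n order_refl assms] unfolding c_def by metis
  define f where "f t = of_real (A\<^sup>2) * (cis (2 * \<theta>) * (W \<theta> t)\<^sup>2)" for t
  define s :: complex where "s = (if even i then 1 else - 1)"
  have f_rev: "f t = s * cnj (f (c - t))" if "t \<in> {0..c}" for t
  proof -
    have "(W \<theta> t)\<^sup>2 = cis (2 * \<alpha>) * cnj ((W \<theta> (c - t))\<^sup>2)"
      unfolding rev[OF that] by (simp add: power_mult_distrib \<alpha>(2))
    moreover have "cis (2 * \<theta>) * cis (2 * \<alpha>) = cis (i * pi) * cnj (cis (2 * \<theta>))"
      unfolding cis_cnj cis_mult by (simp add: \<alpha>(1) algebra_simps)
    moreover have "cis (i * pi) = s" by (simp add: s_def complex_eq_iff cos_int_pi)
    ultimately show ?thesis unfolding f_def by (simp add: mult_ac)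
  qed
  have img: "(\<lambda>t. c - t) ` {0..c} = {0..c}" by (simp add: image_diff_atLeastAtMost)
  have "orb \<theta> = f ` {0..c}" unfolding orb_def f_def c_def ..
  also have "\<dots> = (\<lambda>t. s * cnj (f (c - t))) ` {0..c}" by (rule image_cong[OF refl f_rev])
  also have "\<dots> = (\<lambda>z. s * cnj z) ` f ` (\<lambda>t. c - t) ` {0..c}" by (simp only: image_image)
  also have "\<dots> = (\<lambda>z. s * cnj z) ` f ` {0..c}" by (simp only: img)
  also have "\<dots> = (\<lambda>z. s * cnj z) ` orb \<theta>" unfolding orb_def f_def c_def ..
  finally have o: "orb \<theta> = (\<lambda>z. s * cnj z) ` orb \<theta>" .
  show ?thesis
  proof (cases "even i")
    case True
    then show ?thesis using o by (simp add: s_def)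
  next
    case False
    then have "orb \<theta> = uminus ` (cnj ` orb \<theta>)" using o by (simp add: s_def image_image)
    then have "uminus ` orb \<theta> = uminus ` uminus ` cnj ` orb \<theta>" by (rule arg_cong)
    then show ?thesis using False by (simp add: image_image)
  qed
qed

text \<open>Up to the factor A^2 the orbit stays close to a segment of a half-axis. The allowance
  1/5 covers 1/10 from the window for 2 \<theta> and 3 e from the oscillator; this coarse location
  suffices to tell the four orbits apart.\<close>

lemma orb_near_axis:
  fixes j :: int
  assumes "\<bar>\<theta> - j * pi / 4\<bar> \<le> 1/20" "t \<in> {0..cross n \<theta>}"
  shows "norm (cis (2 * \<theta>) * (W \<theta> t)\<^sup>2 - cis (j * pi / 2) * of_real ((sin t)\<^sup>2)) \<le> 1/5"
proof -
  have t: "t \<in> {0..T}" using assms(2) cross(4)[OF n order_refl, of \<theta>] by simp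
  have "norm (W \<theta> t * W \<theta> t - of_real (sin t) * of_real (sin t)) \<le> (101/100 * 1 + 1 * 1) * e"
    by (rule norm_mult_diff_le) (use near_sin(1)[OF t, of \<theta>] norm_W_P_le(1)[OF t, of \<theta>] e_pos in auto)
  then have 1: "norm ((W \<theta> t)\<^sup>2 - of_real ((sin t)\<^sup>2)) \<le> 3 * e * 1"
    using e_pos by (simp add: power2_eq_square)
  have "norm (cis (2 * \<theta>) - cis (j * pi / 2)) \<le> \<bar>2 * \<theta> - j * pi / 2\<bar>" by (rule norm_cis_diff_le)
  also have "\<dots> = 2 * \<bar>\<theta> - j * pi / 4\<bar>" by (simp add: abs_if)
  also have "\<dots> \<le> 1/10 * 1" using assms(1) by simp
  finally have 2: "norm (cis (2 * \<theta>) - cis (j * pi / 2)) \<le> 1/10 * 1" .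
  have "norm (complex_of_real ((sin t)\<^sup>2)) \<le> 1" by (simp add: norm_power abs_square_le_1)
  from norm_mult_diff_le[OF _ this 2 1, of 1]
  have "norm (cis (2 * \<theta>) * (W \<theta> t)\<^sup>2 - cis (j * pi / 2) * of_real ((sin t)\<^sup>2)) \<le> (1 * (3 * e) + 1 * (1/10)) * 1"
    using e_pos by simp
  also have "\<dots> \<le> 1/5" using small by simp
  finally show ?thesis .
qed

lemma quarter_in_range: "pi / 2 \<in> {0..cross n \<theta>}"
  using cross(5)[OF n order_refl, of \<theta>] pi_approx by simp

lemma orb_along_x:
  assumes "\<bar>\<theta>\<bar> \<le> 1/20"
  shows "z \<in> orb \<theta> \<Longrightarrow> - (A\<^sup>2 * (1/5)) \<le> Re z" "\<exists>z\<in>orb \<theta>. A\<^sup>2 * (4/5) \<le> Re z"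
proof -
  have near: "(sin t)\<^sup>2 - 1/5 \<le> Re (cis (2 * \<theta>) * (W \<theta> t)\<^sup>2)" if "t \<in> {0..cross n \<theta>}" for t
    using orb_near_axis[of \<theta> 0 t] abs_Re_le_cmod[of "cis (2 * \<theta>) * (W \<theta> t)\<^sup>2 - of_real ((sin t)\<^sup>2)"] assms that
    unfolding minus_complex.sel Re_complex_of_real abs_le_iff by simp
  have scale: "Re (of_real (A\<^sup>2) * y) = A\<^sup>2 * Re y" for y by (simp del: of_real_power)
  show "- (A\<^sup>2 * (1/5)) \<le> Re z" if z: "z \<in> orb \<theta>"
  proof -
    obtain t where t: "t \<in> {0..cross n \<theta>}" "z = of_real (A\<^sup>2) * (cis (2 * \<theta>) * (W \<theta> t)\<^sup>2)"
      using z by (auto simp: orb_def)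
    have "- (1/5) \<le> Re (cis (2 * \<theta>) * (W \<theta> t)\<^sup>2)" using near[OF t(1)] zero_le_power2[of "sin t"] by linarith
    from mult_left_mono[OF this, of "A\<^sup>2"] show ?thesis unfolding t(2) scale by simp
  qed
  have "4/5 \<le> Re (cis (2 * \<theta>) * (W \<theta> (pi / 2))\<^sup>2)" using near[OF quarter_in_range] by simp
  from mult_left_mono[OF this, of "A\<^sup>2"]
  have "A\<^sup>2 * (4/5) \<le> Re (of_real (A\<^sup>2) * (cis (2 * \<theta>) * (W \<theta> (pi / 2))\<^sup>2))" unfolding scale by simp
  then show "\<exists>z\<in>orb \<theta>. A\<^sup>2 * (4/5) \<le> Re z" unfolding orb_def using quarter_in_range by blast
qed

lemma orb_along_y:
  assumes "\<bar>\<theta> - pi / 4\<bar> \<le> 1/20"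
  shows "z \<in> orb \<theta> \<Longrightarrow> \<bar>Re z\<bar> \<le> A\<^sup>2 * (1/5)" "z \<in> orb \<theta> \<Longrightarrow> - (A\<^sup>2 * (1/5)) \<le> Im z"
    "\<exists>z\<in>orb \<theta>. A\<^sup>2 * (4/5) \<le> Im z"
proof -
  have near: "(sin t)\<^sup>2 - 1/5 \<le> Im (cis (2 * \<theta>) * (W \<theta> t)\<^sup>2)" "\<bar>Re (cis (2 * \<theta>) * (W \<theta> t)\<^sup>2)\<bar> \<le> 1/5"
    if "t \<in> {0..cross n \<theta>}" for t
  proof -
    define y where "y = cis (2 * \<theta>) * (W \<theta> t)\<^sup>2"
    have "norm (y - \<i> * of_real ((sin t)\<^sup>2)) \<le> 1/5"
      using orb_near_axis[of \<theta> 1 t] assms that by (simp add: y_def)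
    then have "\<bar>Re (y - \<i> * of_real ((sin t)\<^sup>2))\<bar> \<le> 1/5" "\<bar>Im (y - \<i> * of_real ((sin t)\<^sup>2))\<bar> \<le> 1/5"
      using abs_Re_le_cmod abs_Im_le_cmod order_trans by blast+
    moreover have "Re (y - \<i> * of_real r) = Re y" "Im (y - \<i> * of_real r) = Im y - r" for r by simp_all
    ultimately have "\<bar>Re y\<bar> \<le> 1/5" "\<bar>Im y - (sin t)\<^sup>2\<bar> \<le> 1/5" by metis+
    then show "(sin t)\<^sup>2 - 1/5 \<le> Im (cis (2 * \<theta>) * (W \<theta> t)\<^sup>2)" "\<bar>Re (cis (2 * \<theta>) * (W \<theta> t)\<^sup>2)\<bar> \<le> 1/5"
      unfolding y_def by linarith+
  qed
  have scale: "Re (of_real (A\<^sup>2) * y) = A\<^sup>2 * Re y" "Im (of_real (A\<^sup>2) * y) = A\<^sup>2 * Im y" for y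
    by (simp_all del: of_real_power)
  show "\<bar>Re z\<bar> \<le> A\<^sup>2 * (1/5)" "- (A\<^sup>2 * (1/5)) \<le> Im z" if z: "z \<in> orb \<theta>"
  proof -
    obtain t where t: "t \<in> {0..cross n \<theta>}" "z = of_real (A\<^sup>2) * (cis (2 * \<theta>) * (W \<theta> t)\<^sup>2)"
      using z by (auto simp: orb_def)
    have "- (1/5) \<le> Im (cis (2 * \<theta>) * (W \<theta> t)\<^sup>2)" using near(1)[OF t(1)] zero_le_power2[of "sin t"] by linarith
    from mult_left_mono[OF this, of "A\<^sup>2"] show "- (A\<^sup>2 * (1/5)) \<le> Im z" unfolding t(2) scale by simp
    from mult_left_mono[OF near(2)[OF t(1)], of "A\<^sup>2"] show "\<bar>Re z\<bar> \<le> A\<^sup>2 * (1/5)"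
      unfolding t(2) scale abs_mult by simp
  qed
  have "4/5 \<le> Im (cis (2 * \<theta>) * (W \<theta> (pi / 2))\<^sup>2)" using near(1)[OF quarter_in_range] by simp
  from mult_left_mono[OF this, of "A\<^sup>2"]
  have "A\<^sup>2 * (4/5) \<le> Im (of_real (A\<^sup>2) * (cis (2 * \<theta>) * (W \<theta> (pi / 2))\<^sup>2))" unfolding scale by simp
  then show "\<exists>z\<in>orb \<theta>. A\<^sup>2 * (4/5) \<le> Im z" unfolding orb_def using quarter_in_range by blast
qed

text \<open>Points near the tips serve as witnesses: \<open>z0\<close> extends to at least 4/5 of
  A^2 along the positive x axis and \<open>z1\<close> along the positive y axis, while the orbits to
  be told apart from them reach at most 1/5 in these directions.\<close>

lemma orbs_distinct:
  assumes "\<bar>\<theta>0\<bar> \<le> 1/20" "\<bar>\<theta>1 - pi / 4\<bar> \<le> 1/20"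
  shows "distinct [orb \<theta>0, uminus ` orb \<theta>0, orb \<theta>1, uminus ` orb \<theta>1]"
proof -
  define a where "a = A\<^sup>2"
  have a: "0 < a" using A by (simp add: a_def)
  note x = orb_along_x[OF assms(1), folded a_def] and y = orb_along_y[OF assms(2), folded a_def]
  have um: "z \<in> uminus ` X \<longleftrightarrow> - z \<in> X" for z :: complex and X by force
  obtain z0 where z0: "z0 \<in> orb \<theta>0" "a * (4/5) \<le> Re z0" using x(2) by blast
  obtain z1 where z1: "z1 \<in> orb \<theta>1" "a * (4/5) \<le> Im z1" using y(3) by blast
  have "z0 \<notin> uminus ` orb \<theta>0" "z0 \<notin> orb \<theta>1" "z0 \<notin> uminus ` orb \<theta>1" "- z0 \<notin> orb \<theta>1" "- z0 \<notin> uminus ` orb \<theta>1"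
    unfolding um using z0(2) a x(1)[of "- z0"] y(1)[of z0] y(1)[of "- z0"] by (auto simp: abs_le_iff)
  moreover have "z1 \<notin> uminus ` orb \<theta>1" unfolding um using z1(2) a y(2)[of "- z1"] by auto
  moreover have "- z0 \<in> uminus ` orb \<theta>0" using z0(1) by blast
  ultimately show ?thesis using z0(1) z1(1) by auto
qed

theorem four_EC_motions:
  "\<exists>\<alpha> \<gamma> \<beta> \<delta>.
      EC_motions n (k\<^sup>2) = {\<alpha>, \<gamma>, \<beta>, \<delta>} \<and>
      distinct [orbit \<alpha>, orbit \<gamma>, orbit \<beta>, orbit \<delta>] \<and>
      reflect_x_axis ` orbit \<alpha> = orbit \<alpha> \<and>
      reflect_x_axis ` orbit \<gamma> = orbit \<gamma> \<and>
      reflect_y_axis ` orbit \<alpha> = orbit \<gamma> \<and>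
      reflect_y_axis ` orbit \<beta> = orbit \<beta> \<and>
      reflect_y_axis ` orbit \<delta> = orbit \<delta> \<and>
      reflect_x_axis ` orbit \<beta> = orbit \<delta>"
proof -
  obtain \<theta>0 where \<theta>0: "\<bar>\<theta>0\<bar> \<le> 1/20" "G n \<theta>0 = 0" using G_zero_exists[OF n order_refl, of 0] by auto
  obtain \<theta>1 where \<theta>1: "\<bar>\<theta>1 - pi / 4\<bar> \<le> 1/20" "G n \<theta>1 = 0" using G_zero_exists[OF n order_refl, of 1] by auto
  have zeros: "G n \<theta> = 0 \<longleftrightarrow> (\<exists>m::int. \<theta> = \<theta>0 + m * pi / 2 \<or> \<theta> = \<theta>1 + m * pi / 2)" for \<theta>
    by (rule G_zeros[OF \<theta>0 \<theta>1])
  have turns: "mot (\<theta> + of_int m * pi / 2) \<in> {mot \<theta>, mot (\<theta> + pi / 2)}" for \<theta> and m :: int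
  proof (cases "even m")
    case True
    then obtain i where "m = 2 * i" by blast
    then show ?thesis using mot_quarter_turns(1) by simp
  next
    case False
    then obtain i where "m = 2 * i + 1" by (elim oddE)
    then show ?thesis using mot_quarter_turns(2) by simp
  qed
  have "{mot \<theta> |\<theta>. G n \<theta> = 0} = {mot \<theta>0, mot (\<theta>0 + pi / 2), mot \<theta>1, mot (\<theta>1 + pi / 2)}" (is "?L = ?R")
  proof (intro subset_antisym subsetI)
    fix m assume "m \<in> ?L"
    then obtain \<theta> where "m = mot \<theta>" "G n \<theta> = 0" by blast
    then show "m \<in> ?R" using zeros[of \<theta>] turns[of \<theta>0] turns[of \<theta>1] by auto
  next
    fix m assume m: "m \<in> ?R"
    have "G n (\<theta> + pi / 2) = 0 \<longleftrightarrow> G n \<theta> = 0" for \<theta> using G_quarter_turn(2)[OF n order_refl, of \<theta> 1] by simp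
    then show "m \<in> ?L" using m \<theta>0(2) \<theta>1(2) by auto
  qed
  then have EC: "EC_motions n (k\<^sup>2) = ?R" unfolding EC_motions_eq .
  have rev0: "cnj ` orb \<theta>0 = orb \<theta>0" using orb_reversal[of \<theta>0 0] \<theta>0 by simp
  have rev1: "cnj ` orb \<theta>1 = uminus ` orb \<theta>1" using orb_reversal[of \<theta>1 1] \<theta>1 by simp
  have refl: "reflect_x_axis ` pair_of ` X = pair_of ` cnj ` X"
    "reflect_y_axis ` pair_of ` X = pair_of ` uminus ` cnj ` X"
    "cnj ` uminus ` X = uminus ` cnj ` X" "uminus ` uminus ` X = X" for X
    by (simp_all add: image_image reflect_pair_of)
  have inj: "pair_of ` X = pair_of ` Y \<longleftrightarrow> X = Y" for X Y by (simp add: inj_image_eq_iff inj_pair_of)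
  show ?thesis
  \<comment> \<open>The zero near 0 gives the pair along the x axis, the zero near pi/4 the pair
    along the y axis. In each pair one orbit is the negative of the other, so the reflection that
    does not fix them exchanges them.\<close>
  proof (intro exI conjI)
    show "EC_motions n (k\<^sup>2) = {mot \<theta>0, mot (\<theta>0 + pi / 2), mot \<theta>1, mot (\<theta>1 + pi / 2)}" by (rule EC)
    show "distinct [orbit (mot \<theta>0), orbit (mot (\<theta>0 + pi / 2)), orbit (mot \<theta>1), orbit (mot (\<theta>1 + pi / 2))]"
      using orbs_distinct[OF \<theta>0(1) \<theta>1(1)] by (simp add: orbit_mot orb_quarter_turn inj)
  qed (simp_all only: orbit_mot orb_quarter_turn refl rev0 rev1)
qed

end

section \<open>A threshold uniform in n\<close>

theorem corollary2:
  "\<exists>Lhat::real. Lhat > 0 \<and> (\<forall>L\<ge>Lhat. \<forall>n::nat. n \<ge> 1 \<longrightarrow>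
     (\<exists>\<alpha> \<gamma> \<beta> \<delta>.
        EC_motions n (L * real n powr (2/3)) = {\<alpha>, \<gamma>, \<beta>, \<delta>} \<and>
        distinct [orbit \<alpha>, orbit \<gamma>, orbit \<beta>, orbit \<delta>] \<and>
        reflect_x_axis ` orbit \<alpha> = orbit \<alpha> \<and>
        reflect_x_axis ` orbit \<gamma> = orbit \<gamma> \<and>
        reflect_y_axis ` orbit \<alpha> = orbit \<gamma> \<and>
        reflect_y_axis ` orbit \<beta> = orbit \<beta> \<and>
        reflect_y_axis ` orbit \<delta> = orbit \<delta> \<and>
        reflect_x_axis ` orbit \<beta> = orbit \<delta>))"
proof (intro exI[of _ "10 ^ 8"] conjI allI impI)
  fix L :: real and n :: nat
  assume L: "10 ^ 8 \<le> L" and n: "1 \<le> n"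
  define m where "m = real n powr (1/3)"
  have m0: "0 < m" using n by (simp add: m_def)
  have m2: "real n powr (2/3) = m\<^sup>2" and m3: "m ^ 3 = real n"
    using n by (simp_all add: m_def powr_power)
  define k where "k = sqrt (L * real n powr (2/3))"
  have K: "k\<^sup>2 = L * real n powr (2/3)" using L by (simp add: k_def)
  \<comment> \<open>From L \<ge> 10^8 follows k \<ge> 10^4 n^(1/3), so \<epsilon> = 1/k^3 is at most
    10^(-12) / n. With T \<le> 8 n the product 32000 \<epsilon> T is below 10^(-6) for every
    n.\<close>
  have "(10 ^ 4 * m)\<^sup>2 \<le> L * real n powr (2/3)"
    using L unfolding m2 power_mult_distrib by (intro mult_right_mono) auto
  then have km: "10 ^ 4 * m \<le> k" unfolding k_def by (rule real_le_rsqrt)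
  then have k0: "0 < k" using m0 by (smt (verit) mult_pos_pos zero_less_power)
  have k3: "10 ^ 12 * real n \<le> k ^ 3"
    using power_mono[OF km, of 3] m0 m3 by (simp add: power_mult_distrib)
  define A where "A = sqrt 2 / k"
  define \<epsilon> where "\<epsilon> = A\<^sup>2 / (2 * k)"
  have A: "0 < A" "A\<^sup>2 * k\<^sup>2 = 2" using k0 by (simp_all add: A_def power_divide)
  have eps: "\<epsilon> = 1 / k ^ 3" using k0 by (simp add: \<epsilon>_def A_def power_divide power2_eq_square power3_eq_cube)
  then have eps0: "0 < \<epsilon>" using k0 by simp
  define T where "T = (real n + 1) * pi"
  have small: "32000 * \<epsilon> * T \<le> 1/1000000"
  proof -
    have "T \<le> (2 * real n) * 4" unfolding T_def using n pi_less_4 by (intro mult_mono) auto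
    then have "32000 * 1000000 * T \<le> 10 ^ 12 * real n" using n by simp
    also have "\<dots> \<le> k ^ 3" by (rule k3)
    finally show ?thesis unfolding eps using k0 by (simp add: field_simps)
  qed
  interpret hill_problem n \<epsilon> "32000 * \<epsilon> * T" T k A
    by unfold_locales (fact n eps0 T_def refl small k0 A \<epsilon>_def)+
  show "\<exists>\<alpha> \<gamma> \<beta> \<delta>.
        EC_motions n (L * real n powr (2/3)) = {\<alpha>, \<gamma>, \<beta>, \<delta>} \<and>
        distinct [orbit \<alpha>, orbit \<gamma>, orbit \<beta>, orbit \<delta>] \<and>
        reflect_x_axis ` orbit \<alpha> = orbit \<alpha> \<and>
        reflect_x_axis ` orbit \<gamma> = orbit \<gamma> \<and>
        reflect_y_axis ` orbit \<alpha> = orbit \<gamma> \<and>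
        reflect_y_axis ` orbit \<beta> = orbit \<beta> \<and>
        reflect_y_axis ` orbit \<delta> = orbit \<delta> \<and>
        reflect_x_axis ` orbit \<beta> = orbit \<delta>"
    using four_EC_motions unfolding K .
qed simp

end
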